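(* Let $d\in\mathbb{N}$, $d\ge 1$, let $E$ be a real normed space of dimension $d$ (identified with $\mathbb{R}^d$ through a fixed basis), let $\Omega\subset E$ be a nonempty convex open subset, and let $\boldsymbol{o}\in\Omega$ be the base point of $\Omega$. Put $$Y(\Omega)=\{\boldsymbol{g}\in L^1(\Omega,E):\ \operatorname{div}\boldsymbol{g}=0 \text{ in the sense of distributions on }\mathbb{R}^d\}.$$ Then the Lipschitz-free space $\mathcal{F}(\Omega)$ is canonically isometric to the quotient space $L^1(\Omega,E)/Y(\Omega)$. More precisely, there is a surjective linear isometry $\Phi\colon L^1(\Omega,E)/Y(\Omega)\to\mathcal{F}(\Omega)$ such that for every $\boldsymbol{a}\in\Omega$ and every $\boldsymbol{g}\in L^1(\Omega,E)$, $$\Phi([\boldsymbol{g}])=\delta(\boldsymbol{a})\quad\Longleftrightarrow\quad \operatorname{div}\boldsymbol{g}=\varepsilon_{\boldsymbol{o}}-\varepsilon_{\boldsymbol{a}}\ \text{ in the sense of distributions on }\mathbb{R}^d,$$ where $\varepsilon_{\boldsymbol{x}}$ denotes the Dirac measure supported at $\boldsymbol{x}$ and $[\boldsymbol{g}]$ is the class of $\boldsymbol{g}$ in the quotient.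
   Context: Lipschitz-free space: for a metric space $M$ with a distinguished base point $0\in M$, $\operatorname{Lip}_0(M)$ is the Banach space of all real-valued Lipschitz functions on $M$ vanishing at $0$, normed by the minimal Lipschitz constant. For $x\in M$, $\delta(x)\in\operatorname{Lip}_0(M)^*$ is the evaluation functional $\langle\delta(x),f\rangle=f(x)$. $\mathcal{F}(M)$ is the closed linear span of $\{\delta(x): x\in M\}$ in $\operatorname{Lip}_0(M)^*$ with the dual norm. Here $M=\Omega$ carries the metric induced by the norm of $E$, and its base point is $\boldsymbol{o}$. $E$ is identified with $\mathbb{R}^d$ by means of the coordinates with respect to a fixed basis of $E$, and Lebesgue measure $\lambda^d$ is transferred to $E$ by this identification. $L^1(\Omega,E)$ is the space of (classes of) integrable functions $\boldsymbol{f}\colon\Omega\to E$ with norm $\|\boldsymbol{f}\|=\int_\Omega\|\boldsymbol{f}(\boldsymbol{x})\|_E\,d\lambda^d(\boldsymbol{x})$; quotients of it carry the quotient norm. For $\boldsymbol{g}=(g_1,\dots,g_d)\in L^1(\Omega,E)$, "$\operatorname{div}\boldsymbol{g}$ in the sense of distributions on $\mathbb{R}^d$" means the distribution $\sum_{i=1}^d\partial_i g_i$ on $\mathbb{R}^d$, where $\boldsymbol{g}$ is first extended by zero outside $\Omega$ (so test functions range over $C_c^\infty(\mathbb{R}^d)$, not only over those supported in $\Omega$). *)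

theory Defs
  imports "HOL-Analysis.Analysis" "HOL-Probability.Giry_Monad"
begin

section \<open>Lipschitz-free spaces\<close>

text \<open>
  A real function on the metric space \<open>M\<close> is encoded as a function on the whole type that
  is \<open>0\<close> off \<open>M\<close>; likewise a functional on \<open>Lip0 M p\<close> is \<open>0\<close> off \<open>Lip0 M p\<close>. So equality of
  these objects is equality of HOL functions and the linear operations are pointwise.
\<close>

definition Lip0 :: "'a::metric_space set \<Rightarrow> 'a \<Rightarrow> ('a \<Rightarrow> real) set" where
  "Lip0 M p = {f. (\<exists>L. L-lipschitz_on M f) \<and> f p = 0 \<and> (\<forall>x. x \<notin> M \<longrightarrow> f x = 0)}"

definition lip_norm :: "'a::metric_space set \<Rightarrow> ('a \<Rightarrow> real) \<Rightarrow> real" where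
  "lip_norm M f = Inf {L. L-lipschitz_on M f}"

definition Lip0_dual :: "'a::metric_space set \<Rightarrow> 'a \<Rightarrow> (('a \<Rightarrow> real) \<Rightarrow> real) set" where
  "Lip0_dual M p = {\<psi>.
     (\<forall>f\<in>Lip0 M p. \<forall>h\<in>Lip0 M p. \<psi> (\<lambda>x. f x + h x) = \<psi> f + \<psi> h) \<and>
     (\<forall>c. \<forall>f\<in>Lip0 M p. \<psi> (\<lambda>x. c * f x) = c * \<psi> f) \<and>
     (\<exists>C. \<forall>f\<in>Lip0 M p. \<bar>\<psi> f\<bar> \<le> C * lip_norm M f) \<and>
     (\<forall>f. f \<notin> Lip0 M p \<longrightarrow> \<psi> f = 0)}"

definition dual_norm :: "'a::metric_space set \<Rightarrow> 'a \<Rightarrow> (('a \<Rightarrow> real) \<Rightarrow> real) \<Rightarrow> real" where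
  "dual_norm M p \<psi> = Sup {\<bar>\<psi> f\<bar> | f. f \<in> Lip0 M p \<and> lip_norm M f \<le> 1}"

definition delta :: "'a::metric_space set \<Rightarrow> 'a \<Rightarrow> 'a \<Rightarrow> ('a \<Rightarrow> real) \<Rightarrow> real" where
  "delta M p x = (\<lambda>f. if f \<in> Lip0 M p then f x else 0)"

definition delta_span :: "'a::metric_space set \<Rightarrow> 'a \<Rightarrow> (('a \<Rightarrow> real) \<Rightarrow> real) set" where
  "delta_span M p = {\<lambda>f. \<Sum>x\<in>S. c x * delta M p x f | S c. finite S \<and> S \<subseteq> M}"

definition lipschitz_free :: "'a::metric_space set \<Rightarrow> 'a \<Rightarrow> (('a \<Rightarrow> real) \<Rightarrow> real) set" where
  "lipschitz_free M p = {\<psi> \<in> Lip0_dual M p.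
     \<forall>e>0. \<exists>\<theta>\<in>delta_span M p. dual_norm M p (\<lambda>f. \<psi> f - \<theta> f) < e}"

section \<open>Coordinates and Lebesgue measure on a finite-dimensional normed space\<close>

text \<open>
  A basis of \<open>E\<close> is a family \<open>b\<close> over a finite index type \<open>'n\<close>, so \<open>d = CARD('n) \<ge> 1\<close>.
  The class \<open>second_countable_topology\<close>, which the library requires for vector-valued
  integrability, holds in every finite-dimensional normed space.
\<close>

definition is_basis :: "('n::finite \<Rightarrow> 'e::real_vector) \<Rightarrow> bool" where
  "is_basis b \<longleftrightarrow> inj b \<and> independent (range b) \<and> span (range b) = UNIV"

definition coord :: "('n::finite \<Rightarrow> 'e::real_vector) \<Rightarrow> 'n \<Rightarrow> 'e \<Rightarrow> real" where
  "coord b i x = representation (range b) x (b i)"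

definition lebesgue_basis :: "('n::finite \<Rightarrow> 'e::real_normed_vector) \<Rightarrow> 'e measure" where
  "lebesgue_basis b =
     completion (distr lborel borel (\<lambda>v::real^'n. \<Sum>i\<in>UNIV. (v $ i) *\<^sub>R b i))"

section \<open>Distributional divergence\<close>

primrec higher_differentiable :: "nat \<Rightarrow> ('e::real_normed_vector \<Rightarrow> real) \<Rightarrow> bool" where
  "higher_differentiable 0 \<phi> \<longleftrightarrow> continuous_on UNIV \<phi>"
| "higher_differentiable (Suc k) \<phi> \<longleftrightarrow>
     (\<forall>x. \<phi> differentiable (at x)) \<and>
     (\<forall>v. higher_differentiable k (\<lambda>x. frechet_derivative \<phi> (at x) v))"

definition test_functions :: "('e::real_normed_vector \<Rightarrow> real) set" where
  "test_functions = {\<phi>. (\<forall>k. higher_differentiable k \<phi>) \<and> compact (closure {x. \<phi> x \<noteq> 0})}"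

text \<open>
  In the coordinates given by \<open>b\<close>, the \<open>i\<close>-th partial derivative is the derivative in the
  direction \<open>b i\<close>. The field \<open>g\<close> below is defined on all of \<open>E\<close>.
\<close>

definition div_distribution ::
  "('n::finite \<Rightarrow> 'e::real_normed_vector) \<Rightarrow> ('e \<Rightarrow> 'e) \<Rightarrow> ('e \<Rightarrow> real) \<Rightarrow> real" where
  "div_distribution b g \<phi> =
     (\<Sum>i\<in>UNIV. - (LINT x|lebesgue_basis b.
        coord b i (g x) * frechet_derivative \<phi> (at x) (b i)))"

definition dirac_distribution :: "'e::real_normed_vector \<Rightarrow> ('e \<Rightarrow> real) \<Rightarrow> real" where
  "dirac_distribution x \<phi> = (LINT y|return borel x. \<phi> y)"

definition eq_distribution ::
  "(('e::real_normed_vector \<Rightarrow> real) \<Rightarrow> real) \<Rightarrow> (('e \<Rightarrow> real) \<Rightarrow> real) \<Rightarrow> bool" where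
  "eq_distribution T U \<longleftrightarrow> (\<forall>\<phi>\<in>test_functions. T \<phi> = U \<phi>)"

section \<open>The quotient of L1 by the divergence-free fields\<close>

text \<open>
  Elements of \<open>L1\<close> are functions, not classes, and are extended by \<open>0\<close> off \<open>\<Omega>\<close>. Since \<open>Y_space\<close>
  contains all null functions of \<open>L1\<close>, the quotient of this space by \<open>Y_space\<close> is the quotient
  of the space of almost-everywhere classes by the image of \<open>Y_space\<close>.
\<close>

definition L1 ::
  "('n::finite \<Rightarrow> 'e::{real_normed_vector, second_countable_topology}) \<Rightarrow> 'e set \<Rightarrow> ('e \<Rightarrow> 'e) set"
  where
  "L1 b \<Omega> = {g. set_integrable (lebesgue_basis b) \<Omega> g \<and> (\<forall>x. x \<notin> \<Omega> \<longrightarrow> g x = 0)}"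

definition L1_norm ::
  "('n::finite \<Rightarrow> 'e::{real_normed_vector, second_countable_topology}) \<Rightarrow> 'e set \<Rightarrow> ('e \<Rightarrow> 'e) \<Rightarrow> real"
  where
  "L1_norm b \<Omega> g = (LINT x:\<Omega>|lebesgue_basis b. norm (g x))"

definition Y_space ::
  "('n::finite \<Rightarrow> 'e::{real_normed_vector, second_countable_topology}) \<Rightarrow> 'e set \<Rightarrow> ('e \<Rightarrow> 'e) set"
  where
  "Y_space b \<Omega> = {g \<in> L1 b \<Omega>. eq_distribution (div_distribution b g) (\<lambda>_. 0)}"

definition Y_rel ::
  "('n::finite \<Rightarrow> 'e::{real_normed_vector, second_countable_topology}) \<Rightarrow> 'e set
    \<Rightarrow> (('e \<Rightarrow> 'e) \<times> ('e \<Rightarrow> 'e)) set"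
  where
  "Y_rel b \<Omega> = {(g, h). g \<in> L1 b \<Omega> \<and> h \<in> L1 b \<Omega> \<and> (\<lambda>x. g x - h x) \<in> Y_space b \<Omega>}"

definition Y_class ::
  "('n::finite \<Rightarrow> 'e::{real_normed_vector, second_countable_topology}) \<Rightarrow> 'e set
    \<Rightarrow> ('e \<Rightarrow> 'e) \<Rightarrow> ('e \<Rightarrow> 'e) set"
  where
  "Y_class b \<Omega> g = Y_rel b \<Omega> `` {g}"

definition quotient_norm ::
  "('n::finite \<Rightarrow> 'e::{real_normed_vector, second_countable_topology}) \<Rightarrow> 'e set
    \<Rightarrow> ('e \<Rightarrow> 'e) set \<Rightarrow> real"
  where
  "quotient_norm b \<Omega> c = Inf (L1_norm b \<Omega> ` c)"

text \<open>
  The vector space operations of the quotient are those of representatives, so linearity of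
  \<open>\<Phi>\<close> is stated through representatives. Being linear and norm preserving, \<open>\<Phi>\<close> is isometric.
\<close>

definition surjective_linear_isometry ::
  "('n::finite \<Rightarrow> 'e::{real_normed_vector, second_countable_topology}) \<Rightarrow> 'e set \<Rightarrow> 'e
    \<Rightarrow> (('e \<Rightarrow> 'e) set \<Rightarrow> ('e \<Rightarrow> real) \<Rightarrow> real) \<Rightarrow> bool"
  where
  "surjective_linear_isometry b \<Omega> p \<Phi> \<longleftrightarrow>
     \<Phi> ` (L1 b \<Omega> // Y_rel b \<Omega>) = lipschitz_free \<Omega> p \<and>
     (\<forall>g\<in>L1 b \<Omega>. \<forall>h\<in>L1 b \<Omega>.
        \<Phi> (Y_class b \<Omega> (\<lambda>x. g x + h x)) = (\<lambda>f. \<Phi> (Y_class b \<Omega> g) f + \<Phi> (Y_class b \<Omega> h) f)) \<and>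
     (\<forall>r. \<forall>g\<in>L1 b \<Omega>. \<Phi> (Y_class b \<Omega> (\<lambda>x. r *\<^sub>R g x)) = (\<lambda>f. r * \<Phi> (Y_class b \<Omega> g) f)) \<and>
     (\<forall>c\<in>L1 b \<Omega> // Y_rel b \<Omega>. dual_norm \<Omega> p (\<Phi> c) = quotient_norm b \<Omega> c)"

end

theory Submission
  imports Defs
begin

text \<open>
  Pairing \<open>g \<in> L1\<close> with the derivatives of test functions gives a functional, and \<open>g\<close> should be
  sent to the element of the free space that acts in this way on test functions. McShane
  extension, truncation by \<open>max 0 (n - L * norm x)\<close> and mollification approximate a Lipschitz
  function pointwise by test functions without increasing its Lipschitz constant, so that such an
  element is unique and its norm is at most that of \<open>g\<close>; no differentiability of Lipschitz
  functions is needed. Averaging the segments from \<open>x\<close> to the points of a small ball at the midpoint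
  of \<open>x\<close> and \<open>y\<close>, and from there to \<open>y\<close>, yields a field in \<open>L1\<close> of norm almost \<open>norm (x - y)\<close>
  that represents \<open>delta y - delta x\<close>. A finite-dimensional Hahn--Banach argument turns this into
  nearly optimal representing fields for all finite combinations of point evaluations, and a series
  gives them for the whole free space. This proves surjectivity and the remaining norm inequality
  without dualising \<open>L1\<close>. Conversely every field is represented, because fields with coefficients
  in the test functions are dense and integration by parts represents them by densities.
\<close>

section \<open>Lipschitz extension and a finite Hahn--Banach theorem\<close>

text \<open>Representation is tested on smooth functions only, whereas the free space consists of
  functionals on all Lipschitz functions. The bridge is that its members are norm limits of finite
  combinations of evaluations: along uniformly Lipschitz sequences they respect pointwise
  convergence, which arbitrary functionals on \<open>Lip0\<close> need not do. A unit flow along one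
  segment is, in dimension at least two, a singular vector measure and not an integrable field.
  Spreading it over a small ball at the midpoint makes it integrable at an arbitrarily small cost in
  length, and convexity keeps it inside \<Omega>. For a finite combination of evaluations the least
  norm of a representing field is a transport cost. A functional dominated by this cost is a
  function on the finite set, and the spindles force it to be 1-Lipschitz for the given norm: a
  finite form of Kantorovich--Rubinstein duality. On signs: the divergence of \<open>g\<close>
  tested on \<open>\<phi>\<close> is minus the integral of the derivative of \<open>\<phi>\<close>
  along \<open>g\<close>, so a flow from x to y has as divergence the Dirac measure at x minus that
  at y.\<close>

lemma lipschitz_on_extension_real:
  fixes f :: "'a::metric_space \<Rightarrow> real"
  assumes f: "L-lipschitz_on M f"
  obtains h where "L-lipschitz_on UNIV h" "\<And>x. x \<in> M \<Longrightarrow> h x = f x"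
proof (cases "M = {}")
  case True
  then show ?thesis
    using that[of "\<lambda>_. 0"] lipschitz_on_nonneg[OF f]
    by (auto intro: lipschitz_on_mono[OF lipschitz_on_constant])
next
  case False
  then obtain a where a: "a \<in> M" by blast
  have L: "0 \<le> L" by (rule lipschitz_on_nonneg[OF f])
  have fd: "\<bar>f x - f y\<bar> \<le> L * dist x y" if "x \<in> M" "y \<in> M" for x y
    using lipschitz_onD[OF f that] by (simp add: dist_real_def)
  \<comment> \<open>McShane's formula, which gives the largest \<open>L\<close>-Lipschitz extension.
    The fixed point \<open>a\<close> supplies a lower bound that makes the infimum
    meaningful.\<close>
  define h where "h x = (INF y\<in>M. f y + L * dist x y)" for x
  have bdd: "bdd_below ((\<lambda>y. f y + L * dist x y) ` M)" for x
  proof (rule bdd_belowI2)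
    fix y assume y: "y \<in> M"
    have "L * dist a y \<le> L * dist x a + L * dist x y"
      using mult_left_mono[OF dist_triangle[of a y x] L] by (simp add: dist_commute algebra_simps)
    then show "f a - L * dist x a \<le> f y + L * dist x y"
      using fd[OF a y] by linarith
  qed
  have le: "h x \<le> h z + L * dist x z" for x z
  proof -
    have "h x - L * dist x z \<le> f y + L * dist z y" if y: "y \<in> M" for y
    proof -
      have "h x \<le> f y + L * dist x y"
        unfolding h_def by (rule cINF_lower[OF bdd y])
      moreover have "L * dist x y \<le> L * dist x z + L * dist z y"
        using mult_left_mono[OF dist_triangle[of x y z] L] by (simp add: algebra_simps)
      ultimately show ?thesis by linarith
    qed
    then have "h x - L * dist x z \<le> h z"
      unfolding h_def[of z] by (intro cINF_greatest False)
    then show ?thesis by simp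
  qed
  show ?thesis
  proof (rule that[of h])
    show "L-lipschitz_on UNIV h"
    proof (rule lipschitz_onI[OF _ L])
      fix x y show "dist (h x) (h y) \<le> L * dist x y"
        using le[of x y] le[of y x] by (simp add: dist_real_def dist_commute)
    qed
    fix x assume x: "x \<in> M"
    have "h x \<le> f x" unfolding h_def using cINF_lower[OF bdd[of x] x] by simp
    moreover have "f x \<le> h x" unfolding h_def
    proof (rule cINF_greatest[OF False])
      fix y assume "y \<in> M" with fd[OF x this] show "f x \<le> f y + L * dist x y" by linarith
    qed
    ultimately show "h x = f x" by simp
  qed
qed

lemma lipschitz_on_min_max:
  fixes f g :: "'x::metric_space \<Rightarrow> real"
  assumes "L-lipschitz_on S f" "L-lipschitz_on S g"
  shows "L-lipschitz_on S (\<lambda>x. min (f x) (g x))" "L-lipschitz_on S (\<lambda>x. max (f x) (g x))"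
proof -
  have "dist (min (f x) (g x)) (min (f y) (g y)) \<le> L * dist x y"
    and "dist (max (f x) (g x)) (max (f y) (g y)) \<le> L * dist x y" if "x \<in> S" "y \<in> S" for x y
    using lipschitz_onD[OF assms(1) that] lipschitz_onD[OF assms(2) that]
    unfolding dist_real_def by linarith+
  then show "L-lipschitz_on S (\<lambda>x. min (f x) (g x))" "L-lipschitz_on S (\<lambda>x. max (f x) (g x))"
    using lipschitz_on_nonneg[OF assms(1)] by (blast intro: lipschitz_onI)+
qed

text \<open>Vectors are functions with pointwise operations. Homogeneity is asked for
  \<open>t > 0\<close> apart from the value at zero, because for an infimum it follows from a single
  inequality applied to \<open>t\<close> and to \<open>1 / t\<close>.\<close>

definition sublinear :: "(('i \<Rightarrow> real) \<Rightarrow> real) \<Rightarrow> bool" where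
  "sublinear q \<longleftrightarrow> (\<forall>u v. q (\<lambda>x. u x + v x) \<le> q u + q v) \<and>
     (\<forall>t>0. \<forall>u. q (\<lambda>x. t * u x) = t * q u) \<and> q (\<lambda>_. 0) = 0"

lemma sublinearD:
  assumes "sublinear q"
  shows "q (\<lambda>x. u x + v x) \<le> q u + q v"
    and "t \<ge> 0 \<Longrightarrow> q (\<lambda>x. t * u x) = t * q u"
    and "0 \<le> q u + q (\<lambda>x. - u x)"
proof -
  show 1: "q (\<lambda>x. u x + v x) \<le> q u + q v" for u v using assms by (simp add: sublinear_def)
  show "t \<ge> 0 \<Longrightarrow> q (\<lambda>x. t * u x) = t * q u"
    using assms by (cases "t = 0") (auto simp: sublinear_def)
  show "0 \<le> q u + q (\<lambda>x. - u x)"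
    using 1[of u "\<lambda>x. - u x"] assms by (simp add: sublinear_def)
qed

text \<open>The new functional is the infimum over \<open>t \<ge> 0\<close> of
  \<open>q (u + t e) - t q e\<close>, an expression that is subadditive and positively homogeneous
  in \<open>u\<close> and \<open>t\<close> jointly. Taking \<open>t = 1\<close> at
  \<open>- e\<close> forces the value there down to \<open>- q e\<close>, and sublinearity then
  keeps the value at \<open>e\<close> from dropping.\<close>

lemma sublinear_minorant_linear_at:
  assumes q: "sublinear q"
  obtains q' where "sublinear q'" "\<And>u. q' u \<le> q u" "q' (\<lambda>x. - e x) = - q e" "q' e = q e"
proof -
  define F where "F u t = q (\<lambda>x. u x + t * e x) - t * q e" for u t
  define q' where "q' u = (INF t\<in>{0..}. F u t)" for u
  note D = sublinearD[OF q]
  \<comment> \<open>Bounds the infimum from below, by writing \<open>t e\<close> as the sum of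
    \<open>u + t e\<close> and \<open>- u\<close>.\<close>
  have lower: "- q (\<lambda>x. - u x) \<le> F u t" if "t \<ge> 0" for u t
    using D(1)[of "\<lambda>x. u x + t * e x" "\<lambda>x. - u x"] D(2)[OF that, of e] by (simp add: F_def)
  then have bdd: "bdd_below (F u ` {0..})" for u by (intro bdd_belowI2) auto
  have le: "q' u \<le> F u t" if "t \<ge> 0" for u t
    unfolding q'_def using that by (intro cINF_lower bdd) auto
  have ge: "m \<le> q' u" if "\<And>t. t \<ge> 0 \<Longrightarrow> m \<le> F u t" for u m
    unfolding q'_def using that by (intro cINF_greatest) auto
  have qq: "q' u \<le> q u" for u using le[of 0 u] by (simp add: F_def)
  have add: "q' (\<lambda>x. u x + v x) \<le> q' u + q' v" for u v
  proof -
    have "q' (\<lambda>x. u x + v x) - F u s \<le> q' v" if s: "s \<ge> 0" for s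
    proof (rule ge)
      fix t :: real assume t: "t \<ge> 0"
      have "F (\<lambda>x. u x + v x) (s + t) \<le> F u s + F v t"
        using D(1)[of "\<lambda>x. u x + s * e x" "\<lambda>x. v x + t * e x"] by (simp add: F_def algebra_simps)
      with le[of "s + t" "\<lambda>x. u x + v x"] s t show "q' (\<lambda>x. u x + v x) - F u s \<le> F v t" by simp
    qed
    then have "q' (\<lambda>x. u x + v x) - q' v \<le> q' u" by (intro ge) (simp add: algebra_simps)
    then show ?thesis by simp
  qed
  have homle: "q' (\<lambda>x. c * u x) \<le> c * q' u" if c: "c > 0" for c u
  proof -
    have "q' (\<lambda>x. c * u x) / c \<le> q' u"
    proof (rule ge)
      fix t :: real assume t: "t \<ge> 0"
      have "F (\<lambda>x. c * u x) (c * t) = c * F u t"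
        using D(2)[of c "\<lambda>x. u x + t * e x"] c by (simp add: F_def algebra_simps)
      then show "q' (\<lambda>x. c * u x) / c \<le> F u t"
        using le[of "c * t" "\<lambda>x. c * u x"] c t by (simp add: field_simps)
    qed
    then show ?thesis using c by (simp add: field_simps)
  qed
  have hom: "q' (\<lambda>x. c * u x) = c * q' u" if c: "c > 0" for c u
    using homle[OF c, of u] homle[of "1 / c" "\<lambda>x. c * u x"] c by (simp add: field_simps)
  have q0: "q (\<lambda>_. 0) = 0" using q by (simp add: sublinear_def)
  have z: "q' (\<lambda>_. 0) = 0"
    using qq[of "\<lambda>_. 0"] ge[of 0 "\<lambda>_. 0"] lower[of _ "\<lambda>_. 0"] q0 by fastforce
  have sub: "sublinear q'" using add hom z by (simp add: sublinear_def)
  have "q' (\<lambda>x. - e x) \<le> - q e" using le[of 1 "\<lambda>x. - e x"] q0 by (simp add: F_def)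
  with sublinearD(3)[OF sub, of e] qq[of e]
  have "q' (\<lambda>x. - e x) = - q e" "q' e = q e" by linarith+
  with sub qq show ?thesis by (intro that)
qed

text \<open>The vectors can be treated one after another: once a functional is linear along
  \<open>e\<close>, each sublinear minorant agrees with it at \<open>e\<close> and
  \<open>- e\<close>, since its two values there can only decrease while their sum stays
  nonnegative.\<close>

lemma sublinear_minorant_linear_on:
  assumes q: "sublinear q" and A: "finite A"
  obtains q' where "sublinear q'" "\<And>u. q' u \<le> q u" "\<And>e. e \<in> A \<Longrightarrow> q' (\<lambda>x. - e x) = - q' e"
proof -
  from A have "\<exists>q'. sublinear q' \<and> (\<forall>u. q' u \<le> q u) \<and> (\<forall>e\<in>A. q' (\<lambda>x. - e x) = - q' e)"
  proof induction
    case empty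
    then show ?case using q by blast
  next
    case (insert a A)
    then obtain r where r: "sublinear r" "\<And>u. r u \<le> q u" "\<And>e. e \<in> A \<Longrightarrow> r (\<lambda>x. - e x) = - r e"
      by blast
    obtain s where s: "sublinear s" "\<And>u. s u \<le> r u" "s (\<lambda>x. - a x) = - r a" "s a = r a"
      using sublinear_minorant_linear_at[OF r(1), of a] by blast
    have "s (\<lambda>x. - e x) = - s e" if "e \<in> A" for e
      using s(2)[of e] s(2)[of "\<lambda>x. - e x"] r(3)[OF that] sublinearD(3)[OF s(1), of e] by linarith
    moreover have "s u \<le> q u" for u using s(2)[of u] r(2)[of u] by linarith
    ultimately show ?case using s by (intro exI[of _ s]) auto
  qed
  then show ?thesis using that by blast
qed

lemma sublinear_sum_le:
  assumes q: "sublinear q" and "finite S"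
  shows "q (\<lambda>y. \<Sum>x\<in>S. u x y) \<le> (\<Sum>x\<in>S. q (u x))"
  using assms(2)
proof induction
  case empty
  then show ?case using q by (simp add: sublinear_def)
next
  case (insert a A)
  then show ?case using sublinearD(1)[OF q, of "u a" "\<lambda>y. \<Sum>x\<in>A. u x y"] by simp
qed

text \<open>
  Hahn--Banach on finitely many coordinates; \<open>f\<close> records the values of the dominated linear
  functional on the unit vectors.
\<close>

lemma sublinear_dominated_functional:
  fixes c :: "'i \<Rightarrow> real"
  assumes N: "sublinear N" and S: "finite S" and c: "\<And>x. x \<notin> S \<Longrightarrow> c x = 0"
  obtains f where "(\<Sum>x\<in>S. c x * f x) = N c"
    and "\<And>x y. x \<in> S \<Longrightarrow> y \<in> S \<Longrightarrow> f x - f y \<le> N (\<lambda>z. of_bool (z = x) - of_bool (z = y))"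
proof -
  define \<delta> :: "'i \<Rightarrow> 'i \<Rightarrow> real" where "\<delta> x = (\<lambda>z. of_bool (z = x))" for x
  \<comment> \<open>The value at \<open>c\<close> is pinned before the unit vectors are treated:
    every sublinear minorant of \<open>q0\<close> still takes the value \<open>N c\<close> at
    \<open>c\<close>.\<close>
  obtain q0 where q0: "sublinear q0" "\<And>u. q0 u \<le> N u" "q0 (\<lambda>x. - c x) = - N c" "q0 c = N c"
    using sublinear_minorant_linear_at[OF N, of c] by blast
  obtain q where q: "sublinear q" "\<And>u. q u \<le> q0 u"
      "\<And>e. e \<in> \<delta> ` S \<Longrightarrow> q (\<lambda>x. - e x) = - q e"
    using sublinear_minorant_linear_on[OF q0(1), of "\<delta> ` S"] S by auto
  note D = sublinearD[OF q(1)]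
  have qc: "q c = N c" "q (\<lambda>x. - c x) = - N c"
    using q(2)[of c] q(2)[of "\<lambda>x. - c x"] q0(3,4) D(3)[of c] by linarith+
  have scale: "q (\<lambda>z. t * \<delta> x z) = t * q (\<delta> x)" if "x \<in> S" for t x
  proof (cases "t \<ge> 0")
    case False
    then have "q (\<lambda>z. (- t) * - \<delta> x z) = (- t) * q (\<lambda>z. - \<delta> x z)"
      by (intro D(2)) auto
    then show ?thesis using q(3)[of "\<delta> x"] that by simp
  qed (rule D(2))
  have rep: "(\<Sum>x\<in>S. t x * \<delta> x z) = (if z \<in> S then t z else 0)" for t z
    using S by (simp add: \<delta>_def of_bool_def if_distrib[of "\<lambda>u. _ * u"] sum.delta cong: if_cong)
  show ?thesis
  proof (rule that[of "\<lambda>x. q (\<delta> x)"])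
    have "q c = q (\<lambda>z. \<Sum>x\<in>S. c x * \<delta> x z)"
      unfolding rep using c by (intro arg_cong[where f = q]) auto
    also have "\<dots> \<le> (\<Sum>x\<in>S. c x * q (\<delta> x))"
      using sublinear_sum_le[OF q(1) S, of "\<lambda>x z. c x * \<delta> x z"] by (simp add: scale)
    finally have 1: "N c \<le> (\<Sum>x\<in>S. c x * q (\<delta> x))" by (simp add: qc)
    \<comment> \<open>Domination alone gives one inequality; the reverse one comes from the
      expansion of \<open>- c\<close>, where the value is \<open>- N c\<close>.\<close>
    have "q (\<lambda>x. - c x) = q (\<lambda>z. \<Sum>x\<in>S. - c x * \<delta> x z)"
      unfolding rep using c by (intro arg_cong[where f = q]) auto
    also have "\<dots> \<le> (\<Sum>x\<in>S. - c x * q (\<delta> x))"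
      using sublinear_sum_le[OF q(1) S, of "\<lambda>x z. - c x * \<delta> x z"] by (simp only: scale cong: sum.cong)
    finally have "- N c \<le> - (\<Sum>x\<in>S. c x * q (\<delta> x))" by (simp add: qc sum_negf)
    with 1 show "(\<Sum>x\<in>S. c x * q (\<delta> x)) = N c" by simp
  next
    fix x y assume x: "x \<in> S" and y: "y \<in> S"
    have "q (\<delta> x) \<le> q (\<lambda>z. \<delta> x z - \<delta> y z) + q (\<delta> y)"
      using D(1)[of "\<lambda>z. \<delta> x z - \<delta> y z" "\<delta> y"] by simp
    moreover have "q (\<lambda>z. \<delta> x z - \<delta> y z) \<le> N (\<lambda>z. \<delta> x z - \<delta> y z)"
      by (rule order_trans[OF q(2) q0(2)])
    ultimately show "q (\<delta> x) - q (\<delta> y) \<le> N (\<lambda>z. of_bool (z = x) - of_bool (z = y))"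
      by (simp add: \<delta>_def)
  qed
qed

section \<open>Smooth functions and coordinates\<close>

lemma frechet_derivative_eqI:
  "(f has_derivative D) (at x) \<Longrightarrow> frechet_derivative f (at x) = D"
  using frechet_derivative_at by metis

text \<open>Smoothness can thus be proved from an explicit formula for the derivative, with no
  mention of the choice made in \<open>frechet_derivative\<close>.\<close>

lemma higher_differentiable_SucI:
  assumes "\<And>x. (f has_derivative D x) (at x)" "\<And>v. higher_differentiable k (\<lambda>x. D x v)"
  shows "higher_differentiable (Suc k) f"
proof -
  have "frechet_derivative f (at x) = D x" for x by (rule frechet_derivative_eqI[OF assms(1)])
  then show ?thesis using assms by (auto simp: differentiable_def)
qed

lemma higher_differentiable_SucD:
  assumes "higher_differentiable (Suc k) f"
  shows "(f has_derivative frechet_derivative f (at x)) (at x)"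
    and "higher_differentiable k (\<lambda>x. frechet_derivative f (at x) v)"
  using assms by (auto simp: frechet_derivative_works[symmetric])

lemma higher_differentiable_continuous:
  "higher_differentiable k f \<Longrightarrow> continuous_on UNIV f"
  by (cases k) (simp_all add: differentiable_imp_continuous_on differentiable_on_def
      differentiable_at_withinI)

lemma higher_differentiable_pred:
  "higher_differentiable (Suc k) f \<Longrightarrow> higher_differentiable k f"
proof (induction k arbitrary: f)
  case 0
  then show ?case using higher_differentiable_continuous[of "Suc 0" f] by simp
next
  case (Suc k)
  then show ?case by simp
qed

lemma higher_differentiable_const: "higher_differentiable k (\<lambda>_. c)"
proof (induction k arbitrary: c)
  case (Suc k)
  show ?case by (rule higher_differentiable_SucI[where D = "\<lambda>_ _. 0"]) (auto simp: Suc)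
qed simp

lemma higher_differentiable_add:
  "higher_differentiable k f \<Longrightarrow> higher_differentiable k g \<Longrightarrow> higher_differentiable k (\<lambda>x. f x + g x)"
proof (induction k arbitrary: f g)
  case (Suc k)
  note D = higher_differentiable_SucD[OF Suc.prems(1)] higher_differentiable_SucD[OF Suc.prems(2)]
  show ?case
    by (rule higher_differentiable_SucI[OF has_derivative_add[OF D(1,3)]])
      (intro Suc.IH D)
qed (auto intro: continuous_on_add)

lemma higher_differentiable_mult:
  "higher_differentiable k f \<Longrightarrow> higher_differentiable k g \<Longrightarrow> higher_differentiable k (\<lambda>x. f x * g x)"
proof (induction k arbitrary: f g)
  case (Suc k)
  note D = higher_differentiable_SucD[OF Suc.prems(1)] higher_differentiable_SucD[OF Suc.prems(2)]
  show ?case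
    by (rule higher_differentiable_SucI[OF has_derivative_mult[OF D(1,3)]])
      (intro higher_differentiable_add Suc.IH D Suc.prems[THEN higher_differentiable_pred])
qed (auto intro: continuous_on_mult)

lemma higher_differentiable_prod:
  "finite I \<Longrightarrow> (\<And>i. i \<in> I \<Longrightarrow> higher_differentiable k (f i))
    \<Longrightarrow> higher_differentiable k (\<lambda>x. \<Prod>i\<in>I. f i x)"
  by (induction I rule: finite_induct)
    (auto intro: higher_differentiable_mult higher_differentiable_const)

text \<open>The classical flat function is the case \<open>m = 0\<close>. The extra powers of
  \<open>1 / t\<close> make the family closed, up to linear combinations, under differentiation, so
  that one induction with \<open>m\<close> arbitrary yields derivatives of all orders.\<close>

definition flat_exp :: "nat \<Rightarrow> real \<Rightarrow> real" where
  "flat_exp m t = (if t > 0 then inverse t ^ m * exp (- inverse t) else 0)"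

text \<open>From the right, \<open>u = 1 / t\<close> turns the expression into
  \<open>u ^ m / exp u\<close> at infinity; from the left the function is zero.\<close>

lemma flat_exp_tendsto_0: "(flat_exp m \<longlongrightarrow> 0) (at 0)"
proof -
  have "((\<lambda>u. u ^ m / exp u) \<longlongrightarrow> (0::real)) at_top" by (rule tendsto_power_div_exp_0)
  then have "((\<lambda>t. inverse t ^ m / exp (inverse t)) \<longlongrightarrow> (0::real)) (at_right 0)"
    by (rule filterlim_compose[OF _ filterlim_inverse_at_top_right])
  then have r: "(flat_exp m \<longlongrightarrow> 0) (at_right 0)"
    by (rule Lim_transform_eventually)
      (auto simp: eventually_at_right_less flat_exp_def exp_minus field_simps
        intro!: eventually_mono[OF eventually_at_right_less])
  have l: "(flat_exp m \<longlongrightarrow> 0) (at_left 0)"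
    by (rule Lim_transform_eventually[OF tendsto_const])
      (auto simp: flat_exp_def eventually_at intro: exI[of _ 1])
  from l r show ?thesis by (simp add: filterlim_split_at)
qed

lemma flat_exp_has_derivative:
  "(flat_exp m has_real_derivative (flat_exp (m + 2) t - real m * flat_exp (m + 1) t)) (at t)"
proof (cases t "0 :: real" rule: linorder_cases)
  case less
  have "(flat_exp m has_real_derivative 0) (at t)"
    by (rule has_field_derivative_transform_within_open[where f = "\<lambda>_. 0" and S = "{..<0}"])
      (use less in \<open>auto simp: flat_exp_def\<close>)
  then show ?thesis using less by (simp add: flat_exp_def)
next
  case equal
  \<comment> \<open>At zero the difference quotient is the next member of the family,
    \<open>flat_exp (Suc m)\<close>, whose limit is already known.\<close>
  have "((\<lambda>s. (flat_exp m s - flat_exp m 0) / (s - 0)) \<longlongrightarrow> 0) (at 0)"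
    by (rule Lim_transform_eventually[OF flat_exp_tendsto_0[of "Suc m"]])
      (auto simp: flat_exp_def divide_inverse eventually_at intro!: exI[of _ 1])
  then show ?thesis unfolding equal by (simp add: has_field_derivative_iff flat_exp_def)
next
  case greater
  have "((\<lambda>t. inverse t ^ m * exp (- inverse t)) has_real_derivative
      (flat_exp (m + 2) t - real m * flat_exp (m + 1) t)) (at t)"
    using greater
  \<comment> \<open>The split keeps the truncated exponent \<open>m - 1\<close> out of the power
    rule.\<close>
  proof (cases m)
    case (Suc n)
    have "((\<lambda>t. inverse t ^ Suc n * exp (- inverse t)) has_real_derivative
        (inverse t ^ Suc n * (exp (- inverse t) * (inverse t)\<^sup>2)
          + real (Suc n) * (- (inverse t)\<^sup>2 * inverse t ^ n) * exp (- inverse t))) (at t)"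
      using greater
      by (intro derivative_eq_intros DERIV_power[of inverse] DERIV_power_Suc[of inverse] refl)
        (auto simp: power2_eq_square algebra_simps)
    then show ?thesis
      using greater unfolding Suc by (simp add: flat_exp_def algebra_simps power2_eq_square)
  qed (auto intro!: derivative_eq_intros simp: flat_exp_def algebra_simps power2_eq_square)
  then show ?thesis
    by (rule has_field_derivative_transform_within_open[where S = "{0<..}"])
      (use greater in \<open>auto simp: flat_exp_def\<close>)
qed

lemma higher_differentiable_flat_exp:
  assumes l: "bounded_linear l"
  shows "higher_differentiable k (\<lambda>x. flat_exp m (l x + c))"
proof (induction k arbitrary: m)
  case 0
  have "continuous_on UNIV (flat_exp m)"
    by (intro continuous_at_imp_continuous_on ballI DERIV_isCont[OF flat_exp_has_derivative])
  moreover have "continuous_on UNIV (\<lambda>x. l x + c)"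
    using l by (intro continuous_intros linear_continuous_on)
  ultimately have "continuous_on UNIV (flat_exp m \<circ> (\<lambda>x. l x + c))"
    by (intro continuous_on_compose) (auto intro: continuous_on_subset)
  then show ?case by (simp add: o_def)
next
  case (Suc k)
  have 1: "((\<lambda>x. l x + c) has_derivative l) (at x)" for x
    using bounded_linear.has_derivative[OF l has_derivative_ident, of "at x"]
    by (auto intro!: derivative_eq_intros)
  have "((\<lambda>x. flat_exp m (l x + c)) has_derivative
      (\<lambda>v. l v * (flat_exp (m + 2) (l x + c) + (- real m) * flat_exp (m + 1) (l x + c)))) (at x)" for x
    using has_derivative_compose[OF 1 flat_exp_has_derivative[of m, unfolded has_field_derivative_def]]
    by (auto simp: algebra_simps)
  then show ?case
    by (rule higher_differentiable_SucI)
      (intro higher_differentiable_mult higher_differentiable_add higher_differentiable_const Suc)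
qed

section \<open>Test functions and their derivatives\<close>

lemma test_functionsD:
  assumes "\<phi> \<in> test_functions"
  shows test_differentiable: "(\<phi> has_derivative frechet_derivative \<phi> (at x)) (at x)"
    and test_continuous: "continuous_on UNIV \<phi>"
    and test_compact: "compact (closure {x. \<phi> x \<noteq> 0})"
    and test_smooth: "higher_differentiable k \<phi>"
  using assms higher_differentiable_SucD(1)[of 0 \<phi> x]
  by (auto simp: test_functions_def intro: higher_differentiable_continuous[of 0])

lemma compact_closure_subset:
  fixes A :: "'a::t2_space set"
  assumes "A \<subseteq> K" "compact K"
  shows "compact (closure A)"
proof -
  have "closure A \<subseteq> K" using assms by (simp add: closure_minimal compact_imp_closed)
  then show ?thesis using compact_Int_closed[OF assms(2) closed_closure[of A]] by (simp add: inf_absorb2)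
qed

lemma test_functionsI:
  "(\<And>k. higher_differentiable k \<phi>) \<Longrightarrow> (\<And>x. \<phi> x \<noteq> 0 \<Longrightarrow> x \<in> K) \<Longrightarrow> compact K
    \<Longrightarrow> \<phi> \<in> test_functions"
  by (auto simp: test_functions_def intro!: compact_closure_subset[of _ K])

lemma test_derivative_zero:
  assumes "\<phi> \<in> test_functions" "x \<notin> closure {x. \<phi> x \<noteq> 0}"
  shows "frechet_derivative \<phi> (at x) = (\<lambda>_. 0)"
proof (rule frechet_derivative_eqI)
  show "(\<phi> has_derivative (\<lambda>_. 0)) (at x)"
    by (rule has_derivative_transform_within_open[where f = "\<lambda>_. 0" and s = "- closure {x. \<phi> x \<noteq> 0}"])
      (use assms closure_subset[of "{x. \<phi> x \<noteq> 0}"] in auto)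
qed

lemma test_derivative:
  assumes "\<phi> \<in> test_functions"
  shows "(\<lambda>x. frechet_derivative \<phi> (at x) v) \<in> test_functions"
proof (rule test_functionsI)
  show "higher_differentiable k (\<lambda>x. frechet_derivative \<phi> (at x) v)" for k
    using higher_differentiable_SucD(2)[OF test_smooth[OF assms, of "Suc k"]] .
  show "x \<in> closure {x. \<phi> x \<noteq> 0}" if "frechet_derivative \<phi> (at x) v \<noteq> 0" for x
    using test_derivative_zero[OF assms, of x] that by metis
qed (rule test_compact[OF assms])

lemma test_bounded:
  assumes "\<phi> \<in> test_functions"
  obtains B where "B \<ge> 0" "\<And>x. \<bar>\<phi> x\<bar> \<le> B"
proof -
  let ?K = "closure {x. \<phi> x \<noteq> 0}"
  have "compact (\<phi> ` ?K)"
    by (intro compact_continuous_image test_compact assms continuous_on_subset[OF test_continuous[OF assms]]) auto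
  then obtain B where B: "\<And>x. x \<in> ?K \<Longrightarrow> \<bar>\<phi> x\<bar> \<le> B"
    by (meson compact_imp_bounded bounded_real imageI)
  have "\<bar>\<phi> x\<bar> \<le> max 0 B" for x
    using B[of x] closure_subset[of "{x. \<phi> x \<noteq> 0}"] by (cases "\<phi> x = 0") (auto simp: subset_iff)
  then show ?thesis by (intro that[of "max 0 B"]) auto
qed

section \<open>Coordinates and norm equivalence\<close>

locale coordinates =
  fixes b :: "'n::finite \<Rightarrow> 'e::{real_normed_vector, second_countable_topology}"
  assumes basis: "is_basis b"
begin

abbreviation "co \<equiv> coord b"

text \<open>Inverse of the coordinate map, and the map along which \<open>lebesgue_basis\<close>
  transports Lebesgue measure.\<close>

definition J :: "real^'n \<Rightarrow> 'e" where "J v = (\<Sum>i\<in>UNIV. (v $ i) *\<^sub>R b i)"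

lemma indep: "independent (range b)" and span: "span (range b) = UNIV" and inj: "inj b"
  using basis by (auto simp: is_basis_def)

lemma co_sum: "(\<Sum>i\<in>UNIV. co i x *\<^sub>R b i) = x"
proof -
  have "(\<Sum>v\<in>range b. representation (range b) x v *\<^sub>R v) = x"
    by (rule real_vector.sum_representation_eq[OF indep]) (auto simp: span)
  then show ?thesis using inj by (simp add: sum.reindex coord_def)
qed

lemma co_linear: "linear (co i)"
  by (rule linearI) (simp_all add: coord_def real_vector.representation_add[OF indep]
      real_vector.representation_scale[OF indep] span)

lemma co_b: "co i (b j) = of_bool (i = j)"
  using inj by (auto simp: coord_def real_vector.representation_basis[OF indep] inj_eq of_bool_def)

lemma J_linear: "linear J"
  by (rule linearI) (simp_all add: J_def sum.distrib scaleR_sum_right algebra_simps)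

lemma J_bounded_linear: "bounded_linear J"
  using J_linear by (simp add: linear_conv_bounded_linear)

lemma co_J: "co i (J v) = v $ i"
  by (simp add: J_def linear_sum[OF co_linear] linear_scale[OF co_linear] co_b of_bool_def
      if_distrib[of "\<lambda>u. _ * u"] cong: if_cong)

lemma J_co: "J (\<chi> i. co i x) = x"
  by (simp add: J_def co_sum)

lemma J_bij: "bij J"
  by (rule bij_betw_byWitness[where f' = "\<lambda>x. \<chi> i. co i x"]) (auto simp: J_co co_J vec_eq_iff)

text \<open>By injectivity of \<open>J\<close> the minimum of \<open>norm (J v)\<close> over the
  compact unit sphere is positive. This half of the equivalence of norms underlies the continuity of
  the coordinates, compactness in \<open>'e\<close> and the finiteness of the measure on bounded
  sets.\<close>

lemma J_lower: obtains c where "c > 0" "\<And>v. c * norm v \<le> norm (J v)"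
proof -
  let ?S = "sphere 0 1 :: (real^'n) set"
  have cont: "continuous_on ?S (\<lambda>v. norm (J v))"
    by (intro continuous_intros linear_continuous_on J_bounded_linear)
  have "axis undefined 1 \<in> ?S" by (simp add: norm_axis_1)
  then have "?S \<noteq> {}" by blast
  then obtain u where u: "u \<in> ?S" "\<And>v. v \<in> ?S \<Longrightarrow> norm (J u) \<le> norm (J v)"
    using continuous_attains_inf[OF compact_sphere _ cont] by blast
  have "J u \<noteq> 0"
  proof
    assume "J u = 0"
    then have "u $ i = 0" for i using co_J[of i u] linear_0[OF co_linear] by simp
    then have "u = 0" by (simp add: vec_eq_iff)
    with u(1) show False by simp
  qed
  moreover have "norm (J u) * norm v \<le> norm (J v)" for v
  proof (cases "v = 0")
    case False
    then have "norm (J u) \<le> norm (J ((1 / norm v) *\<^sub>R v))" by (intro u(2)) simp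
    also have "\<dots> = norm (J v) / norm v" by (simp add: linear_scale[OF J_linear])
    finally show ?thesis using False by (simp add: field_simps)
  qed (simp add: linear_0[OF J_linear])
  ultimately show ?thesis by (intro that[of "norm (J u)"]) auto
qed

lemma co_bound: obtains C where "C \<ge> 0" "\<And>i x. \<bar>co i x\<bar> \<le> C * norm x"
proof -
  obtain c where c: "c > 0" "\<And>v. c * norm v \<le> norm (J v)" using J_lower by blast
  have "\<bar>co i x\<bar> \<le> (1 / c) * norm x" for i x
  proof -
    have "\<bar>co i x\<bar> \<le> norm (\<chi> i. co i x)"
      using component_le_norm_cart[of "\<chi> i. co i x" i] by simp
    then have "c * \<bar>co i x\<bar> \<le> c * norm (\<chi> i. co i x)" using c(1) by simp
    also have "\<dots> \<le> norm x" using c(2)[of "\<chi> i. co i x"] by (simp add: J_co)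
    finally show ?thesis using c(1) by (simp add: field_simps)
  qed
  then show ?thesis using c(1) by (intro that[of "1 / c"]) auto
qed

lemma co_bounded_linear: "bounded_linear (co i)"
proof -
  obtain C where "\<And>i x. \<bar>co i x\<bar> \<le> C * norm x" using co_bound by blast
  then show ?thesis
    using linear_add[OF co_linear] linear_scale[OF co_linear]
    by (intro bounded_linear_intro[where K = C]) (auto simp: mult.commute)
qed

lemma co_continuous [continuous_intros]: "continuous_on S f \<Longrightarrow> continuous_on S (\<lambda>x. co i (f x))"
  by (rule bounded_linear.continuous_on[OF co_bounded_linear])

text \<open>\<open>'e\<close> is given only as a normed space, so the Heine--Borel property is
  imported from \<open>real^'n\<close>: \<open>K\<close> is the image under \<open>J\<close> of its
  closed and bounded preimage.\<close>

lemma bounded_closed_compact: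
  assumes "bounded (K::'e set)" "closed K"
  shows "compact K"
proof -
  obtain C where C: "C \<ge> 0" "\<And>i x. \<bar>co i x\<bar> \<le> C * norm x" using co_bound by blast
  have J_cont: "continuous_on UNIV J" by (intro linear_continuous_on J_bounded_linear)
  obtain B where B: "\<And>x. x \<in> K \<Longrightarrow> norm x \<le> B" using assms(1) by (auto simp: bounded_iff)
  have "norm v \<le> (\<Sum>i\<in>(UNIV::'n set). C * B)" if "J v \<in> K" for v
  proof -
    have "norm v \<le> (\<Sum>i\<in>UNIV. \<bar>v $ i\<bar>)" by (rule norm_le_l1_cart)
    also have "\<dots> \<le> (\<Sum>i\<in>(UNIV::'n set). C * B)"
    proof (rule sum_mono)
      fix i show "\<bar>v $ i\<bar> \<le> C * B"
        using C(2)[of i "J v"] mult_left_mono[OF B[OF that] C(1)] by (simp add: co_J)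
    qed
    finally show ?thesis .
  qed
  then have "bounded (J -` K)" by (auto simp: bounded_iff)
  moreover have "closed (J -` K)"
    using assms(2) J_cont by (simp add: closed_vimage continuous_on_eq_continuous_within)
  ultimately have "compact (J ` (J -` K))"
    by (intro compact_continuous_image continuous_on_subset[OF J_cont]) (auto simp: compact_eq_bounded_closed)
  then show ?thesis using J_bij by (simp add: bij_def surj_image_vimage_eq)
qed

lemma derivative_expand:
  assumes "linear D"
  shows "D v = (\<Sum>i\<in>UNIV. co i v * D (b i))"
proof -
  have "D v = D (\<Sum>i\<in>UNIV. co i v *\<^sub>R b i)" by (simp add: co_sum)
  also have "\<dots> = (\<Sum>i\<in>UNIV. co i v * D (b i))"
    using assms by (simp add: linear_sum linear_scale)
  finally show ?thesis .
qed

lemma test_derivative_linear: "(\<phi> :: 'e \<Rightarrow> real) \<in> test_functions \<Longrightarrow> linear (frechet_derivative \<phi> (at x))"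
  using test_differentiable[of \<phi>] has_derivative_linear by blast

text \<open>Passes from the basis directions to all directions. Derivatives of test functions are
  first controlled in the directions \<open>b i\<close>, where they are again test
  functions.\<close>

lemma linear_bound:
  assumes "C \<ge> 0" "\<And>i x. \<bar>co i x\<bar> \<le> C * norm x" "linear D" "\<And>i. \<bar>D (b i)\<bar> \<le> B i"
  shows "\<bar>D v\<bar> \<le> (C * (\<Sum>i\<in>UNIV. B i)) * norm v"
proof -
  have "\<bar>D v\<bar> \<le> (\<Sum>i\<in>UNIV. \<bar>co i v * D (b i)\<bar>)"
    by (subst derivative_expand[OF assms(3)]) (rule sum_abs)
  also have "\<dots> \<le> (\<Sum>i\<in>UNIV. C * norm v * B i)"
    unfolding abs_mult using assms by (intro sum_mono mult_mono) auto
  also have "\<dots> = (C * (\<Sum>i\<in>UNIV. B i)) * norm v"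
    by (simp add: sum_distrib_left sum_distrib_right mult_ac)
  finally show ?thesis .
qed

lemma test_derivative_bounded:
  fixes \<phi> :: "'e \<Rightarrow> real"
  assumes \<phi>: "\<phi> \<in> test_functions"
  obtains B where "B \<ge> 0" "\<And>x v. \<bar>frechet_derivative \<phi> (at x) v\<bar> \<le> B * norm v"
proof -
  obtain C where C: "C \<ge> 0" "\<And>i x. \<bar>co i x\<bar> \<le> C * norm x" using co_bound by blast
  have "\<exists>B\<ge>0. \<forall>x. \<bar>frechet_derivative \<phi> (at x) (b i)\<bar> \<le> B" for i
    using test_bounded[OF test_derivative[OF \<phi>, of "b i"]] by metis
  then obtain B where B: "\<And>i. B i \<ge> 0" "\<And>i x. \<bar>frechet_derivative \<phi> (at x) (b i)\<bar> \<le> B i"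
    by metis
  show ?thesis
    by (rule that[OF _ linear_bound[OF C test_derivative_linear[OF \<phi>] B(2)]])
      (use B(1) C(1) in \<open>auto intro!: mult_nonneg_nonneg sum_nonneg\<close>)
qed

lemma test_lipschitz:
  fixes \<phi> :: "'e \<Rightarrow> real"
  assumes \<phi>: "\<phi> \<in> test_functions"
  obtains L where "L-lipschitz_on UNIV \<phi>"
proof -
  obtain B where B: "B \<ge> 0" "\<And>x v. \<bar>frechet_derivative \<phi> (at x) v\<bar> \<le> B * norm v"
    using test_derivative_bounded[OF \<phi>] by blast
  have "norm (\<phi> x - \<phi> y) \<le> B * norm (x - y)" for x y
    by (rule differentiable_bound[where S = UNIV and f' = "\<lambda>x. frechet_derivative \<phi> (at x)"])
      (use B test_differentiable[OF \<phi>] in \<open>auto intro!: onorm_bound\<close>)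
  then show ?thesis using B(1) by (intro that[of B] lipschitz_onI) (auto simp: dist_norm)
qed

text \<open>The difference quotients in direction \<open>v\<close> obey the bound. It is stated in
  the given norm of \<open>'e\<close> and with constant exactly \<open>L\<close>; bounds through
  coordinates would lose a factor and with it the isometry.\<close>

lemma lipschitz_derivative_bound:
  fixes \<phi> :: "'e \<Rightarrow> real"
  assumes L: "L-lipschitz_on UNIV \<phi>" and D: "(\<phi> has_derivative D) (at x)"
  shows "\<bar>D v\<bar> \<le> L * norm v"
proof -
  have Dl: "linear D" using D has_derivative_linear by blast
  have "((\<lambda>t. x + t *\<^sub>R v) has_derivative (\<lambda>t. t *\<^sub>R v)) (at (0::real))"
    by (auto intro!: derivative_eq_intros)
  then have "((\<lambda>t. \<phi> (x + t *\<^sub>R v)) has_derivative (\<lambda>t. D (t *\<^sub>R v))) (at 0)"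
    using has_derivative_compose[of "\<lambda>t. x + t *\<^sub>R v" "\<lambda>t. t *\<^sub>R v" 0 UNIV \<phi> D] D by simp
  then have "((\<lambda>t. \<phi> (x + t *\<^sub>R v)) has_real_derivative D v) (at 0)"
    by (simp add: has_field_derivative_def linear_scale[OF Dl] mult.commute[of _ "D v"])
  then have "((\<lambda>t. (\<phi> (x + t *\<^sub>R v) - \<phi> x) / t) \<longlongrightarrow> D v) (at 0)"
    by (simp add: has_field_derivative_iff)
  then have "((\<lambda>t. \<bar>(\<phi> (x + t *\<^sub>R v) - \<phi> x) / t\<bar>) \<longlongrightarrow> \<bar>D v\<bar>) (at 0)"
    by (rule tendsto_rabs)
  moreover have "\<bar>(\<phi> (x + t *\<^sub>R v) - \<phi> x) / t\<bar> \<le> L * norm v" if "t \<noteq> 0" for t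
  proof -
    have "\<bar>\<phi> (x + t *\<^sub>R v) - \<phi> x\<bar> \<le> L * (\<bar>t\<bar> * norm v)"
      using lipschitz_onD[OF L, of "x + t *\<^sub>R v" x] by (simp add: dist_real_def dist_norm)
    then show ?thesis using that by (simp add: field_simps)
  qed
  ultimately show ?thesis
    by (intro tendsto_upperbound[where F = "at (0::real)"]) (auto simp: eventually_at_filter)
qed

text \<open>The mean value inequality is applied to \<open>\<phi>\<close> minus its derivative at
  \<open>y\<close>, on the ball of radius \<open>norm h\<close>, where the derivative varies by at
  most a multiple of \<open>norm h\<close>. The quadratic remainder serves to differentiate
  convolutions and to show that derivatives of test functions have integral zero.\<close>

lemma test_second_order:
  fixes \<phi> :: "'e \<Rightarrow> real"
  assumes \<phi>: "\<phi> \<in> test_functions"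
  obtains C where "C \<ge> 0"
    "\<And>y h. \<bar>\<phi> (y + h) - \<phi> y - frechet_derivative \<phi> (at y) h\<bar> \<le> C * (norm h)\<^sup>2"
proof -
  obtain K where K: "K \<ge> 0" "\<And>i x. \<bar>co i x\<bar> \<le> K * norm x" using co_bound by blast
  have "\<exists>L. L-lipschitz_on UNIV (\<lambda>x. frechet_derivative \<phi> (at x) (b i))" for i
    using test_lipschitz[OF test_derivative[OF \<phi>, of "b i"]] by metis
  then obtain L where L: "\<And>i. (L i)-lipschitz_on UNIV (\<lambda>x. frechet_derivative \<phi> (at x) (b i))"
    by metis
  define C where "C = K * (\<Sum>i\<in>UNIV. L i)"
  have C: "C \<ge> 0" using K L lipschitz_on_nonneg unfolding C_def
    by (intro mult_nonneg_nonneg sum_nonneg) blast+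
  note DL = test_derivative_linear[OF \<phi>]
  have "\<bar>\<phi> (y + h) - \<phi> y - frechet_derivative \<phi> (at y) h\<bar> \<le> C * (norm h)\<^sup>2" for y h
  proof -
    define S where "S = cball y (norm h)"
    let ?D = "\<lambda>x v. frechet_derivative \<phi> (at x) v - frechet_derivative \<phi> (at y) v"
    have bl: "bounded_linear (frechet_derivative \<phi> (at y))"
      using test_differentiable[OF \<phi>] has_derivative_bounded_linear by blast
    have "norm ((\<phi> (y + h) - frechet_derivative \<phi> (at y) (y + h)) - (\<phi> y - frechet_derivative \<phi> (at y) y))
        \<le> (C * norm h) * norm (y + h - y)"
    proof (rule differentiable_bound[where S = S and f' = ?D])
      show "((\<lambda>x. \<phi> x - frechet_derivative \<phi> (at y) x) has_derivative ?D x) (at x within S)" for x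
        by (intro has_derivative_diff has_derivative_at_withinI[OF test_differentiable[OF \<phi>]]
            bounded_linear_imp_has_derivative bl)
      show "onorm (?D x) \<le> C * norm h" if "x \<in> S" for x
      proof (rule onorm_bound)
        show "norm (?D x v) \<le> C * norm h * norm v" for v
        proof -
          have "\<bar>?D x (b i)\<bar> \<le> L i * norm h" for i
          proof -
            have "\<bar>?D x (b i)\<bar> \<le> L i * dist x y"
              using lipschitz_onD[OF L, of x y i] by (simp add: dist_real_def)
            also have "\<dots> \<le> L i * norm h"
              using that lipschitz_on_nonneg[OF L, of i] by (intro mult_left_mono) (auto simp: S_def dist_commute)
            finally show ?thesis .
          qed
          from linear_bound[OF K linear_compose_sub[OF DL DL] this]
          have "\<bar>?D x v\<bar> \<le> K * (\<Sum>i\<in>UNIV. L i * norm h) * norm v" .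
          then show ?thesis by (simp add: C_def sum_distrib_right[symmetric] mult_ac)
        qed
      qed (use C in simp)
    qed (auto simp: S_def dist_norm)
    then show ?thesis
      by (simp add: linear_add[OF DL] power2_eq_square algebra_simps)
  qed
  with C show ?thesis by (rule that)
qed

text \<open>A product over the coordinates of flat functions rising from \<open>- d\<close> and
  falling towards \<open>d\<close>, so that it lives on a coordinate cube.\<close>

lemma bump_exists:
  assumes "\<delta> > 0"
  obtains \<eta> :: "'e \<Rightarrow> real" where "\<eta> \<in> test_functions" "\<And>x. \<eta> x \<ge> 0"
    "\<And>x. \<eta> x \<noteq> 0 \<Longrightarrow> norm x < \<delta>" "\<eta> 0 > 0"
proof -
  define B where "B = (\<Sum>i\<in>UNIV. norm (b i))"
  \<comment> \<open>Coordinates below \<open>d\<close> give a norm of at most \<open>d * B\<close>,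
    which must stay below \<open>\<delta>\<close>; the added 1 makes this strict and keeps the
    divisor positive.\<close>
  define d where "d = \<delta> / (B + 1)"
  have B: "B \<ge> 0" by (simp add: B_def sum_nonneg)
  then have d: "d > 0" using assms by (simp add: d_def)
  define \<eta> where "\<eta> x = (\<Prod>i\<in>UNIV. flat_exp 0 (co i x + d) * flat_exp 0 (- co i x + d))" for x
  have nz: "norm x < \<delta>" if "\<eta> x \<noteq> 0" for x
  proof -
    have i: "\<bar>co i x\<bar> < d" for i
    proof -
      have "flat_exp 0 (co i x + d) \<noteq> 0" "flat_exp 0 (- co i x + d) \<noteq> 0"
        using that by (auto simp: \<eta>_def)
      have "0 < co i x + d" "0 < - co i x + d"
        using \<open>flat_exp 0 (co i x + d) \<noteq> 0\<close> \<open>flat_exp 0 (- co i x + d) \<noteq> 0\<close>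
        by (auto simp: flat_exp_def split: if_splits)
      then show ?thesis by linarith
    qed
    have "norm x = norm (\<Sum>i\<in>UNIV. co i x *\<^sub>R b i)" by (simp add: co_sum)
    also have "\<dots> \<le> (\<Sum>i\<in>UNIV. \<bar>co i x\<bar> * norm (b i))"
      by (rule order_trans[OF norm_sum]) simp
    also have "\<dots> \<le> (\<Sum>i\<in>UNIV. d * norm (b i))"
      using i by (intro sum_mono mult_right_mono) (auto simp: less_imp_le)
    also have "\<dots> = d * B" by (simp add: B_def sum_distrib_left)
    also have "\<dots> < d * (B + 1)" using d by simp
    also have "\<dots> = \<delta>" using B by (simp add: d_def)
    finally show ?thesis .
  qed
  show ?thesis
  proof (rule that[of \<eta>])
    show "\<eta> \<in> test_functions"
    proof (rule test_functionsI)
      show "higher_differentiable k \<eta>" for k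
        unfolding \<eta>_def
        by (intro higher_differentiable_prod higher_differentiable_mult higher_differentiable_flat_exp
            co_bounded_linear bounded_linear_minus) auto
      show "x \<in> cball 0 \<delta>" if "\<eta> x \<noteq> 0" for x using nz[OF that] by simp
      show "compact (cball (0::'e) \<delta>)" by (rule bounded_closed_compact) auto
    qed
    show "\<eta> x \<ge> 0" for x by (auto simp: \<eta>_def flat_exp_def intro!: prod_nonneg)
    show "\<eta> 0 > 0" using d by (auto simp: \<eta>_def flat_exp_def linear_0[OF co_linear] intro!: prod_pos)
  qed (rule nz)
qed

end

section \<open>Lebesgue measure and mollification\<close>

context coordinates
begin

text \<open>Fubini's theorem and affine substitutions are used for this Borel measure; integrals
  over its completion are reduced to it when the integrand is Borel.\<close>

definition M :: "'e measure" where "M = distr lborel borel J"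

lemma lebesgue_basis_eq: "lebesgue_basis b = completion M"
  by (simp add: lebesgue_basis_def M_def J_def[abs_def])

lemma sets_M [measurable_cong, simp]: "sets M = sets borel"
  by (simp add: M_def)

lemma space_M [simp]: "space M = UNIV"
  by (simp add: M_def)

lemma J_continuous: "continuous_on S J"
  by (intro linear_continuous_on J_bounded_linear)

lemma J_measurable [measurable]: "J \<in> borel_measurable borel"
  by (intro borel_measurable_continuous_onI J_continuous)

lemma co_measurable [measurable]: "co i \<in> borel_measurable borel"
  by (intro borel_measurable_continuous_onI co_continuous continuous_on_id)

lemma M_finite: "bounded A \<Longrightarrow> A \<in> sets borel \<Longrightarrow> emeasure M A < \<infinity>"
proof -
  assume A: "bounded A" "A \<in> sets borel"
  obtain c where c: "c > 0" "\<And>v. c * norm v \<le> norm (J v)" using J_lower by blast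
  obtain B where B: "\<And>x. x \<in> A \<Longrightarrow> norm x \<le> B" using A by (auto simp: bounded_iff)
  have "norm v \<le> B / c" if "J v \<in> A" for v
    using c(2)[of v] B[OF that] c(1) by (simp add: field_simps)
  then have "bounded (J -` A)" by (auto simp: bounded_iff)
  then have "emeasure lborel (J -` A) < \<infinity>" by (rule emeasure_bounded_finite)
  then show ?thesis using A by (simp add: M_def emeasure_distr)
qed

lemma M_sigma_finite: "sigma_finite_measure M"
proof
  have "\<exists>n. norm x < real n" for x :: 'e by (rule reals_Archimedean2)
  moreover have "emeasure M (ball 0 r) \<noteq> \<infinity>" for r using M_finite[of "ball 0 r"] by auto
  ultimately show "\<exists>A. countable A \<and> A \<subseteq> sets M \<and> \<Union>A = space M \<and> (\<forall>a\<in>A. emeasure M a \<noteq> \<infinity>)"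
    by (intro exI[of _ "range (\<lambda>n::nat. ball 0 (real n))"]) auto
qed

text \<open>The scaling law of Lebesgue measure, carried through \<open>J\<close> with the
  coordinates of \<open>a\<close> as translation vector. It is used with \<open>k = 1\<close> for
  translations, \<open>k = -1\<close> for reflections in convolutions, and \<open>k = t\<close> for
  contractions towards the tip of a cone.\<close>

lemma M_affine:
  assumes k: "k \<noteq> 0"
  shows "M = density (distr M borel (\<lambda>z. a + k *\<^sub>R z)) (\<lambda>_. ennreal (\<bar>k\<bar> ^ CARD('n)))" (is "_ = ?R")
proof (rule measure_eqI)
  show "sets M = sets ?R" by simp
  fix A assume "A \<in> sets M"
  then have A [measurable]: "A \<in> sets borel" by simp
  define a' where "a' = (\<chi> i. co i a)"
  have a: "J a' = a" by (simp add: a'_def J_co)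
  have vim: "(\<lambda>x. a' + k *\<^sub>R x) -` (J -` A) = J -` ((\<lambda>z. a + k *\<^sub>R z) -` A)"
    by (auto simp: linear_add[OF J_linear] linear_scale[OF J_linear] a)
  have [measurable]: "J -` A \<in> sets borel" using measurable_sets[OF J_measurable A] by simp
  have [measurable]: "(\<lambda>z. a + k *\<^sub>R z) -` A \<in> sets borel"
    using measurable_sets[of "\<lambda>z. a + k *\<^sub>R z" borel borel A] by simp
  have "emeasure M A = emeasure lborel (J -` A)"
    by (simp add: M_def emeasure_distr)
  also have "\<dots> = ennreal (\<bar>k\<bar> ^ CARD('n)) * emeasure lborel ((\<lambda>x. a' + k *\<^sub>R x) -` (J -` A))"
    by (subst lborel_affine[OF k, of a'])
      (simp add: emeasure_density nn_integral_cmult emeasure_distr ennreal_power)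
  also have "\<dots> = emeasure ?R A"
    by (simp add: vim emeasure_density nn_integral_cmult emeasure_distr M_def)
  finally show "emeasure M A = emeasure ?R A" .
qed

lemma integral_M_affine:
  fixes f :: "'e \<Rightarrow> real"
  assumes [measurable]: "f \<in> borel_measurable borel" and "k \<noteq> 0"
  shows "(\<integral>z. f z \<partial>M) = \<bar>k\<bar> ^ CARD('n) * (\<integral>z. f (a + k *\<^sub>R z) \<partial>M)"
  by (subst M_affine[OF assms(2), of a]) (simp add: integral_density integral_distr)

lemma integrable_M_affine:
  fixes f :: "'e \<Rightarrow> real"
  assumes [measurable]: "f \<in> borel_measurable borel" and k: "k \<noteq> 0"
  shows "integrable M f \<longleftrightarrow> integrable M (\<lambda>z. f (a + k *\<^sub>R z))"
  by (subst M_affine[OF k, of a]) (simp add: integrable_density integrable_distr_eq k)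

lemma M_open_pos:
  assumes "open U" "U \<noteq> {}"
  shows "emeasure M U \<noteq> 0"
proof
  assume 0: "emeasure M U = 0"
  have o: "open (J -` U)" using open_vimage[OF assms(1) J_continuous] .
  obtain x where "x \<in> U" using assms by blast
  then have "J -` U \<noteq> {}" using J_co[of x] by (metis empty_iff vimageI)
  have "emeasure lborel (J -` U) = 0"
    using 0 assms by (simp add: M_def emeasure_distr)
  then have "J -` U \<in> null_sets lborel" using o by (auto intro: null_setsI)
  then have "negligible (J -` U)" by (simp add: negligible_iff_null_sets null_sets_completionI)
  with o \<open>J -` U \<noteq> {}\<close> show False using open_not_negligible by blast
qed

lemma integrable_bounded_support:
  fixes f :: "'e \<Rightarrow> real"
  assumes "f \<in> borel_measurable borel" "bounded A" "\<And>x. x \<notin> A \<Longrightarrow> f x = 0" "\<And>x. \<bar>f x\<bar> \<le> B"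
  shows "integrable M f"
proof (rule integrableI_bounded_set[where A = "closure A" and B = B])
  show "emeasure M (closure A) < \<infinity>" using assms(2) by (intro M_finite) auto
  show "AE x in M. x \<notin> closure A \<longrightarrow> f x = 0"
    using assms(3) closure_subset[of A] by auto
qed (use assms in \<open>auto simp: measurable_cong_sets[OF sets_M refl]\<close>)

lemma test_measurable [measurable_dest]:
  "\<phi> \<in> test_functions \<Longrightarrow> (\<phi> :: 'e \<Rightarrow> real) \<in> borel_measurable borel"
  by (intro borel_measurable_continuous_onI test_continuous)

lemma test_integrable: "(\<phi> :: 'e \<Rightarrow> real) \<in> test_functions \<Longrightarrow> integrable M \<phi>"
proof -
  assume \<phi>: "\<phi> \<in> test_functions"
  obtain B where "\<And>x. \<bar>\<phi> x\<bar> \<le> B" using test_bounded[OF \<phi>] by blast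
  then show ?thesis
    using closure_subset[of "{x. \<phi> x \<noteq> 0}"]
    by (intro integrable_bounded_support[where A = "closure {x. \<phi> x \<noteq> 0}" and B = B]
        compact_imp_bounded test_compact \<phi> test_measurable) auto
qed

lemma test_cmult: "(\<phi> :: 'e \<Rightarrow> real) \<in> test_functions \<Longrightarrow> (\<lambda>x. c * \<phi> x) \<in> test_functions"
  by (rule test_functionsI[where K = "closure {x. \<phi> x \<noteq> 0}"])
    (use closure_subset[of "{x. \<phi> x \<noteq> 0}"] in
      \<open>auto intro: higher_differentiable_mult higher_differentiable_const test_smooth test_compact\<close>)

lemma mollifier_exists:
  assumes "\<delta> > 0"
  obtains \<eta> :: "'e \<Rightarrow> real" where "\<eta> \<in> test_functions" "\<And>x. \<eta> x \<ge> 0"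
    "\<And>x. \<eta> x \<noteq> 0 \<Longrightarrow> norm x < \<delta>" "(\<integral>x. \<eta> x \<partial>M) = 1"
proof -
  obtain \<eta> :: "'e \<Rightarrow> real" where \<eta>: "\<eta> \<in> test_functions" "\<And>x. \<eta> x \<ge> 0"
      "\<And>x. \<eta> x \<noteq> 0 \<Longrightarrow> norm x < \<delta>" "\<eta> 0 > 0"
    using bump_exists[OF assms] by blast
  define I where "I = (\<integral>x. \<eta> x \<partial>M)"
  \<comment> \<open>A vanishing integral would make \<open>\<eta>\<close> zero almost everywhere,
    yet it is positive on an open set around the origin.\<close>
  have "I \<noteq> 0"
  proof
    assume "I = 0"
    then have "AE x in M. \<eta> x = 0"
      using integral_nonneg_eq_0_iff_AE[OF test_integrable[OF \<eta>(1)]] \<eta>(2) by (simp add: I_def)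
    moreover have "open (\<eta> -` {0<..})" by (rule open_vimage[OF _ test_continuous[OF \<eta>(1)]]) simp
    ultimately have "emeasure M (\<eta> -` {0<..}) = 0"
      by (subst AE_iff_measurable[symmetric, where P = "\<lambda>x. \<eta> x = 0"])
        (use \<eta>(2) in \<open>auto simp: less_le\<close>)
    then show False using M_open_pos[OF \<open>open (\<eta> -` {0<..})\<close>] \<eta>(4) by auto
  qed
  moreover have "I \<ge> 0" unfolding I_def using \<eta>(2) by (intro integral_nonneg_AE) auto
  ultimately have "I > 0" by simp
  then show ?thesis
    using \<eta> by (intro that[of "\<lambda>x. inverse I * \<eta> x"] test_cmult)
      (auto simp: I_def[symmetric])
qed

section \<open>Convolution with test functions\<close>

definition conv :: "('e \<Rightarrow> real) \<Rightarrow> ('e \<Rightarrow> real) \<Rightarrow> 'e \<Rightarrow> real" where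
  "conv f \<eta> x = (\<integral>z. f z * \<eta> (x - z) \<partial>M)"

lemma conv_integrable:
  assumes f: "integrable M f" and \<eta>: "\<eta> \<in> test_functions"
  shows "integrable M (\<lambda>z. f z * \<eta> (x - z))"
proof -
  obtain B where B: "\<And>x. \<bar>\<eta> x\<bar> \<le> B" using test_bounded[OF \<eta>] by blast
  note [measurable] = test_measurable[OF \<eta>] borel_measurable_integrable[OF f]
  show ?thesis
  proof (rule Bochner_Integration.integrable_bound[of M "\<lambda>z. B * f z"])
    have "norm (f z * \<eta> (x - z)) \<le> norm (B * f z)" for z
      using mult_left_mono[OF order_trans[OF B abs_ge_self], of "\<bar>f z\<bar>" "x - z"]
      by (simp add: abs_mult mult.commute)
    then show "AE z in M. norm (f z * \<eta> (x - z)) \<le> norm (B * f z)" by simp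
  qed (use f in simp_all)
qed

lemma conv_commute:
  assumes [measurable]: "f \<in> borel_measurable borel" "\<eta> \<in> borel_measurable borel"
  shows "conv f \<eta> x = (\<integral>y. f (x - y) * \<eta> y \<partial>M)"
  unfolding conv_def by (subst integral_M_affine[where k = "-1" and a = x]) auto

text \<open>The quadratic Taylor remainder of \<open>\<eta>\<close> is uniform in the base point, so
  multiplied by \<open>f\<close> and integrated it is at most the integral of the absolute value of
  \<open>f\<close> times a multiple of the squared increment. Integrability of \<open>f\<close>
  suffices for this.\<close>

lemma conv_has_derivative:
  assumes f: "integrable M f" and \<eta>: "\<eta> \<in> test_functions"
  shows "(conv f \<eta> has_derivative (\<lambda>v. conv f (\<lambda>y. frechet_derivative \<eta> (at y) v) x)) (at x)"
proof -
  define D where "D y v = frechet_derivative \<eta> (at y) v" for y v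
  have D: "(\<lambda>y. D y v) \<in> test_functions" for v unfolding D_def by (rule test_derivative[OF \<eta>])
  have Dl: "linear (D y)" for y unfolding D_def using test_derivative_linear[OF \<eta>] by simp
  obtain B where B: "B \<ge> 0" "\<And>x v. \<bar>D x v\<bar> \<le> B * norm v"
    using test_derivative_bounded[OF \<eta>] unfolding D_def by blast
  obtain C where C: "C \<ge> 0" "\<And>y h. \<bar>\<eta> (y + h) - \<eta> y - D y h\<bar> \<le> C * (norm h)\<^sup>2"
    using test_second_order[OF \<eta>] unfolding D_def by blast
  define I where "I = (\<integral>z. \<bar>f z\<bar> \<partial>M)"
  note int = conv_integrable[OF f]
  have bl: "bounded_linear (\<lambda>v. conv f (\<lambda>y. D y v) x)"
  proof (rule bounded_linear_intro[where K = "I * B"])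
    show "conv f (\<lambda>y. D y (u + v)) x = conv f (\<lambda>y. D y u) x + conv f (\<lambda>y. D y v) x" for u v
      using int[OF D] by (simp add: conv_def linear_add[OF Dl] algebra_simps)
    show "conv f (\<lambda>y. D y (r *\<^sub>R v)) x = r *\<^sub>R conv f (\<lambda>y. D y v) x" for r v
      using int[OF D] by (simp add: conv_def linear_scale[OF Dl] algebra_simps)
    show "norm (conv f (\<lambda>y. D y v) x) \<le> norm v * (I * B)" for v
    proof -
      have "norm (conv f (\<lambda>y. D y v) x) \<le> (\<integral>z. norm (f z * D (x - z) v) \<partial>M)"
        unfolding conv_def by (rule integral_norm_bound)
      also have "\<dots> \<le> (\<integral>z. \<bar>f z\<bar> * (B * norm v) \<partial>M)"
      proof (rule integral_mono[OF integrable_norm[OF int[OF D]]])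
        show "integrable M (\<lambda>z. \<bar>f z\<bar> * (B * norm v))" using f by simp
        show "norm (f z * D (x - z) v) \<le> \<bar>f z\<bar> * (B * norm v)" for z
          unfolding real_norm_def abs_mult by (rule mult_left_mono[OF B(2) abs_ge_zero])
      qed
      also have "\<dots> = norm v * (I * B)" by (simp add: I_def)
      finally show ?thesis .
    qed
  qed
  have est: "\<bar>conv f \<eta> y - conv f \<eta> x - conv f (\<lambda>u. D u (y - x)) x\<bar> \<le> I * C * (norm (y - x))\<^sup>2" for y
  proof -
    let ?r = "\<lambda>z. \<eta> (y - z) - \<eta> (x - z) - D (x - z) (y - x)"
    have r: "\<bar>?r z\<bar> \<le> C * (norm (y - x))\<^sup>2" for z
      using C(2)[of "x - z" "y - x"] by simp
    have i: "integrable M (\<lambda>z. f z * ?r z)"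
      using int[OF \<eta>] int[OF D] by (simp add: right_diff_distrib)
    have "\<bar>conv f \<eta> y - conv f \<eta> x - conv f (\<lambda>u. D u (y - x)) x\<bar> = \<bar>\<integral>z. f z * ?r z \<partial>M\<bar>"
      using int[OF \<eta>] int[OF D] by (simp add: conv_def right_diff_distrib)
    also have "\<dots> \<le> (\<integral>z. norm (f z * ?r z) \<partial>M)"
      unfolding real_norm_def[symmetric] by (rule integral_norm_bound)
    also have "\<dots> \<le> (\<integral>z. \<bar>f z\<bar> * (C * (norm (y - x))\<^sup>2) \<partial>M)"
    proof (rule integral_mono[OF integrable_norm[OF i]])
      show "integrable M (\<lambda>z. \<bar>f z\<bar> * (C * (norm (y - x))\<^sup>2))" using f by simp
      show "norm (f z * ?r z) \<le> \<bar>f z\<bar> * (C * (norm (y - x))\<^sup>2)" for z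
        unfolding real_norm_def abs_mult by (rule mult_left_mono[OF r abs_ge_zero])
    qed
    finally show ?thesis by (simp add: I_def mult_ac)
  qed
  have "((\<lambda>y. norm (conv f \<eta> y - conv f \<eta> x - conv f (\<lambda>u. D u (y - x)) x) / norm (y - x)) \<longlongrightarrow> 0) (at x)"
  proof (rule Lim_null_comparison)
    show "\<forall>\<^sub>F y in at x. norm (norm (conv f \<eta> y - conv f \<eta> x - conv f (\<lambda>u. D u (y - x)) x) / norm (y - x))
        \<le> I * C * norm (y - x)"
      using est by (intro always_eventually allI) (auto simp: divide_le_eq power2_eq_square mult_ac)
    show "((\<lambda>y. I * C * norm (y - x)) \<longlongrightarrow> 0) (at x)"
      by (auto intro!: tendsto_eq_intros)
  qed
  with bl show ?thesis unfolding D_def has_derivative_iff_norm by simp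
qed

text \<open>A directional derivative of the convolution is the convolution with the derivative of
  \<open>\<eta>\<close>, again a test function; hence the induction leaves \<open>\<eta>\<close>
  arbitrary.\<close>

lemma conv_smooth:
  assumes f: "integrable M f"
  shows "\<eta> \<in> test_functions \<Longrightarrow> higher_differentiable k (conv f \<eta>)"
proof (induction k arbitrary: \<eta>)
  case 0
  have "conv f \<eta> differentiable (at x)" for x
    using conv_has_derivative[OF f 0] by (auto simp: differentiable_def)
  then show ?case
    by (simp add: differentiable_imp_continuous_on differentiable_on_def differentiable_at_withinI)
next
  case (Suc k)
  show ?case
    by (rule higher_differentiable_SucI[OF conv_has_derivative[OF f Suc.prems]])
      (intro Suc.IH test_derivative Suc.prems)
qed

lemma conv_support:
  assumes "conv f \<eta> x \<noteq> 0"
  obtains z where "f z \<noteq> 0" "\<eta> (x - z) \<noteq> 0"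
proof -
  have "\<exists>z. f z * \<eta> (x - z) \<noteq> 0"
  proof (rule ccontr)
    assume "\<nexists>z. f z * \<eta> (x - z) \<noteq> 0"
    then have "(\<lambda>z. f z * \<eta> (x - z)) = (\<lambda>_. 0)" by auto
    with assms show False by (simp add: conv_def)
  qed
  then show ?thesis using that by auto
qed

lemma conv_test:
  assumes f: "integrable M f" and \<eta>: "\<eta> \<in> test_functions"
    and A: "bounded A" "\<And>x. f x \<noteq> 0 \<Longrightarrow> x \<in> A"
  shows "conv f \<eta> \<in> test_functions"
proof -
  obtain R where R: "\<And>x. x \<in> A \<Longrightarrow> norm x \<le> R" using A(1) by (auto simp: bounded_iff)
  obtain S where S: "\<And>x. x \<in> closure {x. \<eta> x \<noteq> 0} \<Longrightarrow> norm x \<le> S"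
    using compact_imp_bounded[OF test_compact[OF \<eta>]] by (auto simp: bounded_iff)
  show ?thesis
  proof (rule test_functionsI)
    show "compact (cball (0::'e) (R + S))" by (rule bounded_closed_compact) auto
    fix x assume "conv f \<eta> x \<noteq> 0"
    then obtain z where "f z \<noteq> 0" "\<eta> (x - z) \<noteq> 0" by (rule conv_support)
    then have "norm z \<le> R" "norm (x - z) \<le> S"
      using R A S closure_subset[of "{x. \<eta> x \<noteq> 0}"] by auto
    then show "x \<in> cball 0 (R + S)" using norm_triangle_ineq[of z "x - z"] by simp
  qed (rule conv_smooth[OF f \<eta>])
qed

context
  fixes \<eta> :: "'e \<Rightarrow> real" and \<delta> :: real
  assumes \<eta>: "\<eta> \<in> test_functions" "\<And>x. \<eta> x \<ge> 0" "\<And>x. \<eta> x \<noteq> 0 \<Longrightarrow> norm x < \<delta>" "(\<integral>x. \<eta> x \<partial>M) = 1"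
begin

text \<open>The convolution at \<open>x\<close> is an average of \<open>f (x - y)\<close> with the
  weights \<open>\<eta> y\<close>. The comparison value \<open>c\<close> may depend on
  \<open>y\<close>: a constant \<open>c\<close> gives closeness to \<open>f\<close>, and
  \<open>c y = f (x' - y)\<close> gives preservation of the Lipschitz constant.\<close>

lemma conv_diff_bound:
  fixes f :: "'e \<Rightarrow> real"
  assumes f: "f \<in> borel_measurable borel" "integrable M f"
    and le: "\<And>y. norm y < \<delta> \<Longrightarrow> \<bar>f (x - y) - c y\<bar> \<le> B"
    and c: "c \<in> borel_measurable borel" "integrable M (\<lambda>y. c y * \<eta> y)"
  shows "\<bar>conv f \<eta> x - (\<integral>y. c y * \<eta> y \<partial>M)\<bar> \<le> B"
proof -
  note [measurable] = f(1) c(1) test_measurable[OF \<eta>(1)]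
  have "integrable M (\<lambda>z. f z * \<eta> (x - z))" by (rule conv_integrable[OF f(2) \<eta>(1)])
  then have i: "integrable M (\<lambda>y. f (x - y) * \<eta> y)"
    by (subst (asm) integrable_M_affine[where k = "-1" and a = x]) auto
  have "\<bar>conv f \<eta> x - (\<integral>y. c y * \<eta> y \<partial>M)\<bar> = \<bar>\<integral>y. (f (x - y) - c y) * \<eta> y \<partial>M\<bar>"
    unfolding conv_commute[OF f(1) test_measurable[OF \<eta>(1)]]
    using i c(2) by (simp add: left_diff_distrib)
  also have "\<dots> \<le> (\<integral>y. norm ((f (x - y) - c y) * \<eta> y) \<partial>M)"
    unfolding real_norm_def[symmetric] by (rule integral_norm_bound)
  also have "\<dots> \<le> (\<integral>y. B * \<eta> y \<partial>M)"
  proof (rule integral_mono)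
    show "integrable M (\<lambda>y. norm ((f (x - y) - c y) * \<eta> y))"
      using i c(2) by (intro integrable_norm) (simp add: left_diff_distrib)
    show "norm ((f (x - y) - c y) * \<eta> y) \<le> B * \<eta> y" for y
      using le[of y] \<eta>(2,3)[of y] by (cases "\<eta> y = 0") (auto simp: abs_mult intro!: mult_right_mono)
  qed (use test_integrable[OF \<eta>(1)] in simp)
  finally show ?thesis by (simp add: \<eta>(4))
qed

lemma conv_near:
  assumes "f \<in> borel_measurable borel" "integrable M f" "\<And>y. norm y < \<delta> \<Longrightarrow> \<bar>f (x - y) - c\<bar> \<le> B"
  shows "\<bar>conv f \<eta> x - c\<bar> \<le> B"
  using conv_diff_bound[OF assms(1,2), of x "\<lambda>_. c" B] assms(3) test_integrable[OF \<eta>(1)] by (simp add: \<eta>(4))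

lemma conv_lipschitz:
  assumes L: "L-lipschitz_on UNIV f" and f: "integrable M f"
  shows "L-lipschitz_on UNIV (conv f \<eta>)"
proof (rule lipschitz_onI)
  fix x x'
  have m [measurable]: "f \<in> borel_measurable borel"
    by (intro borel_measurable_continuous_onI lipschitz_on_continuous_on[OF L])
  note [measurable] = test_measurable[OF \<eta>(1)]
  have "integrable M (\<lambda>z. f z * \<eta> (x' - z))" by (rule conv_integrable[OF f \<eta>(1)])
  then have i: "integrable M (\<lambda>y. f (x' - y) * \<eta> y)"
    by (subst (asm) integrable_M_affine[where k = "-1" and a = x']) auto
  have "\<bar>conv f \<eta> x - (\<integral>y. f (x' - y) * \<eta> y \<partial>M)\<bar> \<le> L * dist x x'"
  proof (rule conv_diff_bound[OF m f _ _ i])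
    show "\<bar>f (x - y) - f (x' - y)\<bar> \<le> L * dist x x'" for y
      using lipschitz_onD[OF L, of "x - y" "x' - y"] by (simp add: dist_real_def dist_norm)
  qed simp
  then show "dist (conv f \<eta> x) (conv f \<eta> x') \<le> L * dist x x'"
    unfolding conv_commute[OF m test_measurable[OF \<eta>(1)], of x'] dist_real_def .
qed (rule lipschitz_on_nonneg[OF L])

end

text \<open>The extension is clamped between \<open>- m\<close> and \<open>m\<close> rather than
  multiplied by a cutoff, because minima and maxima of \<open>L\<close>-Lipschitz functions stay
  \<open>L\<close>-Lipschitz. At a given point the clamp is inactive for large \<open>n\<close>, and
  mollifying at radius \<open>1 / Suc n\<close> moves values by at most
  \<open>L / Suc n\<close>.\<close>

lemma lipschitz_test_approximation:
  fixes f :: "'e \<Rightarrow> real"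
  assumes f: "L-lipschitz_on S f" and p: "p \<in> S" "f p = 0"
  obtains \<phi> :: "nat \<Rightarrow> 'e \<Rightarrow> real" where "\<And>n. \<phi> n \<in> test_functions"
    "\<And>n. L-lipschitz_on UNIV (\<phi> n)" "\<And>x. x \<in> S \<Longrightarrow> (\<lambda>n. \<phi> n x) \<longlonglongrightarrow> f x"
\<comment> \<open>The support radius \<open>n / L\<close> below requires \<open>L > 0\<close>. For
  \<open>L = 0\<close> the function is zero on \<open>S\<close>, since it vanishes at
  \<open>p\<close>.\<close>
proof (cases "L = 0")
  case True
  have "f x = 0" if "x \<in> S" for x using lipschitz_onD[OF f that p(1)] p(2) True by simp
  then show ?thesis
    by (intro that[of "\<lambda>_ _. 0"])
      (auto simp: True lipschitz_on_constant intro!: test_functionsI[where K = "{}"] higher_differentiable_const)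
next
  case False
  then have L: "L > 0" using lipschitz_on_nonneg[OF f] by simp
  obtain h where h: "L-lipschitz_on UNIV h" "\<And>x. x \<in> S \<Longrightarrow> h x = f x"
    using lipschitz_on_extension_real[OF f] by blast
  have "\<exists>\<phi>. \<phi> \<in> test_functions \<and> L-lipschitz_on UNIV \<phi> \<and>
      (\<forall>x. \<bar>h x\<bar> \<le> real n - L * norm x \<longrightarrow> \<bar>\<phi> x - h x\<bar> \<le> L / real (Suc n))" for n
  proof -
    define m where "m x = max 0 (real n - L * norm x)" for x :: 'e
    have "L-lipschitz_on UNIV (\<lambda>x::'e. real n - L * norm x)"
    proof (rule lipschitz_onI)
      fix x y :: 'e
      have "\<bar>L * norm x - L * norm y\<bar> \<le> L * norm (x - y)"
        using L norm_triangle_ineq3[of x y] by (simp add: abs_mult flip: right_diff_distrib)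
      then show "dist (real n - L * norm x) (real n - L * norm y) \<le> L * dist x y"
        by (simp add: dist_real_def dist_norm abs_minus_commute)
    qed (use L in simp)
    then have m: "L-lipschitz_on UNIV m" unfolding m_def
      using L by (intro lipschitz_on_min_max lipschitz_on_mono[OF lipschitz_on_constant]) auto
    define g where "g x = max (- m x) (min (h x) (m x))" for x
    have g: "L-lipschitz_on UNIV g" unfolding g_def by (intro lipschitz_on_min_max h m) (simp add: m)
    have gm: "\<bar>g x\<bar> \<le> m x" for x by (auto simp: g_def m_def)
    have g0: "x \<in> cball 0 (real n / L)" if "g x \<noteq> 0" for x
    proof -
      have "m x \<noteq> 0" using gm[of x] that by auto
      then show ?thesis using L by (auto simp: m_def field_simps max_def split: if_splits)
    qed
    have gb: "g \<in> borel_measurable borel"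
      by (intro borel_measurable_continuous_onI lipschitz_on_continuous_on[OF g])
    have "m x \<le> real n" for x using L by (simp add: m_def)
    then have gi: "integrable M g"
      using gm g0 by (intro integrable_bounded_support[OF gb, where A = "cball 0 (real n / L)" and B = "real n"])
        (auto intro: order_trans)
    obtain \<eta> :: "'e \<Rightarrow> real" where \<eta>: "\<eta> \<in> test_functions" "\<And>x. \<eta> x \<ge> 0"
        "\<And>x. \<eta> x \<noteq> 0 \<Longrightarrow> norm x < 1 / real (Suc n)" "(\<integral>x. \<eta> x \<partial>M) = 1"
      using mollifier_exists[of "1 / real (Suc n)"] by auto
    have near: "\<bar>conv g \<eta> x - g x\<bar> \<le> L / real (Suc n)" for x
    proof (rule conv_near[OF \<eta> gb gi])
      fix y :: 'e assume "norm y < 1 / real (Suc n)"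
      have "\<bar>g (x - y) - g x\<bar> \<le> L * norm y"
        using lipschitz_onD[OF g, of "x - y" x] by (simp add: dist_real_def dist_norm)
      also have "\<dots> \<le> L * (1 / real (Suc n))"
        using \<open>norm y < _\<close> L by (intro mult_left_mono) auto
      finally show "\<bar>g (x - y) - g x\<bar> \<le> L / real (Suc n)" by simp
    qed
    have "g x = h x" if "\<bar>h x\<bar> \<le> real n - L * norm x" for x
      using that by (auto simp: g_def m_def)
    with near have "\<bar>conv g \<eta> x - h x\<bar> \<le> L / real (Suc n)" if "\<bar>h x\<bar> \<le> real n - L * norm x" for x
      using that by metis
    then show ?thesis
      using conv_lipschitz[OF \<eta> g gi] conv_test[OF gi \<eta>(1) _ g0] by (intro exI[of _ "conv g \<eta>"]) auto
  qed
  then obtain \<phi> where \<phi>: "\<And>n. \<phi> n \<in> test_functions" "\<And>n. L-lipschitz_on UNIV (\<phi> n)"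
      "\<And>n x. \<bar>h x\<bar> \<le> real n - L * norm x \<Longrightarrow> \<bar>\<phi> n x - h x\<bar> \<le> L / real (Suc n)"
    by metis
  have "(\<lambda>n. \<phi> n x) \<longlonglongrightarrow> h x" for x
  proof (rule LIM_zero_cancel, rule Lim_null_comparison)
    obtain N where N: "\<bar>h x\<bar> + L * norm x \<le> real N" using real_arch_simple by blast
    show "\<forall>\<^sub>F n in sequentially. norm (\<phi> n x - h x) \<le> L / real (Suc n)"
      using eventually_ge_at_top[of N]
    proof eventually_elim
      case (elim n)
      then have "real N \<le> real n" by simp
      with N show ?case using \<phi>(3)[of x n] by simp
    qed
    show "(\<lambda>n. L / real (Suc n)) \<longlonglongrightarrow> 0" by (rule LIMSEQ_Suc[OF lim_const_over_n])
  qed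
  then show ?thesis using \<phi>(1,2) h(2) by (intro that[of \<phi>]) metis+
qed

text \<open>The indicator of the closed \<open>\<delta>\<close>-neighbourhood of \<open>K\<close>,
  mollified at radius \<open>\<delta>\<close>, is 1 on \<open>K\<close> and vanishes off the
  \<open>2 * \<delta>\<close>-neighbourhood. As \<open>K\<close> is closed, these functions converge
  pointwise to its indicator when \<open>\<delta>\<close> shrinks, and dominated convergence
  applies.\<close>

lemma indicator_test_approximation:
  fixes K \<Omega> :: "'e set"
  assumes K: "compact K" "K \<subseteq> \<Omega>" and \<Omega>: "open \<Omega>" and \<epsilon>: "\<epsilon> > 0"
  obtains \<rho> K' where "\<rho> \<in> test_functions" "compact K'" "K' \<subseteq> \<Omega>"
    "\<And>x. x \<notin> K' \<Longrightarrow> \<rho> x = 0" "(\<integral>x. \<bar>\<rho> x - indicator K x\<bar> \<partial>M) < \<epsilon>"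
proof (cases "K = {}")
  case True
  then show ?thesis using \<epsilon>
    by (intro that[of "\<lambda>_. 0" "{}"])
      (auto intro!: test_functionsI[where K = "{}"] higher_differentiable_const)
next
  case False
  define N where "N r = {x. infdist x K \<le> r}" for r
  have ex: "\<exists>a\<in>K. dist x a < s" if "infdist x K < s" for x s
    using that False cInf_lessD[of "dist x ` K" s] by (auto simp: infdist_notempty)
  \<comment> \<open>A positive lower bound for the distance from \<open>K\<close> to the complement
    of \<Omega>, set to 1 when there is no complement.\<close>
  obtain d where d: "d > 0" "\<And>x y. x \<in> K \<Longrightarrow> y \<notin> \<Omega> \<Longrightarrow> d \<le> dist x y"
  proof (cases "- \<Omega> = {}")
    case False
    have "continuous_on K (\<lambda>x. infdist x (- \<Omega>))" by (intro continuous_intros)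
    then obtain x0 where x0: "x0 \<in> K" "\<And>x. x \<in> K \<Longrightarrow> infdist x0 (- \<Omega>) \<le> infdist x (- \<Omega>)"
      using continuous_attains_inf[OF K(1) \<open>K \<noteq> {}\<close>] by blast
    have "infdist x0 (- \<Omega>) > 0"
      by (rule infdist_pos_not_in_closed) (use x0(1) K \<Omega> False in \<open>auto simp: closed_def\<close>)
    moreover have "infdist x0 (- \<Omega>) \<le> dist x y" if "x \<in> K" "y \<notin> \<Omega>" for x y
      using x0(2)[OF that(1)] infdist_le[of y "- \<Omega>" x] that by auto
    ultimately show ?thesis using that by blast
  qed (use that[of 1] in auto)
  have NO: "N r \<subseteq> \<Omega>" if "r < d" for r
  proof
    fix x assume "x \<in> N r"
    then have "infdist x K < d" using that by (simp add: N_def)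
    from ex[OF this] obtain a where "a \<in> K" "dist x a < d" by blast
    then show "x \<in> \<Omega>" using d(2)[of a x] by (auto simp: dist_commute)
  qed
  have Nclosed: "closed (N r)" for r
    unfolding N_def by (intro closed_Collect_le continuous_intros)
  obtain R where R: "\<And>x. x \<in> K \<Longrightarrow> norm x \<le> R" using compact_imp_bounded[OF K(1)] by (auto simp: bounded_iff)
  have Nb: "bounded (N r)" for r
    unfolding bounded_iff
  proof (intro exI ballI)
    fix x assume "x \<in> N r"
    then have "infdist x K < r + 1" by (simp add: N_def)
    from ex[OF this] obtain a where "a \<in> K" "dist x a < r + 1" by blast
    then show "norm x \<le> R + (r + 1)"
      using R[of a] norm_triangle_ineq[of a "x - a"] by (simp add: dist_norm)
  qed
  have Nc: "compact (N r)" for r by (rule bounded_closed_compact[OF Nb Nclosed])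
  \<comment> \<open>The shift by 3 ensures \<open>2 * \<delta> n < d\<close> from
    \<open>n = 0\<close> on.\<close>
  define \<delta> where "\<delta> n = d / real (n + 3)" for n
  have \<delta>: "\<delta> n > 0" "2 * \<delta> n < d" for n using d(1) by (auto simp: \<delta>_def field_simps add_pos_nonneg)
  have "\<exists>\<eta>. \<eta> \<in> test_functions \<and> (\<forall>x. \<eta> x \<ge> 0) \<and> (\<forall>x. \<eta> x \<noteq> 0 \<longrightarrow> norm x < \<delta> n) \<and>
      (\<integral>x. \<eta> x \<partial>M) = 1" for n
    using mollifier_exists[OF \<delta>(1)[of n]] by metis
  then obtain \<eta> :: "nat \<Rightarrow> 'e \<Rightarrow> real" where \<eta>: "\<And>n. \<eta> n \<in> test_functions" "\<And>n x. \<eta> n x \<ge> 0"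
      "\<And>n x. \<eta> n x \<noteq> 0 \<Longrightarrow> norm x < \<delta> n" "\<And>n. (\<integral>x. \<eta> n x \<partial>M) = 1"
    by metis
  define f :: "nat \<Rightarrow> 'e \<Rightarrow> real" where "f n = indicator (N (\<delta> n))" for n
  have fb [measurable]: "f n \<in> borel_measurable borel" for n
    unfolding f_def using Nclosed by (intro borel_measurable_indicator) auto
  have fi: "integrable M (f n)" for n
    by (rule integrable_bounded_support[OF fb Nb[of "\<delta> n"], where B = 1]) (auto simp: f_def indicator_def)
  define \<rho> where "\<rho> n = conv (f n) (\<eta> n)" for n
  have test: "\<rho> n \<in> test_functions" for n
    unfolding \<rho>_def by (rule conv_test[OF fi \<eta>(1) Nb[of "\<delta> n"]]) (auto simp: f_def indicator_def)
  have bd: "\<bar>\<rho> n x\<bar> \<le> 1" for n x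
    using conv_near[OF \<eta>(1)[of n] \<eta>(2,3,4) fb fi, where x = x and c = 0 and B = 1] by (auto simp: \<rho>_def f_def indicator_def)
  have supp: "x \<in> N (2 * \<delta> n)" if "\<rho> n x \<noteq> 0" for n x
  proof -
    from that obtain z where "f n z \<noteq> 0" "\<eta> n (x - z) \<noteq> 0" unfolding \<rho>_def by (rule conv_support)
    then have "infdist z K \<le> \<delta> n" "norm (x - z) < \<delta> n" using \<eta>(3) by (auto simp: f_def N_def indicator_def)
    then show ?thesis using infdist_triangle[of x K z] by (simp add: N_def dist_norm)
  qed
  have one: "\<rho> n x = 1" if "x \<in> K" for n x
  proof -
    have "\<bar>conv (f n) (\<eta> n) x - 1\<bar> \<le> 0"
    proof (rule conv_near[OF \<eta>(1)[of n] \<eta>(2,3,4) fb fi])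
      fix y :: 'e assume y: "norm y < \<delta> n"
      have "infdist (x - y) K \<le> dist (x - y) x" by (rule infdist_le[OF that])
      with y have "x - y \<in> N (\<delta> n)" by (simp add: N_def dist_norm)
      then show "\<bar>f n (x - y) - 1\<bar> \<le> 0" by (simp add: f_def)
    qed
    then show ?thesis by (simp add: \<rho>_def)
  qed
  have lim: "(\<lambda>n. \<bar>\<rho> n x - indicator K x\<bar>) \<longlonglongrightarrow> 0" for x
  proof (cases "x \<in> K")
    case False
    have "infdist x K > 0"
      using infdist_pos_not_in_closed[OF compact_imp_closed[OF K(1)] \<open>K \<noteq> {}\<close> False] .
    moreover have "(\<lambda>n. 2 * \<delta> n) \<longlonglongrightarrow> 0"
      unfolding \<delta>_def using LIMSEQ_ignore_initial_segment[OF lim_const_over_n[of "2 * d"], of 3] by simp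
    ultimately have "\<forall>\<^sub>F n in sequentially. 2 * \<delta> n < infdist x K" by (rule order_tendstoD(2)[rotated])
    then have "\<forall>\<^sub>F n in sequentially. \<bar>\<rho> n x - indicator K x\<bar> = 0"
      by eventually_elim (use supp False in \<open>force simp: N_def\<close>)
    then show ?thesis by (rule tendsto_eventually)
  qed (simp add: one)
  have Kb [measurable]: "K \<in> sets borel" using K(1) by (simp add: borel_closed compact_imp_closed)
  note [measurable] = test_measurable[OF test]
  have "(\<lambda>n. \<integral>x. \<bar>\<rho> n x - indicator K x\<bar> \<partial>M) \<longlonglongrightarrow> (\<integral>x. 0 \<partial>M)"
  proof (rule integral_dominated_convergence[where w = "\<lambda>x. 2 * indicator (N d) x"])
    have "integrable M (indicator (N d) :: 'e \<Rightarrow> real)"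
      using M_finite[OF Nb[of d]] Nclosed by (intro integrable_real_indicator) auto
    then show "integrable M (\<lambda>x. 2 * indicator (N d) x :: real)" by simp
    show "AE x in M. norm \<bar>\<rho> n x - indicator K x\<bar> \<le> 2 * indicator (N d) x" for n
    proof (rule AE_I2)
      fix x
      show "norm \<bar>\<rho> n x - indicator K x\<bar> \<le> 2 * indicator (N d) x"
      proof (cases "x \<in> N d")
        case True
        then show ?thesis using bd[of n x] by (auto simp: indicator_def split: if_splits)
      next
        case False
        then have "\<rho> n x = 0" "x \<notin> K" using supp[of n x] \<delta>(2)[of n] d(1) by (auto simp: N_def)
        then show ?thesis by simp
      qed
    qed
  qed (use lim in auto)
  then have "\<forall>\<^sub>F n in sequentially. (\<integral>x. \<bar>\<rho> n x - indicator K x\<bar> \<partial>M) < \<epsilon>"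
    using \<epsilon> by (intro order_tendstoD(2)[where y = 0]) simp_all
  then obtain n where n: "(\<integral>x. \<bar>\<rho> n x - indicator K x\<bar> \<partial>M) < \<epsilon>"
    by (auto simp: eventually_sequentially)
  show ?thesis
    by (rule that[OF test Nc NO[OF \<delta>(2)] _ n]) (use supp in blast)
qed

end

section \<open>Integrable fields and spindles\<close>

context coordinates
begin

text \<open>Reduces fields to finitely many real functions, to which comparison, series and density
  arguments are applied.\<close>

lemma integrable_iff_co:
  "integrable N g \<longleftrightarrow> (\<forall>i. integrable N (\<lambda>x. co i (g x)))"
proof
  assume "\<forall>i. integrable N (\<lambda>x. co i (g x))"
  then have "integrable N (\<lambda>x. \<Sum>i\<in>UNIV. co i (g x) *\<^sub>R b i)"
    by (intro Bochner_Integration.integrable_sum integrable_scaleR_left) auto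
  then show "integrable N g" by (simp add: co_sum)
qed (auto intro: integrable_bounded_linear[OF co_bounded_linear])

lemma integrable_norm_co:
  fixes g :: "'a \<Rightarrow> 'e"
  assumes "integrable N g"
  shows "integrable N (\<lambda>x. norm (g x))"
proof (rule Bochner_Integration.integrable_bound)
  show "integrable N (\<lambda>x. \<Sum>i\<in>UNIV. \<bar>co i (g x)\<bar> * norm (b i))"
    using assms unfolding integrable_iff_co by (intro Bochner_Integration.integrable_sum integrable_mult_left integrable_abs) auto
  show "(\<lambda>x. norm (g x)) \<in> borel_measurable N" using borel_measurable_integrable[OF assms] by simp
  have "norm (g x) \<le> (\<Sum>i\<in>UNIV. \<bar>co i (g x)\<bar> * norm (b i))" for x
    using norm_sum[of "\<lambda>i. co i (g x) *\<^sub>R b i" UNIV] by (simp add: co_sum)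
  then show "AE x in N. norm (norm (g x)) \<le> norm (\<Sum>i\<in>UNIV. \<bar>co i (g x)\<bar> * norm (b i))"
    by (intro AE_I2) (simp add: abs_le_iff order_trans[OF _ abs_ge_self])
qed

abbreviation "lam \<equiv> completion M"

lemma L1_iff: "g \<in> L1 b \<Omega> \<longleftrightarrow> integrable lam g \<and> (\<forall>x. x \<notin> \<Omega> \<longrightarrow> g x = 0)"
proof -
  have "(\<lambda>x. indicator \<Omega> x *\<^sub>R g x) = g" if "\<forall>x. x \<notin> \<Omega> \<longrightarrow> g x = 0"
    using that by (auto simp: indicator_def)
  then show ?thesis by (auto simp: L1_def set_integrable_def lebesgue_basis_eq)
qed

lemma L1_norm_eq:
  assumes "g \<in> L1 b \<Omega>"
  shows "L1_norm b \<Omega> g = (\<integral>x. norm (g x) \<partial>lam)"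
proof -
  have "(\<lambda>x. indicator \<Omega> x *\<^sub>R norm (g x)) = (\<lambda>x. norm (g x))"
    using assms by (force simp: indicator_def L1_iff)
  then show ?thesis by (simp add: L1_norm_def set_lebesgue_integral_def lebesgue_basis_eq)
qed

text \<open>Coordinate-free form of minus the divergence of \<open>g\<close> tested on
  \<open>\<phi>\<close>. With this sign a flow from x to y pairs to
  \<open>\<phi> y - \<phi> x\<close>.\<close>

definition pair :: "('e \<Rightarrow> 'e) \<Rightarrow> ('e \<Rightarrow> real) \<Rightarrow> real" where
  "pair g \<phi> = (\<integral>x. frechet_derivative \<phi> (at x) (g x) \<partial>lam)"

lemma measurable_lam: "f \<in> borel_measurable borel \<Longrightarrow> f \<in> borel_measurable lam"
  by (intro measurable_completion) (simp add: measurable_cong_sets[OF sets_M refl])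

lemma test_derivative_expand:
  "(\<phi> :: 'e \<Rightarrow> real) \<in> test_functions
    \<Longrightarrow> frechet_derivative \<phi> (at x) v = (\<Sum>i\<in>UNIV. co i v * frechet_derivative \<phi> (at x) (b i))"
  by (rule derivative_expand[OF test_derivative_linear])

lemma integrable_co_derivative:
  fixes \<phi> :: "'e \<Rightarrow> real"
  assumes g: "integrable lam g" and \<phi>: "\<phi> \<in> test_functions"
  shows "integrable lam (\<lambda>x. co i (g x) * frechet_derivative \<phi> (at x) (b i))"
proof -
  obtain B where B: "\<And>x. \<bar>frechet_derivative \<phi> (at x) (b i)\<bar> \<le> B"
    using test_bounded[OF test_derivative[OF \<phi>]] by blast
  have gi: "integrable lam (\<lambda>x. co i (g x))" using g integrable_iff_co by blast
  have m: "(\<lambda>x. frechet_derivative \<phi> (at x) (b i)) \<in> borel_measurable lam"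
    by (intro measurable_lam test_measurable test_derivative \<phi>)
  show ?thesis
  proof (rule Bochner_Integration.integrable_bound[of lam "\<lambda>x. B * co i (g x)"])
    have "norm (co i (g x) * frechet_derivative \<phi> (at x) (b i)) \<le> norm (B * co i (g x))" for x
      using mult_left_mono[OF order_trans[OF B abs_ge_self], of "\<bar>co i (g x)\<bar>" x]
      by (simp add: abs_mult mult.commute)
    then show "AE x in lam. norm (co i (g x) * frechet_derivative \<phi> (at x) (b i)) \<le> norm (B * co i (g x))"
      by simp
    show "(\<lambda>x. co i (g x) * frechet_derivative \<phi> (at x) (b i)) \<in> borel_measurable lam"
      by (rule borel_measurable_times[OF borel_measurable_integrable[OF gi] m])
  qed (use gi in simp)
qed

lemma pair_integrable:
  fixes \<phi> :: "'e \<Rightarrow> real"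
  assumes "integrable lam g" "\<phi> \<in> test_functions"
  shows "integrable lam (\<lambda>x. frechet_derivative \<phi> (at x) (g x))"
  unfolding test_derivative_expand[OF assms(2), of _ "g _"]
  by (intro Bochner_Integration.integrable_sum integrable_co_derivative assms)

lemma div_distribution_eq:
  fixes \<phi> :: "'e \<Rightarrow> real"
  assumes "integrable lam g" "\<phi> \<in> test_functions"
  shows "div_distribution b g \<phi> = - pair g \<phi>"
  unfolding div_distribution_def pair_def test_derivative_expand[OF assms(2), of _ "g _"] lebesgue_basis_eq
  by (simp add: sum_negf integrable_co_derivative[OF assms])

lemma pair_bound:
  assumes g: "integrable lam g" and \<phi>: "\<phi> \<in> test_functions" "L-lipschitz_on UNIV \<phi>"
  shows "\<bar>pair g \<phi>\<bar> \<le> L * (\<integral>x. norm (g x) \<partial>lam)"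
proof -
  have "\<bar>pair g \<phi>\<bar> \<le> (\<integral>x. norm (frechet_derivative \<phi> (at x) (g x)) \<partial>lam)"
    unfolding pair_def real_norm_def[symmetric] by (rule integral_norm_bound)
  also have "\<dots> \<le> (\<integral>x. L * norm (g x) \<partial>lam)"
  proof (rule integral_mono[OF integrable_norm[OF pair_integrable[OF g \<phi>(1)]]])
    show "integrable lam (\<lambda>x. L * norm (g x))" using integrable_norm_co[OF g] by simp
    show "norm (frechet_derivative \<phi> (at x) (g x)) \<le> L * norm (g x)" for x
      unfolding real_norm_def by (rule lipschitz_derivative_bound[OF \<phi>(2) test_differentiable[OF \<phi>(1)]])
  qed
  finally show ?thesis by simp
qed

lemma pair_add:
  assumes "integrable lam g" "integrable lam h" "\<phi> \<in> test_functions"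
  shows "pair (\<lambda>x. g x + h x) \<phi> = pair g \<phi> + pair h \<phi>"
  using pair_integrable[OF assms(1,3)] pair_integrable[OF assms(2,3)]
  by (simp add: pair_def linear_add[OF test_derivative_linear[OF assms(3)]])

lemma pair_scale:
  assumes "\<phi> \<in> test_functions"
  shows "pair (\<lambda>x. r *\<^sub>R g x) \<phi> = r * pair g \<phi>"
  by (simp add: pair_def linear_scale[OF test_derivative_linear[OF assms]])

lemma integrable_sub:
  "integrable N g \<Longrightarrow> integrable N h \<Longrightarrow> integrable N (\<lambda>x. g x - h x :: 'e)"
  unfolding integrable_iff_co by (auto simp: linear_diff[OF co_linear])

lemma pair_diff:
  assumes "integrable lam g" "integrable lam h" "\<phi> \<in> test_functions"
  shows "pair (\<lambda>x. g x - h x) \<phi> = pair g \<phi> - pair h \<phi>"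
  using pair_integrable[OF assms(1,3)] pair_integrable[OF assms(2,3)]
  by (simp add: pair_def linear_diff[OF test_derivative_linear[OF assms(3)]])

text \<open>
  Density of the uniform superposition over \<open>z \<in> B\<close> of the segments from \<open>x\<close> to \<open>z\<close>,
  relative to the radial field \<open>w - x\<close>: the substitution \<open>w = x + t (z - x)\<close> has Jacobian
  \<open>t ^ d\<close>, and the velocity \<open>z - x\<close> is \<open>(w - x) / t\<close>.
\<close>

definition radial_weight :: "'e \<Rightarrow> 'e set \<Rightarrow> 'e \<Rightarrow> real" where
  "radial_weight x B w = (\<integral>t. indicator {0<..<1} t *
     (indicator B (x + (1 / t) *\<^sub>R (w - x)) / t ^ Suc CARD('n)) \<partial>lborel)"

text \<open>Fubini's theorem for \<open>t\<close> and \<open>w\<close>, with the substitution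
  \<open>w = x + t (z - x)\<close> on each slice. The growth condition on \<open>\<psi>\<close>
  absorbs the factor \<open>1 / t\<close> left over after the Jacobian, and so removes the
  singularity at the tip \<open>x\<close>.\<close>

lemma radial_weight_integral:
  fixes x :: 'e
  assumes B [measurable]: "B \<in> sets borel" and bdd: "bounded B"
    and \<psi> [measurable]: "\<psi> \<in> borel_measurable borel" and le: "\<And>w. \<bar>\<psi> w\<bar> \<le> C * norm (w - x)"
  shows "integrable M (\<lambda>w. radial_weight x B w * \<psi> w)"
    and "(\<integral>w. radial_weight x B w * \<psi> w \<partial>M) =
      (\<integral>t. indicator {0<..<1} t * (\<integral>z. indicator B z * (\<psi> (x + t *\<^sub>R (z - x)) / t) \<partial>M) \<partial>lborel)"
proof -
  interpret M: sigma_finite_measure M by (rule M_sigma_finite)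
  interpret P: pair_sigma_finite lborel M ..
  obtain R where R: "\<And>z. z \<in> B \<Longrightarrow> norm z \<le> R" using bdd by (auto simp: bounded_iff)
  define r where "r = R + norm x"
  have r: "norm (z - x) \<le> r" if "z \<in> B" for z
    using R[OF that] norm_triangle_ineq4[of z x] by (simp add: r_def)
  have Bfin: "integrable M (indicator B :: 'e \<Rightarrow> real)"
    using M_finite[OF bdd B] by (intro integrable_real_indicator) auto
  have C: "0 \<le> C * norm (w - x)" for w using le[of w] by linarith
  \<comment> \<open>The function is a parameter because the slices serve twice: for the given
    \<open>\<psi>\<close>, and for its absolute value when integrability on the product is
    checked.\<close>
  define K where "K t \<psi> = (\<integral>z. indicator B z * (\<psi> (x + t *\<^sub>R (z - x)) / t) \<partial>M)"
    for t :: real and \<psi> :: "'e \<Rightarrow> real"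
  define f where "f \<psi> t w = indicator {0<..<1} t *
      (indicator B (x + (1 / t) *\<^sub>R (w - x)) / t ^ Suc CARD('n)) * \<psi> w"
    for \<psi> :: "'e \<Rightarrow> real" and t :: real and w
  have slice: "integrable M (f \<psi> t)" "(\<integral>w. f \<psi> t w \<partial>M) = indicator {0<..<1} t * K t \<psi>"
      "\<bar>indicator {0<..<1} t * K t \<psi>\<bar> \<le> indicator {0<..<1} t * (\<integral>z. indicator B z * (\<bar>C\<bar> * r) \<partial>M)"
    if [measurable]: "\<psi> \<in> borel_measurable borel" and le: "\<And>w. \<bar>\<psi> w\<bar> \<le> C * norm (w - x)" for \<psi> t
  proof -
    have "integrable M (f \<psi> t) \<and> (\<integral>w. f \<psi> t w \<partial>M) = indicator {0<..<1} t * K t \<psi> \<and>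
      \<bar>indicator {0<..<1} t * K t \<psi>\<bar> \<le> indicator {0<..<1} t * (\<integral>z. indicator B z * (\<bar>C\<bar> * r) \<partial>M)"
    proof (cases "0 < t \<and> t < 1")
      case True
      then have t: "t > 0" "t \<noteq> 0" "t < 1" by auto
      have [measurable]: "f \<psi> t \<in> borel_measurable borel" unfolding f_def by measurable
      have w: "(1 - t) *\<^sub>R x + t *\<^sub>R z = x + t *\<^sub>R (z - x)" for z by (simp add: algebra_simps)
      \<comment> \<open>Of the power \<open>t ^ Suc d\<close> in the weight, \<open>t ^ d\<close>
        will cancel against the Jacobian; the remaining \<open>1 / t\<close> stays with
        \<open>\<psi>\<close>.\<close>
      have subst: "f \<psi> t ((1 - t) *\<^sub>R x + t *\<^sub>R z)
          = (1 / t ^ CARD('n)) * (indicator B z * (\<psi> (x + t *\<^sub>R (z - x)) / t))" for z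
        unfolding w f_def using t by (simp add: field_simps)
      have bound: "\<bar>indicator B z * (\<psi> (x + t *\<^sub>R (z - x)) / t)\<bar> \<le> indicator B z * (\<bar>C\<bar> * r)" for z
      proof (cases "z \<in> B")
        case True
        have "\<bar>\<psi> (x + t *\<^sub>R (z - x))\<bar> \<le> C * (t * norm (z - x))"
          using le[of "x + t *\<^sub>R (z - x)"] t by simp
        also have "\<dots> \<le> \<bar>C\<bar> * (t * r)"
          using r[OF True] t by (intro mult_mono) (auto intro: mult_nonneg_nonneg)
        finally show ?thesis using True t by (simp add: field_simps)
      qed simp
      have Bi: "integrable M (\<lambda>z. indicator B z * (\<bar>C\<bar> * r))" using Bfin by simp
      have int: "integrable M (\<lambda>z. indicator B z * (\<psi> (x + t *\<^sub>R (z - x)) / t))"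
      proof (rule Bochner_Integration.integrable_bound[OF Bi])
        show "AE z in M. norm (indicator B z * (\<psi> (x + t *\<^sub>R (z - x)) / t)) \<le> norm (indicator B z * (\<bar>C\<bar> * r))"
          unfolding real_norm_def by (intro AE_I2 order_trans[OF bound abs_ge_self])
      qed measurable
      have "integrable M (f \<psi> t)"
        by (subst integrable_M_affine[where k = t and a = "(1 - t) *\<^sub>R x"])
          (simp_all only: subst integrable_mult_right int t(2) simp_thms
            \<open>f \<psi> t \<in> borel_measurable borel\<close>)
      moreover have "(\<integral>w. f \<psi> t w \<partial>M) = K t \<psi>"
        by (subst integral_M_affine[where k = t and a = "(1 - t) *\<^sub>R x"])
          (use t in \<open>simp_all add: subst K_def\<close>)
      moreover have "\<bar>K t \<psi>\<bar> \<le> (\<integral>z. indicator B z * (\<bar>C\<bar> * r) \<partial>M)"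
        unfolding K_def
        by (rule order_trans[OF integral_abs_bound integral_mono[OF integrable_abs[OF int] Bi bound]])
      ultimately show ?thesis using t by simp
    next
      case False
      then have "indicator {0<..<1} t = (0::real)" by (simp add: indicator_def)
      moreover from this have "f \<psi> t = (\<lambda>_. 0)" unfolding f_def by simp
      ultimately show ?thesis by simp
    qed
    then show "integrable M (f \<psi> t)" "(\<integral>w. f \<psi> t w \<partial>M) = indicator {0<..<1} t * K t \<psi>"
      "\<bar>indicator {0<..<1} t * K t \<psi>\<bar> \<le> indicator {0<..<1} t * (\<integral>z. indicator B z * (\<bar>C\<bar> * r) \<partial>M)"
      by auto
  qed
  have prod: "integrable (lborel \<Otimes>\<^sub>M M) (case_prod (f \<psi>))"
  proof (rule P.Fubini_integrable)
    show "case_prod (f \<psi>) \<in> borel_measurable (lborel \<Otimes>\<^sub>M M)" unfolding f_def by measurable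
    have ab: "(\<lambda>w. \<bar>\<psi> w\<bar>) \<in> borel_measurable borel" "\<bar>\<bar>\<psi> w\<bar>\<bar> \<le> C * norm (w - x)" for w using le by auto
    have "norm (f \<psi> t w) = f (\<lambda>w. \<bar>\<psi> w\<bar>) t w" for t w
      by (cases "0 < t \<and> t < 1") (auto simp: f_def abs_mult indicator_def)
    then have eq: "(\<integral>w. norm (case_prod (f \<psi>) (t, w)) \<partial>M) = indicator {0<..<1} t * K t (\<lambda>w. \<bar>\<psi> w\<bar>)" for t
      using slice(2)[OF ab, of t] by simp
    show "integrable lborel (\<lambda>t. \<integral>w. norm (case_prod (f \<psi>) (t, w)) \<partial>M)"
    proof (rule Bochner_Integration.integrable_bound)
      show "integrable lborel (\<lambda>t. indicator {0<..<1::real} t * (\<integral>z. indicator B z * (\<bar>C\<bar> * r) \<partial>M))"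
        by (intro integrable_mult_left integrable_real_indicator) auto
      show "(\<lambda>t. \<integral>w. norm (case_prod (f \<psi>) (t, w)) \<partial>M) \<in> borel_measurable lborel"
        unfolding f_def by measurable
      show "AE t in lborel. norm (\<integral>w. norm (case_prod (f \<psi>) (t, w)) \<partial>M)
          \<le> norm (indicator {0<..<1::real} t * (\<integral>z. indicator B z * (\<bar>C\<bar> * r) \<partial>M))"
        unfolding eq unfolding real_norm_def by (intro AE_I2 order_trans[OF slice(3)[OF ab] abs_ge_self])
    qed
    show "AE t in lborel. integrable M (\<lambda>w. case_prod (f \<psi>) (t, w))"
      using slice(1)[OF \<psi> le] by simp
  qed
  \<comment> \<open>Also true where the integral in \<open>t\<close> diverges, which can happen only
    at \<open>w = x\<close>: there both sides are zero.\<close>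
  have sw: "(\<integral>t. f \<psi> t w \<partial>lborel) = radial_weight x B w * \<psi> w" for w
    unfolding f_def radial_weight_def by (rule integral_mult_left_zero)
  show "integrable M (\<lambda>w. radial_weight x B w * \<psi> w)"
    using P.integrable_snd[OF prod] by (simp add: sw)
  show "(\<integral>w. radial_weight x B w * \<psi> w \<partial>M) =
      (\<integral>t. indicator {0<..<1} t * (\<integral>z. indicator B z * (\<psi> (x + t *\<^sub>R (z - x)) / t) \<partial>M) \<partial>lborel)"
    using P.Fubini_integral[OF prod] by (simp add: sw slice(2)[OF \<psi> le] K_def)
qed

text \<open>If the point projected from \<open>x\<close> through \<open>w\<close> lay in
  \<open>B\<close>, then \<open>w\<close>, a convex combination of it and \<open>x\<close>, would
  belong to \<Omega>. This is how convexity keeps the flow inside the domain.\<close>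

lemma radial_weight_outside:
  assumes "convex \<Omega>" "x \<in> \<Omega>" "B \<subseteq> \<Omega>" "w \<notin> \<Omega>"
  shows "radial_weight x B w = 0"
proof -
  have "indicator {0<..<1} t * (indicator B (x + (1 / t) *\<^sub>R (w - x)) / t ^ Suc CARD('n)) = (0::real)" for t
  proof (cases "0 < t \<and> t < 1 \<and> x + (1 / t) *\<^sub>R (w - x) \<in> B")
    case True
    then have "(1 - t) *\<^sub>R x + t *\<^sub>R (x + (1 / t) *\<^sub>R (w - x)) \<in> \<Omega>"
      using assms by (intro convexD[OF assms(1,2)]) auto
    then show ?thesis using True assms(4) by (simp add: algebra_simps)
  qed (auto simp: indicator_def)
  then show ?thesis unfolding radial_weight_def by (simp only: integral_zero)
qed

lemma segment_FTC:
  fixes \<phi> :: "'e \<Rightarrow> real"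
  assumes \<phi>: "\<phi> \<in> test_functions"
  shows "(\<integral>t. indicator {0<..<1} t * frechet_derivative \<phi> (at (x + t *\<^sub>R v)) v \<partial>lborel) = \<phi> (x + v) - \<phi> x"
proof -
  have d: "((\<lambda>t. \<phi> (x + t *\<^sub>R v)) has_vector_derivative frechet_derivative \<phi> (at (x + t *\<^sub>R v)) v)
      (at t within {0..1})" for t
  proof -
    have "((\<lambda>t. x + t *\<^sub>R v) has_derivative (\<lambda>s. s *\<^sub>R v)) (at t within {0..1})"
      by (auto intro!: derivative_eq_intros)
    from has_derivative_compose[OF this test_differentiable[OF \<phi>]]
    show ?thesis by (simp add: has_vector_derivative_def linear_scale[OF test_derivative_linear[OF \<phi>]])
  qed
  have c: "continuous_on {0..1} (\<lambda>t. frechet_derivative \<phi> (at (x + t *\<^sub>R v)) v)"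
  proof -
    have "continuous_on UNIV (\<lambda>y. frechet_derivative \<phi> (at y) v)"
      by (intro test_continuous test_derivative \<phi>)
    moreover have "continuous_on {0..1} (\<lambda>t::real. x + t *\<^sub>R v)" by (intro continuous_intros)
    ultimately show ?thesis by (rule continuous_on_compose2) auto
  qed
  have "(\<integral>t. indicator {0..1} t *\<^sub>R frechet_derivative \<phi> (at (x + t *\<^sub>R v)) v \<partial>lborel)
      = \<phi> (x + 1 *\<^sub>R v) - \<phi> (x + 0 *\<^sub>R v)"
    by (rule integral_FTC_Icc[OF _ d c]) simp
  moreover have "(\<integral>t. indicator {0..1} t *\<^sub>R frechet_derivative \<phi> (at (x + t *\<^sub>R v)) v \<partial>lborel)
     = (\<integral>t. indicator {0<..<1} t * frechet_derivative \<phi> (at (x + t *\<^sub>R v)) v \<partial>lborel)"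
  proof (rule integral_cong_AE)
    have m: "(\<lambda>t. frechet_derivative \<phi> (at (x + t *\<^sub>R v)) v) \<in> borel_measurable lborel"
      using measurable_compose[OF _ test_measurable[OF test_derivative[OF \<phi>, of v]], of "\<lambda>t. x + t *\<^sub>R v" borel]
      by simp
    show "(\<lambda>t. indicator {0..1} t *\<^sub>R frechet_derivative \<phi> (at (x + t *\<^sub>R v)) v) \<in> borel_measurable lborel"
      "(\<lambda>t. indicator {0<..<1} t * frechet_derivative \<phi> (at (x + t *\<^sub>R v)) v) \<in> borel_measurable lborel"
      using m by measurable
    have "AE t in lborel. t \<notin> {0, 1 :: real}"
      by (rule AE_not_in) (simp add: finite_imp_null_set_lborel)
    then show "AE t in lborel. indicator {0..1} t *\<^sub>R frechet_derivative \<phi> (at (x + t *\<^sub>R v)) v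
      = indicator {0<..<1} t * frechet_derivative \<phi> (at (x + t *\<^sub>R v)) v"
      by eventually_elim (auto simp: indicator_def)
  qed
  ultimately show ?thesis by simp
qed

text \<open>The field is the radial weight times \<open>w - x\<close>, divided by the measure of
  \<open>B\<close>: the average of the segments from \<open>x\<close> to the points of
  \<open>B\<close>. Taking \<open>\<psi>\<close> to be the norm of \<open>w - x\<close> computes its
  norm as the average length of the segments; taking the radial derivative of \<open>\<phi>\<close>
  computes its divergence.\<close>

lemma cone_field:
  fixes x :: 'e
  assumes \<Omega>: "convex \<Omega>" "x \<in> \<Omega>" and B [measurable]: "B \<in> sets borel" and bdd: "bounded B" "B \<subseteq> \<Omega>"
    and pos: "measure M B > 0" and r: "\<And>z. z \<in> B \<Longrightarrow> norm (z - x) \<le> r"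
  obtains g where "g \<in> L1 b \<Omega>" "(\<integral>w. norm (g w) \<partial>lam) \<le> r"
    "\<And>\<phi>. \<phi> \<in> test_functions \<Longrightarrow> pair g \<phi> = (\<integral>z. indicator B z * \<phi> z \<partial>M) / measure M B - \<phi> x"
proof -
  interpret M: sigma_finite_measure M by (rule M_sigma_finite)
  interpret P: pair_sigma_finite lborel M ..
  define m where "m = measure M B"
  have m: "m > 0" using pos by (simp add: m_def)
  have Bfin: "integrable M (indicator B :: 'e \<Rightarrow> real)"
    using M_finite[OF bdd(1) B] by (intro integrable_real_indicator) auto
  have mB: "(\<integral>z. indicator B z \<partial>M) = m" by (simp add: m_def)
  define S where "S = radial_weight x B"
  have [measurable]: "S \<in> borel_measurable borel" unfolding S_def radial_weight_def
    by measurable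
  have S0: "S w \<ge> 0" for w unfolding S_def radial_weight_def
    by (intro integral_nonneg_AE AE_I2) (auto simp: indicator_def)
  define g where "g w = (S w / m) *\<^sub>R (w - x)" for w
  have gm [measurable]: "g \<in> borel_measurable borel" unfolding g_def by measurable
  obtain C where C: "C \<ge> 0" "\<And>i x. \<bar>co i x\<bar> \<le> C * norm x" using co_bound by blast
  have int: "integrable M (\<lambda>w. co i (g w))" for i
  proof -
    have "(\<lambda>w. co i (w - x)) \<in> borel_measurable borel" by measurable
    from radial_weight_integral(1)[OF B bdd(1) this C(2)]
    show ?thesis by (simp add: g_def S_def linear_scale[OF co_linear])
  qed
  then have gint: "integrable lam g"
    unfolding integrable_iff_co by (auto intro!: integrable_completion[THEN iffD2] simp: measurable_cong_sets[OF sets_M refl])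
  have z0: "g w = 0" if "w \<notin> \<Omega>" for w
    using radial_weight_outside[OF \<Omega> bdd(2) that] by (simp add: g_def S_def)
  have nb: "(\<lambda>w. norm (w - x)) \<in> borel_measurable borel" by measurable
  have "(\<integral>w. norm (g w) \<partial>lam) = (\<integral>w. norm (g w) \<partial>M)"
    by (rule integral_completion) (simp add: measurable_cong_sets[OF sets_M refl])
  also have "\<dots> = (\<integral>w. S w * norm (w - x) \<partial>M) / m"
    using S0 m by (simp add: g_def)
  also have "(\<integral>w. S w * norm (w - x) \<partial>M)
     = (\<integral>t. indicator {0<..<1::real} t * (\<integral>z. indicator B z * norm (z - x) \<partial>M) \<partial>lborel)"
  proof -
    have "(\<integral>w. S w * norm (w - x) \<partial>M) = (\<integral>t. indicator {0<..<1} t *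
        (\<integral>z. indicator B z * (norm (x + t *\<^sub>R (z - x) - x) / t) \<partial>M) \<partial>lborel)"
      unfolding S_def by (rule radial_weight_integral(2)[OF B bdd(1) nb, where C = 1]) simp
    moreover have "norm (x + t *\<^sub>R (z - x) - x) / t = norm (z - x)" if "0 < t" for t z
      using that by simp
    then have "indicator {0<..<1} t * (\<integral>z. indicator B z * (norm (x + t *\<^sub>R (z - x) - x) / t) \<partial>M)
        = indicator {0<..<1} t * (\<integral>z. indicator B z * norm (z - x) \<partial>M)" for t
      by (cases "0 < t \<and> t < 1") (simp_all only: indicator_simps greaterThanLessThan_iff mult_zero_left simp_thms not_False_eq_True)
    ultimately show ?thesis by (simp only:)
  qed
  also have "\<dots> = (\<integral>z. indicator B z * norm (z - x) \<partial>M)" by simp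
  also have "\<dots> \<le> (\<integral>z. indicator B z * r \<partial>M)"
  proof (rule integral_mono)
    show i: "integrable M (\<lambda>z. indicator B z * r)" using Bfin by simp
    show le: "indicator B z * norm (z - x) \<le> indicator B z * r" for z using r by (auto simp: indicator_def)
    show "integrable M (\<lambda>z. indicator B z * norm (z - x))"
      by (rule Bochner_Integration.integrable_bound[OF i])
        (auto intro!: AE_I2 order_trans[OF _ abs_ge_self] simp: r indicator_def)
  qed
  finally have norm: "(\<integral>w. norm (g w) \<partial>lam) \<le> r" using m by (simp add: m_def[symmetric] field_simps)
  have "pair g \<phi> = (\<integral>z. indicator B z * \<phi> z \<partial>M) / measure M B - \<phi> x" if \<phi>: "\<phi> \<in> test_functions" for \<phi>
  proof -
    define \<psi> where "\<psi> w = frechet_derivative \<phi> (at w) (w - x)" for w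
    note Dl = test_derivative_linear[OF \<phi>]
    have Dm [measurable]: "(\<lambda>w. frechet_derivative \<phi> (at w) v) \<in> borel_measurable borel" for v
      by (intro test_measurable test_derivative \<phi>)
    have [measurable]: "\<psi> \<in> borel_measurable borel"
      unfolding \<psi>_def test_derivative_expand[OF \<phi>, of _ "_ - x"] by measurable
    obtain D where D: "D \<ge> 0" "\<And>w v. \<bar>frechet_derivative \<phi> (at w) v\<bar> \<le> D * norm v"
      using test_derivative_bounded[OF \<phi>] by blast
    define f where "f t z = indicator {0<..<1} t * (indicator B z * frechet_derivative \<phi> (at (x + t *\<^sub>R (z - x))) (z - x))"
      for t :: real and z
    have "pair g \<phi> = (\<integral>w. (S w * \<psi> w) / m \<partial>lam)"
      by (simp add: pair_def g_def \<psi>_def linear_scale[OF Dl])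
    also have "\<dots> = (\<integral>w. (S w * \<psi> w) / m \<partial>M)"
      by (rule integral_completion) (simp add: measurable_cong_sets[OF sets_M refl])
    also have "\<dots> = (\<integral>w. S w * \<psi> w \<partial>M) / m" by simp
    also have "(\<integral>w. S w * \<psi> w \<partial>M)
       = (\<integral>t. (\<integral>z. f t z \<partial>M) \<partial>lborel)"
    proof -
      have "\<bar>\<psi> w\<bar> \<le> D * norm (w - x)" for w unfolding \<psi>_def by (rule D(2))
      then have 1: "(\<integral>w. S w * \<psi> w \<partial>M) =
          (\<integral>t. indicator {0<..<1} t * (\<integral>z. indicator B z * (\<psi> (x + t *\<^sub>R (z - x)) / t) \<partial>M) \<partial>lborel)"
        unfolding S_def by (intro radial_weight_integral(2)[where C = D] B bdd(1)) auto
      have "\<psi> (x + t *\<^sub>R (z - x)) / t = frechet_derivative \<phi> (at (x + t *\<^sub>R (z - x))) (z - x)" if "0 < t" for t z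
        using that by (simp add: \<psi>_def linear_scale[OF Dl])
      then have "indicator {0<..<1} t * (\<integral>z. indicator B z * (\<psi> (x + t *\<^sub>R (z - x)) / t) \<partial>M) = (\<integral>z. f t z \<partial>M)" for t
        by (cases "0 < t \<and> t < 1") (auto simp: f_def)
      then show ?thesis unfolding 1 by simp
    qed
    \<comment> \<open>After the exchange the inner integral runs along a single segment from
      \<open>x\<close> to \<open>z\<close>, where the fundamental theorem of calculus
      applies.\<close>
    also have "\<dots> = (\<integral>z. (\<integral>t. f t z \<partial>lborel) \<partial>M)"
    proof (rule P.Fubini_integral[symmetric])
      have fm: "case_prod f \<in> borel_measurable (lborel \<Otimes>\<^sub>M M)"
        unfolding f_def test_derivative_expand[OF \<phi>, of _ "_ - x"] by measurable
      have fb: "\<bar>f t z\<bar> \<le> indicator ({0<..<1} \<times> B) (t, z) * (D * r)" for t z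
      proof (cases "(t, z) \<in> {0<..<1} \<times> B")
        case True
        then have "\<bar>f t z\<bar> = \<bar>frechet_derivative \<phi> (at (x + t *\<^sub>R (z - x))) (z - x)\<bar>" by (simp add: f_def)
        also have "\<dots> \<le> D * norm (z - x)" by (rule D(2))
        also have "\<dots> \<le> D * r" using True r D(1) by (intro mult_left_mono) auto
        finally show ?thesis using True by simp
      qed (auto simp: f_def indicator_def)
      have "emeasure (lborel \<Otimes>\<^sub>M M) ({0<..<1::real} \<times> B) = emeasure lborel {0<..<1::real} * emeasure M B"
        by (rule M.emeasure_pair_measure_Times) auto
      then have "emeasure (lborel \<Otimes>\<^sub>M M) ({0<..<1::real} \<times> B) < \<infinity>"
        using M_finite[OF bdd(1) B] by simp
      then have "integrable (lborel \<Otimes>\<^sub>M M) (\<lambda>y. indicator ({0<..<1::real} \<times> B) y * (D * r))"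
        by (intro integrable_mult_left integrable_real_indicator pair_measureI) auto
      then show "integrable (lborel \<Otimes>\<^sub>M M) (case_prod f)"
        by (rule Bochner_Integration.integrable_bound[OF _ fm])
          (auto intro!: AE_I2 order_trans[OF fb abs_ge_self] simp del: abs_mult)
    qed
    also have "(\<lambda>z. \<integral>t. f t z \<partial>lborel) = (\<lambda>z. indicator B z * (\<phi> z - \<phi> x))"
    proof
      fix z show "(\<integral>t. f t z \<partial>lborel) = indicator B z * (\<phi> z - \<phi> x)"
        using segment_FTC[OF \<phi>, of x "z - x"] by (cases "z \<in> B") (auto simp: f_def)
    qed
    also have "(\<integral>z. indicator B z * (\<phi> z - \<phi> x) \<partial>M) = (\<integral>z. indicator B z * \<phi> z \<partial>M) - m * \<phi> x"
    proof -
      have "integrable M (\<lambda>z. indicator B z * \<phi> z)"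
        using integrable_mult_indicator[OF _ test_integrable[OF \<phi>], of B] by simp
      moreover have "integrable M (\<lambda>z. indicator B z * \<phi> x)" using Bfin by simp
      ultimately show ?thesis by (simp add: right_diff_distrib m_def)
    qed
    finally show ?thesis using m by (simp add: m_def[symmetric] field_simps)
  qed
  with gint z0 norm show ?thesis by (intro that[of g]) (auto simp: L1_iff)
qed

text \<open>Two cones with tips \<open>x\<close> and \<open>y\<close> over the same ball at the
  midpoint are subtracted. The averages of \<open>\<phi>\<close> over the ball cancel, and each cone
  has norm at most half the distance plus the radius.\<close>

lemma spindle_field:
  assumes \<Omega>: "convex \<Omega>" "open \<Omega>" "x \<in> \<Omega>" "y \<in> \<Omega>" and \<epsilon>: "\<epsilon> > 0"
  obtains g where "g \<in> L1 b \<Omega>" "(\<integral>w. norm (g w) \<partial>lam) \<le> norm (x - y) + \<epsilon>"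
    "\<And>\<phi>. \<phi> \<in> test_functions \<Longrightarrow> pair g \<phi> = \<phi> y - \<phi> x"
proof -
  define m where "m = (1/2) *\<^sub>R x + (1/2) *\<^sub>R y"
  have "m \<in> \<Omega>" unfolding m_def by (rule convexD[OF \<Omega>(1,3,4)]) auto
  then obtain s where s: "s > 0" "ball m s \<subseteq> \<Omega>" using \<Omega>(2) openE by blast
  \<comment> \<open>Both cones lose at most \<open>r\<close> in length, hence the bound
    \<open>\<epsilon> / 2\<close>.\<close>
  define r where "r = min s (\<epsilon> / 2)"
  define B where "B = ball m r"
  have r: "r > 0" "r \<le> \<epsilon> / 2" using s \<epsilon> by (auto simp: r_def)
  have B: "B \<in> sets borel" "bounded B" "B \<subseteq> \<Omega>" "open B" "B \<noteq> {}"
    using s r by (auto simp: B_def r_def)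
  have "measure M B > 0"
    using M_open_pos[OF B(4,5)] M_finite[OF B(2,1)] by (simp add: measure_def enn2real_positive_iff zero_less_iff_neq_zero)
  have d: "norm (z - x) \<le> norm (x - y) / 2 + r" "norm (z - y) \<le> norm (x - y) / 2 + r" if "z \<in> B" for z
  proof -
    have zm: "norm (z - m) < r" using that by (simp add: B_def dist_norm norm_minus_commute)
    have "m - x = (1/2) *\<^sub>R (y - x)" "m - y = (1/2) *\<^sub>R (x - y)"
      by (simp_all add: m_def algebra_simps flip: scaleR_add_left)
    then have "norm (m - x) = norm (x - y) / 2" "norm (m - y) = norm (x - y) / 2"
      by (simp_all add: norm_minus_commute)
    then show "norm (z - x) \<le> norm (x - y) / 2 + r" "norm (z - y) \<le> norm (x - y) / 2 + r"
      using zm norm_triangle_ineq[of "z - m" "m - x"] norm_triangle_ineq[of "z - m" "m - y"] by auto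
  qed
  obtain g where g: "g \<in> L1 b \<Omega>" "(\<integral>w. norm (g w) \<partial>lam) \<le> norm (x - y) / 2 + r"
    "\<And>\<phi>. \<phi> \<in> test_functions \<Longrightarrow> pair g \<phi> = (\<integral>z. indicator B z * \<phi> z \<partial>M) / measure M B - \<phi> x"
    using cone_field[OF \<Omega>(1,3) B(1-3) \<open>measure M B > 0\<close> d(1)] by blast
  obtain h where h: "h \<in> L1 b \<Omega>" "(\<integral>w. norm (h w) \<partial>lam) \<le> norm (x - y) / 2 + r"
    "\<And>\<phi>. \<phi> \<in> test_functions \<Longrightarrow> pair h \<phi> = (\<integral>z. indicator B z * \<phi> z \<partial>M) / measure M B - \<phi> y"
    using cone_field[OF \<Omega>(1,4) B(1-3) \<open>measure M B > 0\<close> d(2)] by blast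
  have i: "integrable lam g" "integrable lam h" using g(1) h(1) by (auto simp: L1_iff)
  show ?thesis
  proof (rule that[of "\<lambda>w. g w - h w"])
    show "(\<lambda>w. g w - h w) \<in> L1 b \<Omega>" using g(1) h(1) by (auto simp: L1_iff intro: integrable_sub)
    have "(\<integral>w. norm (g w - h w) \<partial>lam) \<le> (\<integral>w. norm (g w) + norm (h w) \<partial>lam)"
      by (intro integral_mono integrable_norm_co integrable_sub i Bochner_Integration.integrable_add norm_triangle_ineq4)
    also have "\<dots> = (\<integral>w. norm (g w) \<partial>lam) + (\<integral>w. norm (h w) \<partial>lam)"
      by (intro Bochner_Integration.integral_add integrable_norm_co i)
    finally show "(\<integral>w. norm (g w - h w) \<partial>lam) \<le> norm (x - y) + \<epsilon>" using g(2) h(2) r(2) by simp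
    show "pair (\<lambda>w. g w - h w) \<phi> = \<phi> y - \<phi> x" if "\<phi> \<in> test_functions" for \<phi>
      using that by (simp add: pair_diff[OF i] g(3) h(3))
  qed
qed

end

section \<open>The dual space and the free space\<close>

lemma lip_norm_le: "L-lipschitz_on X f \<Longrightarrow> lip_norm X f \<le> L"
  unfolding lip_norm_def by (rule cInf_lower) (auto intro!: bdd_belowI[of _ 0] lipschitz_on_nonneg)

text \<open>The infimum is attained, since every admissible constant dominates each difference
  quotient. Hence \<open>lip_norm\<close> itself may serve as a Lipschitz constant.\<close>

lemma lip_norm_lipschitz:
  assumes "L-lipschitz_on X f"
  shows "(lip_norm X f)-lipschitz_on X f"
proof (rule lipschitz_onI)
  let ?S = "{L. L-lipschitz_on X f}"
  have ne: "?S \<noteq> {}" using assms by auto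
  show "0 \<le> lip_norm X f" unfolding lip_norm_def
    by (rule cInf_greatest[OF ne]) (auto intro: lipschitz_on_nonneg)
  fix x y assume xy: "x \<in> X" "y \<in> X"
  show "dist (f x) (f y) \<le> lip_norm X f * dist x y"
  proof (cases "dist x y = 0")
    case False
    then have d: "dist x y > 0" by (simp add: less_le)
    have "dist (f x) (f y) / dist x y \<le> lip_norm X f" unfolding lip_norm_def
      by (rule cInf_greatest[OF ne]) (use xy d in \<open>auto simp: divide_le_eq dest: lipschitz_onD\<close>)
    then show ?thesis using d by (simp add: divide_le_eq)
  qed simp
qed

lemma lip_norm_nonneg: "L-lipschitz_on X f \<Longrightarrow> 0 \<le> lip_norm X f"
  using lip_norm_lipschitz lipschitz_on_nonneg by blast

lemma Lip0_lipschitz: "f \<in> Lip0 X p \<Longrightarrow> (lip_norm X f)-lipschitz_on X f"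
  by (auto simp: Lip0_def intro: lip_norm_lipschitz)

lemma Lip0I: "L-lipschitz_on X f \<Longrightarrow> f p = 0 \<Longrightarrow> (\<And>x. x \<notin> X \<Longrightarrow> f x = 0) \<Longrightarrow> f \<in> Lip0 X p"
  by (auto simp: Lip0_def)

lemma Lip0_zero: "(\<lambda>_. 0) \<in> Lip0 X p"
  by (rule Lip0I[OF lipschitz_on_constant]) auto

lemma Lip0_add: "f \<in> Lip0 X p \<Longrightarrow> h \<in> Lip0 X p \<Longrightarrow> (\<lambda>x. f x + h x) \<in> Lip0 X p"
  by (rule Lip0I[OF lipschitz_on_add[OF Lip0_lipschitz Lip0_lipschitz]]) (auto simp: Lip0_def)

lemma Lip0_scale: "f \<in> Lip0 X p \<Longrightarrow> (\<lambda>x. c * f x) \<in> Lip0 X p"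
  by (rule Lip0I[OF lipschitz_on_cmult_real[OF Lip0_lipschitz]]) (auto simp: Lip0_def)

lemma Lip0_dualD:
  assumes "\<psi> \<in> Lip0_dual X p"
  shows "f \<in> Lip0 X p \<Longrightarrow> h \<in> Lip0 X p \<Longrightarrow> \<psi> (\<lambda>x. f x + h x) = \<psi> f + \<psi> h"
    and "f \<in> Lip0 X p \<Longrightarrow> \<psi> (\<lambda>x. c * f x) = c * \<psi> f"
    and "f \<notin> Lip0 X p \<Longrightarrow> \<psi> f = 0"
  using assms by (auto simp: Lip0_dual_def)

lemma Lip0_dual_bounded:
  assumes "\<psi> \<in> Lip0_dual X p"
  obtains C where "C \<ge> 0" "\<And>f. f \<in> Lip0 X p \<Longrightarrow> \<bar>\<psi> f\<bar> \<le> C * lip_norm X f"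
proof -
  have "\<exists>C. \<forall>f\<in>Lip0 X p. \<bar>\<psi> f\<bar> \<le> C * lip_norm X f"
    using assms by (simp add: Lip0_dual_def)
  then obtain C where C: "\<And>f. f \<in> Lip0 X p \<Longrightarrow> \<bar>\<psi> f\<bar> \<le> C * lip_norm X f" by blast
  have "\<bar>\<psi> f\<bar> \<le> \<bar>C\<bar> * lip_norm X f" if "f \<in> Lip0 X p" for f
    using C[OF that] mult_right_mono[OF abs_ge_self lip_norm_nonneg[OF Lip0_lipschitz[OF that]], of C]
    by linarith
  then show ?thesis by (intro that[of "\<bar>C\<bar>"]) auto
qed

lemma Lip0_dualI:
  assumes "\<And>f h. f \<in> Lip0 X p \<Longrightarrow> h \<in> Lip0 X p \<Longrightarrow> \<psi> (\<lambda>x. f x + h x) = \<psi> f + \<psi> h"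
    and "\<And>c f. f \<in> Lip0 X p \<Longrightarrow> \<psi> (\<lambda>x. c * f x) = c * \<psi> f"
    and "\<And>f. f \<in> Lip0 X p \<Longrightarrow> \<bar>\<psi> f\<bar> \<le> C * lip_norm X f"
    and "\<And>f. f \<notin> Lip0 X p \<Longrightarrow> \<psi> f = 0"
  shows "\<psi> \<in> Lip0_dual X p"
  using assms unfolding Lip0_dual_def by blast

lemma Lip0_dual_add:
  assumes u: "u \<in> Lip0_dual X p" and v: "v \<in> Lip0_dual X p"
  shows "(\<lambda>f. u f + v f) \<in> Lip0_dual X p"
proof -
  obtain C D where "\<And>f. f \<in> Lip0 X p \<Longrightarrow> \<bar>u f\<bar> \<le> C * lip_norm X f"
      "\<And>f. f \<in> Lip0 X p \<Longrightarrow> \<bar>v f\<bar> \<le> D * lip_norm X f"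
    using Lip0_dual_bounded[OF u] Lip0_dual_bounded[OF v] by metis
  then have bd: "\<bar>u f + v f\<bar> \<le> (C + D) * lip_norm X f" if "f \<in> Lip0 X p" for f
    using abs_triangle_ineq[of "u f" "v f"] that by (fastforce simp: distrib_right)
  show ?thesis
    by (rule Lip0_dualI[OF _ _ bd]) (simp_all add: Lip0_dualD[OF u] Lip0_dualD[OF v] algebra_simps)
qed

lemma Lip0_dual_scale:
  assumes u: "u \<in> Lip0_dual X p"
  shows "(\<lambda>f. r * u f) \<in> Lip0_dual X p"
proof -
  obtain C where "\<And>f. f \<in> Lip0 X p \<Longrightarrow> \<bar>u f\<bar> \<le> C * lip_norm X f"
    using Lip0_dual_bounded[OF u] by metis
  then have bd: "\<bar>r * u f\<bar> \<le> (\<bar>r\<bar> * C) * lip_norm X f" if "f \<in> Lip0 X p" for f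
    using that by (auto simp: abs_mult mult.assoc intro: mult_left_mono)
  show ?thesis
    by (rule Lip0_dualI[OF _ _ bd]) (simp_all add: Lip0_dualD[OF u] algebra_simps)
qed

lemma Lip0_dual_diff:
  "u \<in> Lip0_dual X p \<Longrightarrow> v \<in> Lip0_dual X p \<Longrightarrow> (\<lambda>f. u f - v f) \<in> Lip0_dual X p"
  using Lip0_dual_add[OF _ Lip0_dual_scale[of v X p "-1"], of u] by simp

lemma Lip0_dual_zero: "(\<lambda>_. 0) \<in> Lip0_dual X p"
  by (rule Lip0_dualI[where C = 0]) auto

lemma dual_norm_le:
  assumes "\<And>f. f \<in> Lip0 X p \<Longrightarrow> 1-lipschitz_on X f \<Longrightarrow> \<bar>\<psi> f\<bar> \<le> C"
  shows "dual_norm X p \<psi> \<le> C"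
  unfolding dual_norm_def
proof (rule cSup_least)
  have "lip_norm X (\<lambda>_. 0 :: real) \<le> 1"
    using lip_norm_le[OF lipschitz_on_constant[of X "0::real"]] by simp
  then show "{\<bar>\<psi> f\<bar> |f. f \<in> Lip0 X p \<and> lip_norm X f \<le> 1} \<noteq> {}" using Lip0_zero by blast
  fix y assume "y \<in> {\<bar>\<psi> f\<bar> |f. f \<in> Lip0 X p \<and> lip_norm X f \<le> 1}"
  then obtain f where "y = \<bar>\<psi> f\<bar>" "f \<in> Lip0 X p" "lip_norm X f \<le> 1" by blast
  then show "y \<le> C" using assms lipschitz_on_mono[OF Lip0_lipschitz] by blast
qed

text \<open>Membership in \<open>Lip0_dual\<close> bounds the set under the supremum; the rest is
  scaling by \<open>1 / L\<close>. For \<open>L = 0\<close> scaling is impossible, but then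
  boundedness already gives the value zero.\<close>

lemma dual_norm_bound:
  assumes \<psi>: "\<psi> \<in> Lip0_dual X p" and f: "f \<in> Lip0 X p" "L-lipschitz_on X f"
  shows "\<bar>\<psi> f\<bar> \<le> dual_norm X p \<psi> * L"
proof -
  obtain C where C: "C \<ge> 0" "\<And>f. f \<in> Lip0 X p \<Longrightarrow> \<bar>\<psi> f\<bar> \<le> C * lip_norm X f"
    using Lip0_dual_bounded[OF \<psi>] by blast
  have unit: "\<bar>\<psi> h\<bar> \<le> dual_norm X p \<psi>" if "h \<in> Lip0 X p" "lip_norm X h \<le> 1" for h
    unfolding dual_norm_def
  proof (rule cSup_upper)
    show "bdd_above {\<bar>\<psi> f\<bar> |f. f \<in> Lip0 X p \<and> lip_norm X f \<le> 1}"
    proof (rule bdd_aboveI[of _ C])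
      fix y assume "y \<in> {\<bar>\<psi> f\<bar> |f. f \<in> Lip0 X p \<and> lip_norm X f \<le> 1}"
      then obtain f where "y = \<bar>\<psi> f\<bar>" "f \<in> Lip0 X p" "lip_norm X f \<le> 1" by blast
      then show "y \<le> C" using C(2)[of f] mult_left_mono[of "lip_norm X f" 1 C] C(1) by simp
    qed
  qed (use that in blast)
  show ?thesis
  proof (cases "L = 0")
    case True
    then have "lip_norm X f = 0"
      using lip_norm_le[OF f(2)] lip_norm_nonneg[OF f(2)] by simp
    then show ?thesis using C(2)[OF f(1)] True by simp
  next
    case False
    then have L: "L > 0" using lipschitz_on_nonneg[OF f(2)] by simp
    have "1-lipschitz_on X (\<lambda>x. (1 / L) * f x)"
      using lipschitz_on_cmult_real[OF f(2), of "1 / L"] L by simp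
    from unit[OF Lip0_scale[OF f(1)] lip_norm_le[OF this]]
    have "\<bar>(1 / L) * \<psi> f\<bar> \<le> dual_norm X p \<psi>" by (simp only: Lip0_dualD(2)[OF \<psi> f(1)])
    then show ?thesis using L by (simp add: abs_mult field_simps)
  qed
qed

lemma dual_norm_triangle:
  assumes "u \<in> Lip0_dual X p" "v \<in> Lip0_dual X p"
  shows "dual_norm X p (\<lambda>f. u f + v f) \<le> dual_norm X p u + dual_norm X p v"
proof (rule dual_norm_le)
  fix f assume f: "f \<in> Lip0 X p" "1-lipschitz_on X f"
  show "\<bar>u f + v f\<bar> \<le> dual_norm X p u + dual_norm X p v"
    using dual_norm_bound[OF assms(1) f] dual_norm_bound[OF assms(2) f] by simp
qed

lemma dual_norm_scale_le:
  assumes "u \<in> Lip0_dual X p"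
  shows "dual_norm X p (\<lambda>f. r * u f) \<le> \<bar>r\<bar> * dual_norm X p u"
proof (rule dual_norm_le)
  fix f assume f: "f \<in> Lip0 X p" "1-lipschitz_on X f"
  show "\<bar>r * u f\<bar> \<le> \<bar>r\<bar> * dual_norm X p u"
    using mult_left_mono[OF dual_norm_bound[OF assms f], of "\<bar>r\<bar>"] by (simp add: abs_mult)
qed

lemma delta_dual:
  assumes "x \<in> X" "p \<in> X"
  shows "delta X p x \<in> Lip0_dual X p"
proof (rule Lip0_dualI)
  fix f assume f: "f \<in> Lip0 X p"
  then have "f p = 0" by (simp add: Lip0_def)
  then show "\<bar>delta X p x f\<bar> \<le> dist x p * lip_norm X f"
    using lipschitz_onD[OF Lip0_lipschitz[OF f] assms] f by (simp add: delta_def dist_real_def mult.commute)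
qed (auto simp: delta_def Lip0_add Lip0_scale)

lemma delta_span_dual:
  assumes "p \<in> X" "\<theta> \<in> delta_span X p"
  shows "\<theta> \<in> Lip0_dual X p"
proof -
  obtain S c where S: "finite S" "S \<subseteq> X" and \<theta>: "\<theta> = (\<lambda>f. \<Sum>x\<in>S. c x * delta X p x f)"
    using assms(2) unfolding delta_span_def by blast
  from S have "(\<lambda>f. \<Sum>x\<in>S. c x * delta X p x f) \<in> Lip0_dual X p"
    by induction (auto intro!: Lip0_dual_zero Lip0_dual_add Lip0_dual_scale delta_dual assms(1))
  then show ?thesis by (simp add: \<theta>)
qed

lemma delta_span_add:
  assumes "u \<in> delta_span X p" "v \<in> delta_span X p"
  shows "(\<lambda>f. u f + v f) \<in> delta_span X p"
proof -
  obtain S c T d where S: "finite S" "S \<subseteq> X" "u = (\<lambda>f. \<Sum>x\<in>S. c x * delta X p x f)"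
    and T: "finite T" "T \<subseteq> X" "v = (\<lambda>f. \<Sum>x\<in>T. d x * delta X p x f)"
    using assms unfolding delta_span_def by blast
  define e where "e x = (if x \<in> S then c x else 0) + (if x \<in> T then d x else 0)" for x
  have "u f + v f = (\<Sum>x\<in>S \<union> T. e x * delta X p x f)" for f
  proof -
    have "(\<Sum>x\<in>S. c x * delta X p x f) = (\<Sum>x\<in>S \<union> T. (if x \<in> S then c x else 0) * delta X p x f)"
      using S(1) T(1) by (intro sum.mono_neutral_cong_left) auto
    moreover have "(\<Sum>x\<in>T. d x * delta X p x f) = (\<Sum>x\<in>S \<union> T. (if x \<in> T then d x else 0) * delta X p x f)"
      using S(1) T(1) by (intro sum.mono_neutral_cong_left) auto
    ultimately show ?thesis by (simp add: S(3) T(3) e_def distrib_right sum.distrib)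
  qed
  then show ?thesis using S T unfolding delta_span_def
    by (intro CollectI exI[of _ "S \<union> T"] exI[of _ e]) auto
qed

lemma delta_span_scale:
  assumes "u \<in> delta_span X p"
  shows "(\<lambda>f. r * u f) \<in> delta_span X p"
proof -
  obtain S c where "finite S" "S \<subseteq> X" "u = (\<lambda>f. \<Sum>x\<in>S. c x * delta X p x f)"
    using assms unfolding delta_span_def by blast
  then show ?thesis unfolding delta_span_def
    by (intro CollectI exI[of _ S] exI[of _ "\<lambda>x. r * c x"]) (auto simp: sum_distrib_left mult.assoc)
qed

lemma delta_in_span: "x \<in> X \<Longrightarrow> delta X p x \<in> delta_span X p"
  unfolding delta_span_def by (intro CollectI exI[of _ "{x}"] exI[of _ "\<lambda>_. 1"]) auto

text \<open>The indexed points may coincide, whereas \<open>delta_span\<close> sums over a set; this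
  suits points taken from a list.\<close>

lemma delta_span_sum:
  "(\<And>j. j \<in> I \<Longrightarrow> z j \<in> X) \<Longrightarrow> finite I \<Longrightarrow> (\<lambda>f. \<Sum>j\<in>I. c j * delta X p (z j) f) \<in> delta_span X p"
proof (induction I rule: infinite_finite_induct)
  case empty
  then show ?case unfolding delta_span_def by (intro CollectI exI[of _ "{}"]) auto
qed (auto intro!: delta_span_add delta_span_scale delta_in_span)

lemma lipschitz_free_dual: "\<psi> \<in> lipschitz_free X p \<Longrightarrow> \<psi> \<in> Lip0_dual X p"
  by (simp add: lipschitz_free_def)

lemma dual_norm_zero: "dual_norm X p (\<lambda>_. 0) \<le> 0"
  by (rule dual_norm_le) simp

lemma delta_span_free:
  assumes "p \<in> X" "\<theta> \<in> delta_span X p"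
  shows "\<theta> \<in> lipschitz_free X p"
  using delta_span_dual[OF assms] assms(2) le_less_trans[OF dual_norm_zero]
  unfolding lipschitz_free_def by (intro CollectI conjI allI impI bexI[of _ \<theta>]) auto

text \<open>The free space is closed in the dual: each approximant is itself within
  \<open>e / 2\<close> of a finite combination of evaluations.\<close>

lemma lipschitz_free_approx:
  assumes p: "p \<in> X" and \<psi>: "\<psi> \<in> Lip0_dual X p"
    and approx: "\<And>e. e > 0 \<Longrightarrow> \<exists>\<theta>\<in>lipschitz_free X p. dual_norm X p (\<lambda>f. \<psi> f - \<theta> f) \<le> e"
  shows "\<psi> \<in> lipschitz_free X p"
  unfolding lipschitz_free_def
proof (intro CollectI conjI allI impI \<psi>)
  fix e :: real assume e: "e > 0"
  obtain \<theta> where \<theta>: "\<theta> \<in> lipschitz_free X p" "dual_norm X p (\<lambda>f. \<psi> f - \<theta> f) \<le> e / 2"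
    using approx[of "e / 2"] e by auto
  obtain \<eta> where \<eta>: "\<eta> \<in> delta_span X p" "dual_norm X p (\<lambda>f. \<theta> f - \<eta> f) < e / 2"
    using \<theta>(1) e unfolding lipschitz_free_def by (auto dest: spec[of _ "e / 2"])
  have "dual_norm X p (\<lambda>f. (\<psi> f - \<theta> f) + (\<theta> f - \<eta> f)) < e"
    using dual_norm_triangle[OF Lip0_dual_diff[OF \<psi> lipschitz_free_dual[OF \<theta>(1)]]
        Lip0_dual_diff[OF lipschitz_free_dual[OF \<theta>(1)] delta_span_dual[OF p \<eta>(1)]]] \<theta>(2) \<eta>(2)
    by linarith
  then show "\<exists>\<theta>\<in>delta_span X p. dual_norm X p (\<lambda>f. \<psi> f - \<theta> f) < e"
    using \<eta>(1) by auto
qed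

lemma lipschitz_free_add:
  assumes p: "p \<in> X" and u: "u \<in> lipschitz_free X p" and v: "v \<in> lipschitz_free X p"
  shows "(\<lambda>f. u f + v f) \<in> lipschitz_free X p"
  unfolding lipschitz_free_def
proof (intro CollectI conjI allI impI Lip0_dual_add u v lipschitz_free_dual)
  fix e :: real assume e: "e > 0"
  have ex: "\<exists>\<theta>\<in>delta_span X p. dual_norm X p (\<lambda>f. w f - \<theta> f) < e / 2" if "w \<in> lipschitz_free X p" for w
    using that half_gt_zero[OF e] unfolding lipschitz_free_def by blast
  obtain \<theta> \<eta> where t: "\<theta> \<in> delta_span X p" "dual_norm X p (\<lambda>f. u f - \<theta> f) < e / 2"
     "\<eta> \<in> delta_span X p" "dual_norm X p (\<lambda>f. v f - \<eta> f) < e / 2"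
    using ex[OF u] ex[OF v] by blast
  have "dual_norm X p (\<lambda>f. (u f - \<theta> f) + (v f - \<eta> f)) < e"
    using dual_norm_triangle[OF Lip0_dual_diff[OF lipschitz_free_dual[OF u] delta_span_dual[OF p t(1)]]
      Lip0_dual_diff[OF lipschitz_free_dual[OF v] delta_span_dual[OF p t(3)]]] t(2,4)
    by linarith
  then show "\<exists>\<theta>\<in>delta_span X p. dual_norm X p (\<lambda>f. u f + v f - \<theta> f) < e"
    by (intro bexI[OF _ delta_span_add[OF t(1,3)]]) (simp add: algebra_simps)
qed

lemma lipschitz_free_scale:
  assumes p: "p \<in> X" and u: "u \<in> lipschitz_free X p"
  shows "(\<lambda>f. r * u f) \<in> lipschitz_free X p"
proof (rule lipschitz_free_approx[OF p Lip0_dual_scale[OF lipschitz_free_dual[OF u]]])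
  fix e :: real assume e: "e > 0"
  then have "e / (\<bar>r\<bar> + 1) > 0" by simp
  then obtain \<theta> where t: "\<theta> \<in> delta_span X p" "dual_norm X p (\<lambda>f. u f - \<theta> f) < e / (\<bar>r\<bar> + 1)"
    using u unfolding lipschitz_free_def by blast
  note ud = Lip0_dual_diff[OF lipschitz_free_dual[OF u] delta_span_dual[OF p t(1)]]
  have "dual_norm X p (\<lambda>f. r * (u f - \<theta> f)) \<le> \<bar>r\<bar> * dual_norm X p (\<lambda>f. u f - \<theta> f)"
    by (rule dual_norm_scale_le[OF ud])
  also have "\<dots> \<le> \<bar>r\<bar> * (e / (\<bar>r\<bar> + 1))" using t(2) by (intro mult_left_mono) auto
  also have "\<dots> \<le> e" using e by (simp add: field_simps)
  finally show "\<exists>\<theta>\<in>lipschitz_free X p. dual_norm X p (\<lambda>f. r * u f - \<theta> f) \<le> e"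
    by (intro bexI[OF _ delta_span_free[OF p delta_span_scale[OF t(1), of r]]]) (simp add: right_diff_distrib)
qed

lemma lipschitz_free_diff:
  "p \<in> X \<Longrightarrow> u \<in> lipschitz_free X p \<Longrightarrow> v \<in> lipschitz_free X p \<Longrightarrow> (\<lambda>f. u f - v f) \<in> lipschitz_free X p"
  using lipschitz_free_add[OF _ _ lipschitz_free_scale[of p X v "-1"], of u] by simp

section \<open>Fields representing functionals on Lipschitz functions\<close>

locale convex_domain = coordinates b
  for b :: "'n::finite \<Rightarrow> 'e::{real_normed_vector, second_countable_topology}" +
  fixes \<Omega> :: "'e set" and p :: 'e
  assumes open_\<Omega>: "open \<Omega>" and convex_\<Omega>: "convex \<Omega>" and p: "p \<in> \<Omega>"
begin

abbreviation "F \<equiv> lipschitz_free \<Omega> p"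

text \<open>A test function need not vanish at the base point or off \<Omega>, so it is shifted by a
  constant and cut off to become an element of \<open>Lip0\<close>. The jump at the boundary is
  harmless, as the Lipschitz condition concerns \<Omega> only.\<close>

definition res :: "('e \<Rightarrow> real) \<Rightarrow> 'e \<Rightarrow> real" where
  "res \<phi> x = (if x \<in> \<Omega> then \<phi> x - \<phi> p else 0)"

text \<open>The graph of the future isometry before passing to the quotient. It constrains
  \<open>\<psi>\<close> on test functions alone, which for \<open>\<psi>\<close> in the free space
  is enough to determine it.\<close>

definition matches :: "('e \<Rightarrow> 'e) \<Rightarrow> (('e \<Rightarrow> real) \<Rightarrow> real) \<Rightarrow> bool" where
  "matches g \<psi> \<longleftrightarrow> (\<forall>\<phi>\<in>test_functions. pair g \<phi> = \<psi> (res \<phi>))"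

lemma matchesD: "matches g \<psi> \<Longrightarrow> \<phi> \<in> test_functions \<Longrightarrow> pair g \<phi> = \<psi> (res \<phi>)"
  by (simp add: matches_def)

lemma res_lipschitz: "L-lipschitz_on UNIV \<phi> \<Longrightarrow> L-lipschitz_on \<Omega> (res \<phi>)"
  by (rule lipschitz_onI) (auto simp: res_def dist_real_def intro: lipschitz_on_nonneg dest: lipschitz_onD)

lemma res_Lip0: "L-lipschitz_on UNIV \<phi> \<Longrightarrow> res \<phi> \<in> Lip0 \<Omega> p"
  by (rule Lip0I[OF res_lipschitz]) (auto simp: res_def)

text \<open>Clear for finite combinations of evaluations. A general member of the free space differs
  from such a combination by little on all \<open>L\<close>-Lipschitz functions at once, so the
  convergence carries over.\<close>

lemma free_approx:
  assumes \<psi>: "\<psi> \<in> F" and f: "f \<in> Lip0 \<Omega> p" "L-lipschitz_on \<Omega> f"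
    and \<phi>: "\<And>n. L-lipschitz_on UNIV (\<phi> n)" "\<And>x. x \<in> \<Omega> \<Longrightarrow> (\<lambda>n. \<phi> n x) \<longlonglongrightarrow> f x"
  shows "(\<lambda>n. \<psi> (res (\<phi> n))) \<longlonglongrightarrow> \<psi> f"
proof (rule LIMSEQ_I)
  fix r :: real assume r: "r > 0"
  have L: "L \<ge> 0" using lipschitz_on_nonneg[OF f(2)] .
  \<comment> \<open>One third of \<open>r\<close> for each of the three differences;
    \<open>L + 1\<close> instead of \<open>L\<close> covers \<open>L = 0\<close>.\<close>
  define e where "e = r / (3 * (L + 1))"
  have e: "e > 0" "e * L < r / 3" using r L by (auto simp: e_def field_simps)
  obtain \<theta> where \<theta>: "\<theta> \<in> delta_span \<Omega> p" "dual_norm \<Omega> p (\<lambda>f. \<psi> f - \<theta> f) < e"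
    using \<psi> e(1) unfolding lipschitz_free_def by blast
  obtain S c where S: "finite S" "S \<subseteq> \<Omega>" "\<theta> = (\<lambda>f. \<Sum>x\<in>S. c x * delta \<Omega> p x f)"
    using \<theta>(1) unfolding delta_span_def by blast
  have near: "\<bar>\<psi> h - \<theta> h\<bar> < r / 3" if "h \<in> Lip0 \<Omega> p" "L-lipschitz_on \<Omega> h" for h
  proof -
    have "\<bar>\<psi> h - \<theta> h\<bar> \<le> dual_norm \<Omega> p (\<lambda>f. \<psi> f - \<theta> f) * L"
      by (rule dual_norm_bound[OF Lip0_dual_diff[OF lipschitz_free_dual[OF \<psi>] delta_span_dual[OF p \<theta>(1)]] that])
    also have "\<dots> \<le> e * L" using \<theta>(2) L by (intro mult_right_mono) auto
    finally show ?thesis using e(2) by simp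
  qed
  have "(\<lambda>n. \<theta> (res (\<phi> n))) \<longlonglongrightarrow> \<theta> f"
  proof -
    have "f p = 0" using f(1) by (simp add: Lip0_def)
    then have "(\<lambda>n. \<phi> n x - \<phi> n p) \<longlonglongrightarrow> f x" if "x \<in> S" for x
      using tendsto_diff[OF \<phi>(2)[of x] \<phi>(2)[OF p]] S(2) that by auto
    then have "(\<lambda>n. \<Sum>x\<in>S. c x * (\<phi> n x - \<phi> n p)) \<longlonglongrightarrow> (\<Sum>x\<in>S. c x * f x)"
      by (intro tendsto_sum tendsto_mult tendsto_const)
    moreover have "\<theta> (res (\<phi> n)) = (\<Sum>x\<in>S. c x * (\<phi> n x - \<phi> n p))" for n
      unfolding S(3) using S(2) by (intro sum.cong) (auto simp: delta_def res_Lip0[OF \<phi>(1)] res_def)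
    ultimately show ?thesis using f(1) by (simp add: S(3) delta_def)
  qed
  from LIMSEQ_D[OF this, of "r / 3"] r obtain N where
    N: "\<And>n. n \<ge> N \<Longrightarrow> \<bar>\<theta> (res (\<phi> n)) - \<theta> f\<bar> < r / 3" by auto
  have "\<bar>\<psi> (res (\<phi> n)) - \<psi> f\<bar> < r" if "n \<ge> N" for n
    using N[OF that] near[OF f] near[OF res_Lip0[OF \<phi>(1)] res_lipschitz[OF \<phi>(1)], of n] by linarith
  then show "\<exists>N. \<forall>n\<ge>N. norm (\<psi> (res (\<phi> n)) - \<psi> f) < r" by auto
qed

text \<open>For test functions this is the bound on the pairing; the approximating test functions
  keep the constant \<open>L\<close>, so the bound survives in the limit for every Lipschitz
  \<open>f\<close>. Applied to a difference and the zero field, it yields uniqueness.\<close>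

lemma matches_bound:
  assumes \<psi>: "\<psi> \<in> F" and g: "integrable lam g" "matches g \<psi>" and f: "f \<in> Lip0 \<Omega> p" "L-lipschitz_on \<Omega> f"
  shows "\<bar>\<psi> f\<bar> \<le> L * (\<integral>x. norm (g x) \<partial>lam)"
proof -
  have "f p = 0" using f(1) by (simp add: Lip0_def)
  then obtain \<phi> :: "nat \<Rightarrow> 'e \<Rightarrow> real" where \<phi>: "\<And>n. \<phi> n \<in> test_functions"
    "\<And>n. L-lipschitz_on UNIV (\<phi> n)" "\<And>x. x \<in> \<Omega> \<Longrightarrow> (\<lambda>n. \<phi> n x) \<longlonglongrightarrow> f x"
    using lipschitz_test_approximation[OF f(2) p] by blast
  have "(\<lambda>n. \<bar>\<psi> (res (\<phi> n))\<bar>) \<longlonglongrightarrow> \<bar>\<psi> f\<bar>"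
    by (intro tendsto_rabs free_approx[OF \<psi> f \<phi>(2,3)])
  moreover have "\<bar>\<psi> (res (\<phi> n))\<bar> \<le> L * (\<integral>x. norm (g x) \<partial>lam)" for n
    using pair_bound[OF g(1) \<phi>(1,2)] matchesD[OF g(2) \<phi>(1)] by simp
  ultimately show ?thesis by (intro LIMSEQ_le_const2) auto
qed

lemma matches_norm:
  assumes "\<psi> \<in> F" "integrable lam g" "matches g \<psi>"
  shows "dual_norm \<Omega> p \<psi> \<le> (\<integral>x. norm (g x) \<partial>lam)"
  by (rule dual_norm_le) (use matches_bound[OF assms, of _ 1] in simp)

lemma matches_add:
  "integrable lam g \<Longrightarrow> integrable lam h \<Longrightarrow> matches g u \<Longrightarrow> matches h v
    \<Longrightarrow> matches (\<lambda>x. g x + h x) (\<lambda>f. u f + v f)"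
  by (simp add: matches_def pair_add)

lemma matches_diff:
  "integrable lam g \<Longrightarrow> integrable lam h \<Longrightarrow> matches g u \<Longrightarrow> matches h v
    \<Longrightarrow> matches (\<lambda>x. g x - h x) (\<lambda>f. u f - v f)"
  by (simp add: matches_def pair_diff)

lemma matches_scale: "matches g u \<Longrightarrow> matches (\<lambda>x. r *\<^sub>R g x) (\<lambda>f. r * u f)"
  by (simp add: matches_def pair_scale)

lemma matches_unique:
  assumes "u \<in> F" "v \<in> F" "integrable lam g" "matches g u" "matches g v"
  shows "u = v"
proof
  fix f
  have "matches (\<lambda>x. 0) (\<lambda>f. u f - v f)"
    using matches_diff[OF assms(3,3-5)] by simp
  note b = matches_bound[OF lipschitz_free_diff[OF p assms(1,2)] _ this]
  show "u f = v f"
  proof (cases "f \<in> Lip0 \<Omega> p")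
    case True
    then show ?thesis using b[OF _ True Lip0_lipschitz[OF True]] by simp
  next
    case False
    then show ?thesis using Lip0_dualD(3)[OF lipschitz_free_dual] assms(1,2) by metis
  qed
qed

lemma delta_res: "a \<in> \<Omega> \<Longrightarrow> \<phi> \<in> test_functions \<Longrightarrow> delta \<Omega> p a (res \<phi>) = \<phi> a - \<phi> p"
  using test_lipschitz[of \<phi>] res_Lip0[of _ \<phi>] by (auto simp: delta_def res_def)

lemma L1_add: "g \<in> L1 b \<Omega> \<Longrightarrow> h \<in> L1 b \<Omega> \<Longrightarrow> (\<lambda>x. g x + h x) \<in> L1 b \<Omega>"
  by (simp add: L1_iff)

lemma L1_scale: "g \<in> L1 b \<Omega> \<Longrightarrow> (\<lambda>x. r *\<^sub>R g x) \<in> L1 b \<Omega>"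
  by (simp add: L1_iff)

lemma L1_zero: "(\<lambda>_. 0) \<in> L1 b \<Omega>"
  by (simp add: L1_iff)

lemma L1_integrable: "g \<in> L1 b \<Omega> \<Longrightarrow> integrable lam g"
  by (simp add: L1_iff)

text \<open>A superposition of spindles from \<open>p\<close> to the points of \<open>S\<close>, far
  from optimal in norm. Its purpose is that the infimum defining the transport cost is taken over a
  nonempty set.\<close>

lemma flow_exists:
  assumes "finite S" "S \<subseteq> \<Omega>"
  shows "\<exists>g\<in>L1 b \<Omega>. \<forall>\<phi>\<in>test_functions. pair g \<phi> = (\<Sum>x\<in>S. u x * (\<phi> x - \<phi> p))"
  using assms
proof induction
  case empty
  have "pair (\<lambda>_. 0) \<phi> = 0" if "\<phi> \<in> test_functions" for \<phi>
    using pair_scale[OF that, of 0 "\<lambda>_. 0"] by simp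
  then show ?case using L1_zero by (intro bexI[of _ "\<lambda>_. 0"]) auto
next
  case (insert x S)
  then obtain g where g: "g \<in> L1 b \<Omega>"
    "\<And>\<phi>. \<phi> \<in> test_functions \<Longrightarrow> pair g \<phi> = (\<Sum>x\<in>S. u x * (\<phi> x - \<phi> p))" by auto
  obtain h where h: "h \<in> L1 b \<Omega>" "\<And>\<phi>. \<phi> \<in> test_functions \<Longrightarrow> pair h \<phi> = \<phi> x - \<phi> p"
    using spindle_field[OF convex_\<Omega> open_\<Omega> p, of x 1] insert.prems by (metis insert_subset zero_less_one)
  show ?case
    using insert.hyps g h
    by (intro bexI[of _ "\<lambda>w. u x *\<^sub>R h w + g w"])
      (auto simp: pair_add pair_scale L1_integrable intro!: L1_add L1_scale)
qed

text \<open>\<open>N u\<close> is the least norm of a field that represents the weights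
  \<open>u\<close>. A linear functional dominated by \<open>N\<close> with value \<open>N c\<close>
  at \<open>c\<close> is a function \<open>f\<close> on \<open>S\<close>, 1-Lipschitz because
  spindles bound the cost between two points. Extended to the whole space, \<open>f\<close> tests
  \<open>\<theta>\<close> and shows \<open>N c \<le> dual_norm \<Omega> p \<theta>\<close>. The
  infimum need not be attained, which accounts for \<open>\<epsilon>\<close>.\<close>

lemma delta_span_lift:
  assumes \<theta>: "\<theta> \<in> delta_span \<Omega> p" and \<epsilon>: "\<epsilon> > 0"
  obtains g where "g \<in> L1 b \<Omega>" "matches g \<theta>" "(\<integral>x. norm (g x) \<partial>lam) \<le> dual_norm \<Omega> p \<theta> + \<epsilon>"
proof -
  obtain S0 c0 where S0: "finite S0" "S0 \<subseteq> \<Omega>" "\<theta> = (\<lambda>f. \<Sum>x\<in>S0. c0 x * delta \<Omega> p x f)"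
    using \<theta> unfolding delta_span_def by blast
  define S where "S = insert p S0"
  have S: "finite S" "S \<subseteq> \<Omega>" "p \<in> S" using S0 p by (auto simp: S_def)
  \<comment> \<open>The coefficient at \<open>p\<close> does not affect functions vanishing there,
    so it is chosen to make the total zero. This permits subtracting the constant \<open>f p\<close>
    later.\<close>
  define c where "c x = (if x = p then - (\<Sum>x\<in>S0 - {p}. c0 x) else if x \<in> S0 then c0 x else 0)" for x
  have Sp: "S = insert p (S0 - {p})" by (auto simp: S_def)
  have c0: "c x = 0" if "x \<notin> S" for x using that by (auto simp: c_def S_def)
  have csum: "(\<Sum>x\<in>S. c x) = 0"
  proof -
    have "(\<Sum>x\<in>S0 - {p}. c x) = (\<Sum>x\<in>S0 - {p}. c0 x)" by (intro sum.cong) (auto simp: c_def)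
    moreover have "(\<Sum>x\<in>S. c x) = c p + (\<Sum>x\<in>S0 - {p}. c x)"
      unfolding Sp using S0(1) by (intro sum.insert) auto
    ultimately show ?thesis by (simp add: c_def)
  qed
  have cS: "(\<Sum>x\<in>S. c x * k x) = (\<Sum>x\<in>S0. c0 x * k x)" if "k p = 0" for k :: "'e \<Rightarrow> real"
  proof -
    have "(\<Sum>x\<in>S. c x * k x) = c p * k p + (\<Sum>x\<in>S0 - {p}. c x * k x)"
      unfolding Sp using S0(1) by (intro sum.insert) auto
    also have "\<dots> = (\<Sum>x\<in>S0 - {p}. c x * k x)" using that by simp
    also have "\<dots> = (\<Sum>x\<in>S0 - {p}. c0 x * k x)" by (intro sum.cong) (auto simp: c_def)
    also have "\<dots> = (\<Sum>x\<in>S0. c0 x * k x)"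
      by (rule sum.mono_neutral_left) (use S0(1) that in auto)
    finally show ?thesis .
  qed
  define A where "A u = {g \<in> L1 b \<Omega>. \<forall>\<phi>\<in>test_functions. pair g \<phi> = (\<Sum>x\<in>S. u x * (\<phi> x - \<phi> p))}" for u
  define nrm where "nrm g = (\<integral>x. norm (g x) \<partial>lam)" for g :: "'e \<Rightarrow> 'e"
  define N where "N u = (INF g\<in>A u. nrm g)" for u
  have Ane: "A u \<noteq> {}" for u using flow_exists[OF S(1,2), of u] by (auto simp: A_def)
  have nn: "nrm g \<ge> 0" for g by (simp add: nrm_def)
  have bdd: "bdd_below (nrm ` X)" for X using nn by (intro bdd_belowI2) auto
  have lower: "N u \<le> nrm g" if "g \<in> A u" for u g
    unfolding N_def using that by (intro cINF_lower bdd) auto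
  have nrm_add: "nrm (\<lambda>x. g x + h x) \<le> nrm g + nrm h" if "g \<in> L1 b \<Omega>" "h \<in> L1 b \<Omega>" for g h
  proof -
    have "nrm (\<lambda>x. g x + h x) \<le> (\<integral>x. norm (g x) + norm (h x) \<partial>lam)" unfolding nrm_def
      by (intro integral_mono norm_triangle_ineq integrable_norm_co Bochner_Integration.integrable_add L1_integrable that)
    also have "\<dots> = nrm g + nrm h" unfolding nrm_def
      by (intro Bochner_Integration.integral_add integrable_norm_co L1_integrable that)
    finally show ?thesis .
  qed
  have "sublinear N"
    unfolding sublinear_def
  proof (intro conjI allI impI)
    fix u v
    have 1: "N (\<lambda>x. u x + v x) \<le> nrm g + nrm h" if g: "g \<in> A u" and h: "h \<in> A v" for g h
    proof -
      have "(\<lambda>x. g x + h x) \<in> A (\<lambda>x. u x + v x)"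
        using g h by (auto simp: A_def L1_add pair_add L1_integrable sum.distrib distrib_right)
      from lower[OF this] nrm_add[of g h] g h show ?thesis by (simp add: A_def)
    qed
    have "N (\<lambda>x. u x + v x) - nrm h \<le> N u" if h: "h \<in> A v" for h
      unfolding N_def[of u] using 1[OF _ h] by (intro cINF_greatest Ane) (simp add: algebra_simps)
    then have "N (\<lambda>x. u x + v x) - N u \<le> N v"
      unfolding N_def[of v] by (intro cINF_greatest Ane) (simp add: algebra_simps)
    then show "N (\<lambda>x. u x + v x) \<le> N u + N v" by simp
  next
    have le: "N (\<lambda>x. t * u x) \<le> t * N u" if t: "t > 0" for t u
    proof -
      have "N (\<lambda>x. t * u x) / t \<le> N u" unfolding N_def[of u]
      proof (intro cINF_greatest Ane)
        fix g assume g: "g \<in> A u"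
        then have "(\<lambda>x. t *\<^sub>R g x) \<in> A (\<lambda>x. t * u x)"
          by (auto simp: A_def L1_scale pair_scale sum_distrib_left mult.assoc)
        from lower[OF this] have "N (\<lambda>x. t * u x) \<le> t * nrm g" using t by (simp add: nrm_def)
        then show "N (\<lambda>x. t * u x) / t \<le> nrm g" using t by (simp add: field_simps)
      qed
      then show ?thesis using t by (simp add: field_simps)
    qed
    fix t :: real and u assume t: "t > 0"
    show "N (\<lambda>x. t * u x) = t * N u"
      using le[OF t, of u] le[of "1 / t" "\<lambda>x. t * u x"] t by (simp add: field_simps)
  next
    have "(\<lambda>_. 0) \<in> A (\<lambda>_. 0)" using pair_scale[of _ 0 "\<lambda>_. 0"] by (simp add: A_def L1_zero)
    from lower[OF this] have "N (\<lambda>_. 0) \<le> 0" by (simp add: nrm_def)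
    moreover have "0 \<le> N (\<lambda>_. 0)" unfolding N_def by (intro cINF_greatest Ane nn)
    ultimately show "N (\<lambda>_. 0) = 0" by simp
  qed
  then obtain f where f: "(\<Sum>x\<in>S. c x * f x) = N c"
    "\<And>x y. x \<in> S \<Longrightarrow> y \<in> S \<Longrightarrow> f x - f y \<le> N (\<lambda>z. of_bool (z = x) - of_bool (z = y))"
    using sublinear_dominated_functional[of N S c] S(1) c0 by blast
  have fle: "f x - f y \<le> norm (x - y)" if xy: "x \<in> S" "y \<in> S" for x y
  proof (rule field_le_epsilon)
    fix e :: real assume "e > 0"
    then obtain g where g: "g \<in> L1 b \<Omega>" "nrm g \<le> norm (y - x) + e"
        "\<And>\<phi>. \<phi> \<in> test_functions \<Longrightarrow> pair g \<phi> = \<phi> x - \<phi> y"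
      using spindle_field[OF convex_\<Omega> open_\<Omega>, of y x e] S(2) xy unfolding nrm_def by blast
    have "(\<Sum>z\<in>S. (of_bool (z = x) - of_bool (z = y)) * (\<phi> z - \<phi> p)) = \<phi> x - \<phi> y" for \<phi> :: "'e \<Rightarrow> real"
      using S(1) xy by (simp add: left_diff_distrib sum_subtractf of_bool_def if_distrib[of "\<lambda>u. u * _"] cong: if_cong)
    then have "g \<in> A (\<lambda>z. of_bool (z = x) - of_bool (z = y))" using g by (simp add: A_def)
    from lower[OF this] f(2)[OF xy] g(2) show "f x - f y \<le> norm (x - y) + e"
      by (simp add: norm_minus_commute)
  qed
  have "1-lipschitz_on S f"
  proof (rule lipschitz_onI)
    fix x y assume "x \<in> S" "y \<in> S"
    then show "dist (f x) (f y) \<le> 1 * dist x y"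
      using fle[of x y] fle[of y x] by (simp add: dist_real_def dist_norm norm_minus_commute abs_le_iff)
  qed simp
  then obtain h where h: "1-lipschitz_on UNIV h" "\<And>x. x \<in> S \<Longrightarrow> h x = f x"
    using lipschitz_on_extension_real by blast
  have "N c = (\<Sum>x\<in>S. c x * (f x - f p))"
    using f(1) csum by (simp add: right_diff_distrib sum_subtractf flip: sum_distrib_right)
  also have "\<dots> = (\<Sum>x\<in>S. c x * res h x)"
    using S(2,3) h(2) by (intro sum.cong) (auto simp: res_def)
  also have "\<dots> = \<theta> (res h)"
    using cS[of "res h"] p by (simp add: S0(3) delta_def res_Lip0[OF h(1)] res_def)
  also have "\<dots> \<le> dual_norm \<Omega> p \<theta>"
    using dual_norm_bound[OF delta_span_dual[OF p \<theta>] res_Lip0[OF h(1)] res_lipschitz[OF h(1)]] by simp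
  finally have "N c < dual_norm \<Omega> p \<theta> + \<epsilon>" using \<epsilon> by simp
  then obtain g where g: "g \<in> A c" "nrm g < dual_norm \<Omega> p \<theta> + \<epsilon>"
    unfolding N_def using cInf_lessD[of "nrm ` A c"] Ane by auto
  show ?thesis
  proof (rule that[of g])
    show "matches g \<theta>"
      unfolding matches_def
    proof
      fix \<phi> :: "'e \<Rightarrow> real" assume \<phi>: "\<phi> \<in> test_functions"
      have "pair g \<phi> = (\<Sum>x\<in>S. c x * (\<phi> x - \<phi> p))" using g(1) \<phi> by (simp add: A_def)
      also have "\<dots> = (\<Sum>x\<in>S0. c0 x * (\<phi> x - \<phi> p))" by (rule cS) simp
      also have "\<dots> = \<theta> (res \<phi>)"
        unfolding S0(3) using S0(2) by (intro sum.cong) (auto simp: delta_res[OF _ \<phi>])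
      finally show "pair g \<phi> = \<theta> (res \<phi>)" .
    qed
  qed (use g in \<open>auto simp: A_def nrm_def\<close>)
qed

end

section \<open>Representing fields and densities\<close>

context convex_domain
begin

text \<open>Completeness of \<open>L1\<close> for absolutely convergent series, with control of the
  norm and of all pairings. The sum is formed coordinatewise, and both the norm estimate and the
  pairings pass through its partial sums.\<close>

lemma L1_series:
  assumes g: "\<And>k::nat. g k \<in> L1 b \<Omega>" and sum: "summable (\<lambda>k. \<integral>x. norm (g k x) \<partial>lam)"
  obtains h where "h \<in> L1 b \<Omega>" "(\<integral>x. norm (h x) \<partial>lam) \<le> (\<Sum>k. \<integral>x. norm (g k x) \<partial>lam)"
    "\<And>\<phi>. \<phi> \<in> test_functions \<Longrightarrow> (\<lambda>k. pair (g k) \<phi>) sums pair h \<phi>"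
proof -
  note gi = L1_integrable[OF g]
  note ni = integrable_norm_co[OF gi]
  obtain C where C: "C \<ge> 0" "\<And>i x. \<bar>co i x\<bar> \<le> C * norm x" using co_bound by blast
  have ae: "AE x in lam. summable (\<lambda>k. norm (g k x))"
  proof -
    have [measurable]: "(\<lambda>x. norm (g k x)) \<in> borel_measurable lam" for k
      using ni by (rule borel_measurable_integrable)
    have "(\<integral>\<^sup>+x. (\<Sum>k. ennreal (norm (g k x))) \<partial>lam) = (\<Sum>k. \<integral>\<^sup>+x. ennreal (norm (g k x)) \<partial>lam)"
      by (rule nn_integral_suminf) measurable
    also have "\<dots> = (\<Sum>k. ennreal (\<integral>x. norm (g k x) \<partial>lam))"
      by (intro suminf_cong nn_integral_eq_integral ni) auto
    also have "\<dots> = ennreal (\<Sum>k. \<integral>x. norm (g k x) \<partial>lam)"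
      by (rule suminf_ennreal2[OF _ sum]) simp
    finally have "(\<integral>\<^sup>+x. (\<Sum>k. ennreal (norm (g k x))) \<partial>lam) \<noteq> \<infinity>" by simp
    then have "AE x in lam. (\<Sum>k. ennreal (norm (g k x))) \<noteq> \<infinity>"
      by (intro nn_integral_noteq_infinite) measurable
    then show ?thesis
      by eventually_elim (auto intro: summable_suminf_not_top)
  qed
  \<comment> \<open>At points of the null set where the series of norms diverges the value does not
    matter; off \<Omega> all terms are zero, so \<open>h\<close> vanishes there everywhere and not
    merely almost everywhere.\<close>
  define h where "h x = (\<Sum>i\<in>UNIV. (\<Sum>k. co i (g k x)) *\<^sub>R b i)" for x
  have coh: "co i (h x) = (\<Sum>k. co i (g k x))" for i x
    by (simp add: h_def linear_sum[OF co_linear] linear_scale[OF co_linear] co_b of_bool_def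
        if_distrib[of "\<lambda>u. _ * u"] cong: if_cong)
  have ci: "integrable lam (\<lambda>x. co i (g k x))" for i k using gi integrable_iff_co by blast
  have csum: "summable (\<lambda>k. norm (co i (g k x)))" if "summable (\<lambda>k. norm (g k x))" for i x
    using C(2) by (intro summable_comparison_test'[OF summable_mult[OF that, of C]]) auto
  have cint: "integrable lam (\<lambda>x. \<Sum>k. co i (g k x))" for i
  proof (rule integrable_suminf[OF ci])
    show "AE x in lam. summable (\<lambda>k. norm (co i (g k x)))" using ae by eventually_elim (rule csum)
    show "summable (\<lambda>k. \<integral>x. norm (co i (g k x)) \<partial>lam)"
    proof (rule summable_comparison_test'[OF summable_mult[OF sum, of C]])
      fix k :: nat
      have "(\<integral>x. norm (co i (g k x)) \<partial>lam) \<le> (\<integral>x. C * norm (g k x) \<partial>lam)"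
        using C(2) by (intro integral_mono integrable_norm ci integrable_mult_right ni) auto
      then show "norm (\<integral>x. norm (co i (g k x)) \<partial>lam) \<le> C * (\<integral>x. norm (g k x) \<partial>lam)"
        by simp
    qed
  qed
  have hi: "integrable lam h" unfolding integrable_iff_co coh using cint by blast
  have hL: "h \<in> L1 b \<Omega>"
  proof -
    have "h x = 0" if "x \<notin> \<Omega>" for x
    proof -
      have "g k x = 0" for k using g that by (simp add: L1_iff)
      then show ?thesis by (simp add: h_def linear_0[OF co_linear])
    qed
    with hi show ?thesis by (simp add: L1_iff)
  qed
  have hsums: "(\<lambda>n. \<Sum>k<n. g k x) \<longlonglongrightarrow> h x" if "summable (\<lambda>k. norm (g k x))" for x
  proof -
    have "(\<lambda>n. \<Sum>i\<in>UNIV. (\<Sum>k<n. co i (g k x)) *\<^sub>R b i) \<longlonglongrightarrow> h x"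
      unfolding h_def
      by (rule tendsto_sum)
        (rule tendsto_scaleR[OF summable_LIMSEQ[OF summable_norm_cancel[OF csum[OF that]]] tendsto_const])
    moreover have "(\<Sum>i\<in>UNIV. (\<Sum>k<n. co i (g k x)) *\<^sub>R b i) = (\<Sum>k<n. g k x)" for n
      using co_sum[of "\<Sum>k<n. g k x"] by (simp add: linear_sum[OF co_linear])
    ultimately show ?thesis by simp
  qed
  have hn: "norm (h x) \<le> (\<Sum>k. norm (g k x))" if s: "summable (\<lambda>k. norm (g k x))" for x
  proof (rule LIMSEQ_le_const2[OF tendsto_norm[OF hsums[OF s]]])
    have "norm (\<Sum>k<n. g k x) \<le> (\<Sum>k. norm (g k x))" for n
      by (rule order_trans[OF norm_sum sum_le_suminf[OF s]]) auto
    then show "\<exists>N. \<forall>n\<ge>N. norm (\<Sum>k<n. g k x) \<le> (\<Sum>k. norm (g k x))" by blast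
  qed
  have ae': "AE x in lam. summable (\<lambda>k. norm (norm (g k x)))" using ae by simp
  have sum': "summable (\<lambda>k. \<integral>x. norm (norm (g k x)) \<partial>lam)" using sum by simp
  have "(\<integral>x. norm (h x) \<partial>lam) \<le> (\<integral>x. (\<Sum>k. norm (g k x)) \<partial>lam)"
  proof (rule integral_mono_AE[OF integrable_norm_co[OF hi] integrable_suminf[OF ni ae' sum']])
    show "AE x in lam. norm (h x) \<le> (\<Sum>k. norm (g k x))" using ae by eventually_elim (rule hn)
  qed
  also have "\<dots> = (\<Sum>k. \<integral>x. norm (g k x) \<partial>lam)" by (rule integral_suminf[OF ni ae' sum'])
  finally have nle: "(\<integral>x. norm (h x) \<partial>lam) \<le> (\<Sum>k. \<integral>x. norm (g k x) \<partial>lam)" .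
  have "(\<lambda>k. pair (g k) \<phi>) sums pair h \<phi>" if \<phi>: "\<phi> \<in> test_functions" for \<phi>
  proof -
    define D where "D x v = frechet_derivative \<phi> (at x) v" for x v
    note Dl = test_derivative_linear[OF \<phi>, folded D_def]
    have Dbl: "bounded_linear (D x)" for x
      unfolding D_def using test_differentiable[OF \<phi>] has_derivative_bounded_linear by (metis (no_types))
    obtain B where B: "B \<ge> 0" "\<And>x v. \<bar>D x v\<bar> \<le> B * norm v"
      using test_derivative_bounded[OF \<phi>] unfolding D_def by blast
    have Di: "integrable lam (\<lambda>x. D x (g k x))" for k unfolding D_def by (rule pair_integrable[OF gi \<phi>])
    have ds: "(\<lambda>k. D x (g k x)) sums D x (h x)" if "summable (\<lambda>k. norm (g k x))" for x
      unfolding sums_def using bounded_linear.tendsto[OF Dbl hsums[OF that], of x]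
      by (simp add: linear_sum[OF bounded_linear.linear[OF Dbl]])
    have aeD: "AE x in lam. summable (\<lambda>k. norm (D x (g k x)))"
      using ae
    proof eventually_elim
      case (elim x)
      then show ?case using B(2) by (intro summable_comparison_test'[OF summable_mult[OF elim, of B]]) auto
    qed
    have sumD: "summable (\<lambda>k. \<integral>x. norm (D x (g k x)) \<partial>lam)"
    proof (rule summable_comparison_test'[OF summable_mult[OF sum, of B]])
      fix k :: nat
      have "(\<integral>x. norm (D x (g k x)) \<partial>lam) \<le> (\<integral>x. B * norm (g k x) \<partial>lam)"
        using B(2) by (intro integral_mono integrable_norm Di integrable_mult_right ni) auto
      then show "norm (\<integral>x. norm (D x (g k x)) \<partial>lam) \<le> B * (\<integral>x. norm (g k x) \<partial>lam)" by simp
    qed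
    have "(\<lambda>k. \<integral>x. D x (g k x) \<partial>lam) sums (\<integral>x. (\<Sum>k. D x (g k x)) \<partial>lam)"
      by (rule sums_integral[OF Di aeD sumD])
    moreover have "(\<integral>x. (\<Sum>k. D x (g k x)) \<partial>lam) = (\<integral>x. D x (h x) \<partial>lam)"
    proof (rule integral_cong_AE)
      show "(\<lambda>x. \<Sum>k. D x (g k x)) \<in> borel_measurable lam"
        using integrable_suminf[OF Di aeD sumD] by (rule borel_measurable_integrable)
      show "(\<lambda>x. D x (h x)) \<in> borel_measurable lam"
        using pair_integrable[OF hi \<phi>] unfolding D_def by (rule borel_measurable_integrable)
      show "AE x in lam. (\<Sum>k. D x (g k x)) = D x (h x)"
        using ae by eventually_elim (metis ds sums_unique)
    qed
    ultimately show ?thesis by (simp add: pair_def D_def)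
  qed
  with hL nle show ?thesis by (rule that)
qed

text \<open>Successive approximation: each remainder is split into a finite combination of
  evaluations, which is lifted almost optimally, and a much smaller remainder. Only the first lift
  costs about the norm of \<open>\<psi>\<close>; the others sum to a fraction of
  \<open>\<epsilon>\<close>.\<close>

lemma free_lift:
  assumes \<psi>: "\<psi> \<in> F" and \<epsilon>: "\<epsilon> > 0"
  obtains g where "g \<in> L1 b \<Omega>" "matches g \<psi>" "(\<integral>x. norm (g x) \<partial>lam) \<le> dual_norm \<Omega> p \<psi> + \<epsilon>"
proof -
  \<comment> \<open>For \<open>n > 0\<close> the lift costs at most
    \<open>e (n - 1) + 2 * e n = 4 * e n\<close>. The factor \<open>1 / 8\<close> turns this into
    \<open>\<epsilon> / 2 * (1 / 2) ^ n\<close>, and these terms sum to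
    \<open>\<epsilon>\<close>.\<close>
  define e where "e n = \<epsilon> / 8 * (1 / 2) ^ n" for n :: nat
  have e: "e n > 0" for n using \<epsilon> by (simp add: e_def)
  let ?Q = "\<lambda>n u v. dual_norm \<Omega> p v < e n \<and> (\<exists>g\<in>L1 b \<Omega>. matches g (\<lambda>f. u f - v f) \<and>
      (\<integral>x. norm (g x) \<partial>lam) \<le> dual_norm \<Omega> p u + 2 * e n)"
  \<comment> \<open>\<open>u n\<close> is the remainder before stage \<open>n\<close>. The term
    \<open>2 * e n\<close> consists of one \<open>e n\<close> for replacing the remainder by a
    finite combination and one for the lift of that combination.\<close>
  have "\<exists>u. \<forall>n. (u n \<in> F \<and> (n = 0 \<longrightarrow> u n = \<psi>)) \<and> ?Q n (u n) (u (Suc n))"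
  proof (rule dependent_nat_choice)
    show "\<exists>x. x \<in> F \<and> (0 = 0 \<longrightarrow> x = \<psi>)" using \<psi> by blast
  next
    fix u and n :: nat assume "u \<in> F \<and> (n = 0 \<longrightarrow> u = \<psi>)"
    then have u: "u \<in> F" by simp
    then obtain \<theta> where \<theta>: "\<theta> \<in> delta_span \<Omega> p" "dual_norm \<Omega> p (\<lambda>f. u f - \<theta> f) < e n"
      using e unfolding lipschitz_free_def by blast
    note ud = lipschitz_free_dual[OF u] and td = delta_span_dual[OF p \<theta>(1)]
    define v where "v f = u f - \<theta> f" for f
    have v: "v \<in> F" unfolding v_def by (rule lipschitz_free_diff[OF p u delta_span_free[OF p \<theta>(1)]])
    have "dual_norm \<Omega> p \<theta> \<le> dual_norm \<Omega> p u + e n"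
    proof (rule dual_norm_le)
      fix f assume f: "f \<in> Lip0 \<Omega> p" "1-lipschitz_on \<Omega> f"
      show "\<bar>\<theta> f\<bar> \<le> dual_norm \<Omega> p u + e n"
        using dual_norm_bound[OF ud f] dual_norm_bound[OF Lip0_dual_diff[OF ud td] f] \<theta>(2) by linarith
    qed
    moreover obtain g where "g \<in> L1 b \<Omega>" "matches g \<theta>" "(\<integral>x. norm (g x) \<partial>lam) \<le> dual_norm \<Omega> p \<theta> + e n"
      using delta_span_lift[OF \<theta>(1) e] by blast
    ultimately have "?Q n u v" using \<theta>(2) by (force simp: v_def[abs_def])
    with v show "\<exists>v. (v \<in> F \<and> (Suc n = 0 \<longrightarrow> v = \<psi>)) \<and> ?Q n u v" by blast
  qed
  then obtain u where u: "\<And>n. u n \<in> F" "u 0 = \<psi>" "\<And>n. dual_norm \<Omega> p (u (Suc n)) < e n"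
    "\<And>n. \<exists>g\<in>L1 b \<Omega>. matches g (\<lambda>f. u n f - u (Suc n) f) \<and>
      (\<integral>x. norm (g x) \<partial>lam) \<le> dual_norm \<Omega> p (u n) + 2 * e n"
    by blast
  then obtain g where g: "\<And>n. g n \<in> L1 b \<Omega>" "\<And>n. matches (g n) (\<lambda>f. u n f - u (Suc n) f)"
      "\<And>n. (\<integral>x. norm (g n x) \<partial>lam) \<le> dual_norm \<Omega> p (u n) + 2 * e n"
    by metis
  define d where "d n = (if n = 0 then dual_norm \<Omega> p \<psi> else 0) + \<epsilon> / 2 * (1 / 2) ^ n" for n :: nat
  have gd: "(\<integral>x. norm (g n x) \<partial>lam) \<le> d n" for n
  proof (cases n)
    case 0
    then show ?thesis using g(3)[of 0] \<epsilon> by (simp add: d_def e_def u(2))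
  next
    case (Suc m)
    then show ?thesis using g(3)[of n] u(3)[of m] by (simp add: d_def e_def)
  qed
  have "(\<lambda>n. if n = 0 then dual_norm \<Omega> p \<psi> else 0) sums dual_norm \<Omega> p \<psi>"
    using sums_single[of 0 "\<lambda>_. dual_norm \<Omega> p \<psi>"] by simp
  moreover have "(\<lambda>n. \<epsilon> / 2 * (1 / 2) ^ n) sums (\<epsilon> / 2 * 2)"
    using sums_mult[OF geometric_sums[of "1 / 2 :: real"], of "\<epsilon> / 2"] by simp
  ultimately have ds: "d sums (dual_norm \<Omega> p \<psi> + \<epsilon>)"
    unfolding d_def using sums_add by fastforce
  have gs: "summable (\<lambda>n. \<integral>x. norm (g n x) \<partial>lam)"
    by (rule summable_comparison_test'[OF sums_summable[OF ds]]) (use gd in simp)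
  obtain h where h: "h \<in> L1 b \<Omega>" "(\<integral>x. norm (h x) \<partial>lam) \<le> (\<Sum>k. \<integral>x. norm (g k x) \<partial>lam)"
    "\<And>\<phi>. \<phi> \<in> test_functions \<Longrightarrow> (\<lambda>k. pair (g k) \<phi>) sums pair h \<phi>"
    using L1_series[OF g(1) gs] by blast
  show ?thesis
  proof (rule that[OF h(1)])
    have "(\<Sum>k. \<integral>x. norm (g k x) \<partial>lam) \<le> dual_norm \<Omega> p \<psi> + \<epsilon>"
      using suminf_le[OF gd gs sums_summable[OF ds]] sums_unique[OF ds] by simp
    then show "(\<integral>x. norm (h x) \<partial>lam) \<le> dual_norm \<Omega> p \<psi> + \<epsilon>" using h(2) by linarith
    show "matches h \<psi>" unfolding matches_def
    proof
      fix \<phi> :: "'e \<Rightarrow> real" assume \<phi>: "\<phi> \<in> test_functions"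
      then obtain L where L: "L-lipschitz_on UNIV \<phi>" using test_lipschitz by blast
      let ?r = "\<lambda>n. u n (res \<phi>)"
      have "?r \<longlonglongrightarrow> 0"
      proof (rule LIMSEQ_imp_Suc, rule Lim_null_comparison)
        have "norm (?r (Suc n)) \<le> e n * L" for n
          using dual_norm_bound[OF lipschitz_free_dual[OF u(1)] res_Lip0[OF L] res_lipschitz[OF L], of "Suc n"]
            mult_right_mono[OF less_imp_le[OF u(3)[of n]] lipschitz_on_nonneg[OF L]] by simp
        then show "\<forall>\<^sub>F n in sequentially. norm (?r (Suc n)) \<le> e n * L" by simp
        have "e \<longlonglongrightarrow> 0" unfolding e_def
          by (intro tendsto_mult_right_zero LIMSEQ_power_zero) simp
        then show "(\<lambda>n. e n * L) \<longlonglongrightarrow> 0" by (rule tendsto_mult_left_zero)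
      qed
      from telescope_sums'[OF this] have "(\<lambda>n. ?r n - ?r (Suc n)) sums \<psi> (res \<phi>)" by (simp add: u(2))
      moreover have "(\<lambda>n. ?r n - ?r (Suc n)) sums pair h \<phi>"
        using h(3)[OF \<phi>] matchesD[OF g(2) \<phi>] by simp
      ultimately show "pair h \<phi> = \<psi> (res \<phi>)" by (rule sums_unique2[symmetric])
    qed
  qed
qed

section \<open>Integration by parts and densities\<close>

lemma integral_test_derivative:
  fixes \<xi> :: "'e \<Rightarrow> real"
  assumes \<xi>: "\<xi> \<in> test_functions"
  shows "(\<integral>x. frechet_derivative \<xi> (at x) v \<partial>M) = 0"
proof -
  define D where "D x = frechet_derivative \<xi> (at x) v" for x
  have Dt: "D \<in> test_functions" unfolding D_def by (rule test_derivative[OF \<xi>])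
  obtain C where C: "C \<ge> 0" "\<And>y h. \<bar>\<xi> (y + h) - \<xi> y - frechet_derivative \<xi> (at y) h\<bar> \<le> C * (norm h)\<^sup>2"
    using test_second_order[OF \<xi>] by blast
  define K where "K = closure {x. \<xi> x \<noteq> 0}"
  have K: "compact K" "\<And>x. x \<notin> K \<Longrightarrow> \<xi> x = 0" "\<And>x. x \<notin> K \<Longrightarrow> D x = 0"
    using test_compact[OF \<xi>] closure_subset[of "{x. \<xi> x \<noteq> 0}"] test_derivative_zero[OF \<xi>]
    by (auto simp: K_def D_def)
  obtain R where R: "\<And>x. x \<in> K \<Longrightarrow> norm x \<le> R" using compact_imp_bounded[OF K(1)] by (auto simp: bounded_iff)
  \<comment> \<open>Large enough for the supports of all translates of \<open>\<xi>\<close> by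
    \<open>s v\<close> with \<open>s \<le> 1\<close>.\<close>
  define A where "A = cball (0::'e) (R + norm v)"
  have Ai: "integrable M (indicator A :: 'e \<Rightarrow> real)"
    using M_finite[of A] by (intro integrable_real_indicator) (auto simp: A_def)
  define I where "I = (\<integral>x. D x \<partial>M)"
  \<comment> \<open>By translation invariance the integrals of the shifted and the original
    \<open>\<xi>\<close> cancel, so \<open>s * \<bar>I\<bar>\<close> is the integral of a Taylor
    remainder of order \<open>s\<close> squared over the fixed set \<open>A\<close>. Dividing by
    \<open>s\<close> and letting it tend to zero leaves \<open>I = 0\<close>.\<close>
  have est: "\<bar>I\<bar> \<le> s * (C * (norm v)\<^sup>2 * measure M A)" if s: "0 < s" "s \<le> 1" for s :: real
  proof -
    have m [measurable]: "\<xi> \<in> borel_measurable borel" by (rule test_measurable[OF \<xi>])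
    have sh: "integrable M (\<lambda>x. \<xi> (s *\<^sub>R v + 1 *\<^sub>R x))"
      using test_integrable[OF \<xi>] by (subst (asm) integrable_M_affine[where k = 1 and a = "s *\<^sub>R v"]) auto
    have eq: "(\<integral>x. \<xi> (s *\<^sub>R v + 1 *\<^sub>R x) \<partial>M) = (\<integral>x. \<xi> x \<partial>M)"
      using integral_M_affine[of \<xi> 1 "s *\<^sub>R v"] by simp
    let ?d = "\<lambda>x. \<xi> (s *\<^sub>R v + 1 *\<^sub>R x) - \<xi> x - s * D x"
    have di: "integrable M ?d"
      by (intro Bochner_Integration.integrable_diff sh test_integrable \<xi> Dt integrable_mult_right)
    have "(\<integral>x. ?d x \<partial>M) = - s * I"
      using sh test_integrable[OF \<xi>] test_integrable[OF Dt] eq by (simp add: I_def)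
    then have "s * \<bar>I\<bar> = \<bar>\<integral>x. ?d x \<partial>M\<bar>" using s by (simp add: abs_mult)
    also have "\<dots> \<le> (\<integral>x. \<bar>?d x\<bar> \<partial>M)" by (rule integral_abs_bound)
    also have "\<dots> \<le> (\<integral>x. indicator A x * (C * (s * norm v)\<^sup>2) \<partial>M)"
    proof (rule integral_mono[OF integrable_abs[OF di]])
      show "integrable M (\<lambda>x. indicator A x * (C * (s * norm v)\<^sup>2))" using Ai by simp
      fix x
      show "\<bar>?d x\<bar> \<le> indicator A x * (C * (s * norm v)\<^sup>2)"
      proof (cases "x \<in> A")
        case True
        have "\<bar>\<xi> (x + s *\<^sub>R v) - \<xi> x - s * D x\<bar> \<le> C * (norm (s *\<^sub>R v))\<^sup>2"
          using C(2)[of x "s *\<^sub>R v"] linear_scale[OF test_derivative_linear[OF \<xi>], of x s v] by (simp add: D_def)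
        then show ?thesis using True s by (simp add: add.commute)
      next
        case False
        have sv: "norm (s *\<^sub>R v) \<le> norm v" using s mult_right_mono[of s 1 "norm v"] by simp
        have "\<not> norm x \<le> R" using False norm_ge_zero[of v] unfolding A_def mem_cball_0 by linarith
        then have "x \<notin> K" using R by blast
        moreover have "s *\<^sub>R v + x \<notin> K"
        proof
          assume "s *\<^sub>R v + x \<in> K"
          then have "norm (s *\<^sub>R v + x) \<le> R" by (rule R)
          then show False using False sv norm_triangle_ineq4[of "s *\<^sub>R v + x" "s *\<^sub>R v"] by (simp add: A_def)
        qed
        ultimately show ?thesis using K(2,3) False by simp
      qed
    qed
    also have "\<dots> = s * (s * (C * (norm v)\<^sup>2 * measure M A))"
      by (simp add: power_mult_distrib power2_eq_square mult_ac A_def)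
    finally show ?thesis using s(1) by (rule mult_left_le_imp_le)
  qed
  have "\<bar>I\<bar> \<le> 0"
  proof (rule tendsto_lowerbound[where F = "at_right (0::real)"])
    show "((\<lambda>s. s * (C * (norm v)\<^sup>2 * measure M A)) \<longlongrightarrow> 0) (at_right 0)"
      by (rule tendsto_mult_left_zero) (rule tendsto_ident_at)
    show "\<forall>\<^sub>F s in at_right 0. \<bar>I\<bar> \<le> s * (C * (norm v)\<^sup>2 * measure M A)"
      unfolding eventually_at_right_field using est by (intro exI[of _ 1]) auto
  qed simp
  then show ?thesis by (simp add: I_def D_def)
qed

lemma test_mult_smooth:
  fixes \<rho> :: "'e \<Rightarrow> real"
  assumes "\<rho> \<in> test_functions" "\<And>k. higher_differentiable k \<xi>"
  shows "(\<lambda>x. \<rho> x * \<xi> x) \<in> test_functions"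
  by (rule test_functionsI[where K = "closure {x. \<rho> x \<noteq> 0}"])
    (use closure_subset[of "{x. \<rho> x \<noteq> 0}"] in
      \<open>auto intro: higher_differentiable_mult test_smooth test_compact assms\<close>)

text \<open>The product of \<open>\<rho>\<close> and \<open>\<phi> - c\<close> still has compact
  support. The free constant is there to be \<open>\<phi> p\<close>, so that the right-hand side
  involves the function normalised at the base point.\<close>

lemma test_integration_by_parts:
  fixes \<rho> \<phi> :: "'e \<Rightarrow> real"
  assumes \<rho>: "\<rho> \<in> test_functions" and \<phi>: "\<phi> \<in> test_functions"
  shows "(\<integral>x. \<rho> x * frechet_derivative \<phi> (at x) v \<partial>M)
    = - (\<integral>x. (\<phi> x - c) * frechet_derivative \<rho> (at x) v \<partial>M)"
proof -
  have s: "higher_differentiable k (\<lambda>x. \<phi> x - c)" for k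
    using higher_differentiable_add[OF test_smooth[OF \<phi>] higher_differentiable_const[of k "- c"]] by simp
  note t = test_mult_smooth[OF \<rho> s]
  have "((\<lambda>x. \<rho> x * (\<phi> x - c)) has_derivative
      (\<lambda>v. \<rho> x * frechet_derivative \<phi> (at x) v + frechet_derivative \<rho> (at x) v * (\<phi> x - c))) (at x)" for x
    using has_derivative_mult[OF test_differentiable[OF \<rho>] has_derivative_diff[OF test_differentiable[OF \<phi>]
        has_derivative_const[of c]], of x] by simp
  from frechet_derivative_eqI[OF this] have
    D: "frechet_derivative (\<lambda>x. \<rho> x * (\<phi> x - c)) (at x) v
      = \<rho> x * frechet_derivative \<phi> (at x) v + (\<phi> x - c) * frechet_derivative \<rho> (at x) v" for x
    by (simp add: mult.commute)
  have "integrable M (\<lambda>x. \<rho> x * frechet_derivative \<phi> (at x) v)"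
    by (intro test_integrable test_mult_smooth \<rho> test_smooth[OF test_derivative[OF \<phi>]])
  moreover have "integrable M (\<lambda>x. frechet_derivative \<rho> (at x) v * (\<phi> x - c))"
    by (intro test_integrable test_mult_smooth test_derivative \<rho> s)
  ultimately show ?thesis
    using integral_test_derivative[OF t, of v] unfolding D by (simp add: mult.commute)
qed

text \<open>
  The density is replaced by point masses on pieces of small diameter, on each of which a
  \<open>1\<close>-Lipschitz function is almost constant.
\<close>

lemma density_in_free:
  fixes m :: "'e \<Rightarrow> real"
  assumes m [measurable]: "m \<in> borel_measurable borel" and mi: "integrable M m"
    and K: "compact K" "K \<subseteq> \<Omega>" "\<And>x. x \<notin> K \<Longrightarrow> m x = 0"
  shows "(\<lambda>f. if f \<in> Lip0 \<Omega> p then \<integral>x. f x * m x \<partial>M else 0) \<in> F"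
proof -
  define \<psi> where "\<psi> f = (if f \<in> Lip0 \<Omega> p then \<integral>x. f x * m x \<partial>M else 0)" for f
  define I where "I = (\<integral>x. \<bar>m x\<bar> \<partial>M)"
  have I: "I \<ge> 0" by (simp add: I_def)
  obtain R where R: "\<And>x. x \<in> K \<Longrightarrow> norm x \<le> R" using compact_imp_bounded[OF K(1)] by (auto simp: bounded_iff)
  \<comment> \<open>\<open>f\<close> may jump at the boundary of \<Omega>, so measurability comes
    from a Lipschitz extension multiplied by the indicator of the open set.\<close>
  have fm [measurable]: "f \<in> borel_measurable borel" if f: "f \<in> Lip0 \<Omega> p" for f
  proof -
    obtain h where h: "(lip_norm \<Omega> f)-lipschitz_on UNIV h" "\<And>x. x \<in> \<Omega> \<Longrightarrow> h x = f x"
      using lipschitz_on_extension_real[OF Lip0_lipschitz[OF f]] by blast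
    have "f = (\<lambda>x. indicator \<Omega> x * h x)" using f h(2) by (force simp: Lip0_def indicator_def)
    moreover have "h \<in> borel_measurable borel"
      by (intro borel_measurable_continuous_onI lipschitz_on_continuous_on[OF h(1)])
    ultimately show ?thesis using open_\<Omega> by (simp add: borel_measurable_indicator)
  qed
  have fb: "\<bar>f x * m x\<bar> \<le> (L * (R + norm p)) * \<bar>m x\<bar>" if f: "f \<in> Lip0 \<Omega> p" "L-lipschitz_on \<Omega> f" for f L x
  proof (cases "x \<in> K")
    case True
    have "\<bar>f x\<bar> \<le> L * dist x p"
      using lipschitz_onD[OF f(2), of x p] True K(2) p f(1) by (auto simp: Lip0_def dist_real_def)
    also have "\<dots> \<le> L * (R + norm p)"
      using R[OF True] norm_triangle_ineq4[of x p] lipschitz_on_nonneg[OF f(2)]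
      by (intro mult_left_mono) (auto simp: dist_norm)
    finally show ?thesis by (simp add: abs_mult mult_right_mono)
  qed (simp add: K(3))
  have fi: "integrable M (\<lambda>x. f x * m x)" if f: "f \<in> Lip0 \<Omega> p" for f
  proof (rule Bochner_Integration.integrable_bound)
    show "integrable M (\<lambda>x. (lip_norm \<Omega> f * (R + norm p)) * \<bar>m x\<bar>)" using mi by simp
    show "AE x in M. norm (f x * m x) \<le> norm ((lip_norm \<Omega> f * (R + norm p)) * \<bar>m x\<bar>)"
      unfolding real_norm_def by (intro AE_I2 order_trans[OF fb[OF f Lip0_lipschitz[OF f]] abs_ge_self])
    show "(\<lambda>x. f x * m x) \<in> borel_measurable M" using fm[OF f] by measurable
  qed
  have bound: "\<bar>\<psi> f\<bar> \<le> ((R + norm p) * I) * lip_norm \<Omega> f" if f: "f \<in> Lip0 \<Omega> p" for f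
  proof -
    have "\<bar>\<psi> f\<bar> \<le> (\<integral>x. \<bar>f x * m x\<bar> \<partial>M)" using f unfolding \<psi>_def by (simp add: integral_abs_bound)
    also have "\<dots> \<le> (\<integral>x. (lip_norm \<Omega> f * (R + norm p)) * \<bar>m x\<bar> \<partial>M)"
      by (rule integral_mono[OF integrable_abs[OF fi[OF f]] _ fb[OF f Lip0_lipschitz[OF f]]]) (use mi in simp)
    finally show ?thesis by (simp add: I_def mult_ac)
  qed
  have \<psi>d: "\<psi> \<in> Lip0_dual \<Omega> p"
    by (rule Lip0_dualI[OF _ _ bound])
      (simp_all add: \<psi>_def Lip0_add Lip0_scale fi distrib_right mult.assoc)
  have "\<psi> \<in> F"
  proof (rule lipschitz_free_approx[OF p \<psi>d])
    fix e :: real assume e: "e > 0"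
    define \<delta> where "\<delta> = e / (I + 1)"
    have \<delta>: "\<delta> > 0" "\<delta> * I \<le> e" using e I by (auto simp: \<delta>_def field_simps)
    have "K \<subseteq> (\<Union>z\<in>K. ball z \<delta>)" using \<delta> by auto
    then obtain T where T: "T \<subseteq> K" "finite T" "K \<subseteq> (\<Union>z\<in>T. ball z \<delta>)"
      using compactE_image[OF K(1), of K "\<lambda>z. ball z \<delta>"] by blast
    obtain zs where zs: "set zs = T" using finite_list[OF T(2)] by blast
    define n where "n = length zs"
    \<comment> \<open>A disjoint partition from the finite cover: a point belongs to the first ball
      in the list that contains it.\<close>
    define P where "P j = ball (zs ! j) \<delta> - (\<Union>i<j. ball (zs ! i) \<delta>)" for j
    have Pm [measurable]: "P j \<in> sets borel" for j unfolding P_def by auto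
    have part: "(\<Sum>j<n. indicator (P j) x * m x) = m x" for x
    proof (cases "x \<in> K")
      case True
      then obtain j where j: "j < n" "x \<in> ball (zs ! j) \<delta>"
        using T(3) zs by (fastforce simp: n_def in_set_conv_nth)
      define k where "k = (LEAST j. x \<in> ball (zs ! j) \<delta>)"
      have k: "x \<in> ball (zs ! k) \<delta>" "\<And>i. i < k \<Longrightarrow> x \<notin> ball (zs ! i) \<delta>" "k < n"
        using LeastI[of "\<lambda>j. x \<in> ball (zs ! j) \<delta>", OF j(2)] not_less_Least
          Least_le[of "\<lambda>j. x \<in> ball (zs ! j) \<delta>", OF j(2)] j(1)
        unfolding k_def by auto
      have "x \<in> P j \<longleftrightarrow> j = k" for j
        using k(1,2) unfolding P_def by (cases j k rule: linorder_cases) auto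
      then have "(\<Sum>j<n. indicator (P j) x * m x) = (\<Sum>j<n. if j = k then m x else 0)"
        by (intro sum.cong) (auto simp: indicator_def)
      then show ?thesis using k(3) by simp
    qed (simp add: K(3))
    define c where "c j = (\<integral>x. indicator (P j) x * m x \<partial>M)" for j
    have Pi: "integrable M (\<lambda>x. indicator (P j) x * k x)" if "integrable M k" for j and k :: "'e \<Rightarrow> real"
      using integrable_mult_indicator[OF _ that, of "P j"] by simp
    define \<theta> where "\<theta> f = (\<Sum>j<n. c j * delta \<Omega> p (zs ! j) f)" for f
    have zO: "zs ! j \<in> \<Omega>" if "j < n" for j
      using that T(1) K(2) zs by (auto simp: n_def dest!: nth_mem)
    have "\<theta> \<in> delta_span \<Omega> p" unfolding \<theta>_def using zO by (intro delta_span_sum) auto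
    moreover have "dual_norm \<Omega> p (\<lambda>f. \<psi> f - \<theta> f) \<le> e"
    proof (rule dual_norm_le)
      fix f assume f: "f \<in> Lip0 \<Omega> p" "1-lipschitz_on \<Omega> f"
      have t1: "\<psi> f = (\<Sum>j<n. \<integral>x. indicator (P j) x * (f x * m x) \<partial>M)"
      proof -
        have "f x * m x = (\<Sum>j<n. indicator (P j) x * (f x * m x))" for x
        proof -
          have "f x * m x = f x * (\<Sum>j<n. indicator (P j) x * m x)" by (simp only: part)
          also have "\<dots> = (\<Sum>j<n. indicator (P j) x * (f x * m x))"
            unfolding sum_distrib_left by (rule sum.cong) (simp_all add: mult.left_commute)
          finally show ?thesis .
        qed
        note eq = this
        have "\<psi> f = (\<integral>x. f x * m x \<partial>M)" using f(1) by (simp add: \<psi>_def)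
        also have "\<dots> = (\<integral>x. (\<Sum>j<n. indicator (P j) x * (f x * m x)) \<partial>M)"
          by (intro Bochner_Integration.integral_cong refl eq)
        also have "\<dots> = (\<Sum>j<n. \<integral>x. indicator (P j) x * (f x * m x) \<partial>M)"
          by (intro Bochner_Integration.integral_sum Pi fi f)
        finally show ?thesis .
      qed
      have t2: "\<bar>(\<integral>x. indicator (P j) x * (f x * m x) \<partial>M) - c j * f (zs ! j)\<bar>
          \<le> (\<integral>x. indicator (P j) x * (\<delta> * \<bar>m x\<bar>) \<partial>M)" if j: "j < n" for j
      proof -
        have i1: "integrable M (\<lambda>x. indicator (P j) x * (f x * m x))" by (intro Pi fi f)
        have i2: "integrable M (\<lambda>x. indicator (P j) x * m x * f (zs ! j))" using Pi[OF mi] by simp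
        have "(\<integral>x. indicator (P j) x * (f x * m x) \<partial>M) - c j * f (zs ! j)
          = (\<integral>x. indicator (P j) x * (f x * m x) - indicator (P j) x * m x * f (zs ! j) \<partial>M)"
          unfolding c_def using i1 i2 by simp
        then have "\<bar>(\<integral>x. indicator (P j) x * (f x * m x) \<partial>M) - c j * f (zs ! j)\<bar>
          = \<bar>\<integral>x. indicator (P j) x * (f x * m x) - indicator (P j) x * m x * f (zs ! j) \<partial>M\<bar>"
          by (simp only:)
        also have "\<dots> \<le> (\<integral>x. \<bar>indicator (P j) x * (f x * m x) - indicator (P j) x * m x * f (zs ! j)\<bar> \<partial>M)"
          by (rule integral_abs_bound)
        also have "\<dots> \<le> (\<integral>x. indicator (P j) x * (\<delta> * \<bar>m x\<bar>) \<partial>M)"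
        proof (rule integral_mono[OF integrable_abs[OF Bochner_Integration.integrable_diff[OF i1 i2]]])
          show "integrable M (\<lambda>x. indicator (P j) x * (\<delta> * \<bar>m x\<bar>))" using mi by (intro Pi) simp
          fix x
          show "\<bar>indicator (P j) x * (f x * m x) - indicator (P j) x * m x * f (zs ! j)\<bar>
            \<le> indicator (P j) x * (\<delta> * \<bar>m x\<bar>)"
          proof (cases "x \<in> P j \<and> x \<in> K")
            case True
            have "\<bar>f x - f (zs ! j)\<bar> \<le> dist x (zs ! j)"
              using lipschitz_onD[OF f(2), of x "zs ! j"] True K(2) zO[OF j] by (auto simp: dist_real_def)
            also have "\<dots> \<le> \<delta>" using True by (auto simp: P_def dist_commute)
            finally have "\<bar>f x - f (zs ! j)\<bar> * \<bar>m x\<bar> \<le> \<delta> * \<bar>m x\<bar>" by (rule mult_right_mono) simp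
            moreover have "f x * m x - m x * f (zs ! j) = (f x - f (zs ! j)) * m x" by (simp add: algebra_simps)
            ultimately show ?thesis using True by (simp add: abs_mult)
          qed (use K(3)[of x] in \<open>auto simp: indicator_def\<close>)
        qed
        finally show ?thesis .
      qed
      have "\<psi> f - \<theta> f = (\<Sum>j<n. (\<integral>x. indicator (P j) x * (f x * m x) \<partial>M) - c j * f (zs ! j))"
        using f(1) by (simp add: t1 \<theta>_def delta_def sum_subtractf)
      then have "\<bar>\<psi> f - \<theta> f\<bar> \<le> (\<Sum>j<n. \<integral>x. indicator (P j) x * (\<delta> * \<bar>m x\<bar>) \<partial>M)"
        using t2 by (auto intro!: order_trans[OF sum_abs] sum_mono)
      also have "\<dots> = (\<integral>x. (\<Sum>j<n. indicator (P j) x * (\<delta> * \<bar>m x\<bar>)) \<partial>M)"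
        using mi by (intro Bochner_Integration.integral_sum[symmetric] Pi) simp
      also have "\<dots> = (\<integral>x. \<delta> * \<bar>m x\<bar> \<partial>M)"
      proof (rule Bochner_Integration.integral_cong[OF refl])
        fix x
        show "(\<Sum>j<n. indicator (P j) x * (\<delta> * \<bar>m x\<bar>)) = \<delta> * \<bar>m x\<bar>"
        proof (cases "m x = 0")
          case False
          with part[of x] have "(\<Sum>j<n. indicator (P j) x :: real) = 1" by (simp flip: sum_distrib_right)
          then show ?thesis by (simp flip: sum_distrib_right)
        qed simp
      qed
      also have "\<dots> = \<delta> * I" by (simp add: I_def)
      finally show "\<bar>\<psi> f - \<theta> f\<bar> \<le> e" using \<delta>(2) by linarith
    qed
    ultimately show "\<exists>\<theta>\<in>F. dual_norm \<Omega> p (\<lambda>f. \<psi> f - \<theta> f) \<le> e" using delta_span_free[OF p] by blast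
  qed
  then show ?thesis by (simp add: \<psi>_def[abs_def])
qed

lemma test_integrable_lam:
  fixes \<rho> :: "'e \<Rightarrow> real"
  assumes "\<rho> \<in> test_functions"
  shows "integrable lam \<rho>"
  using test_integrable[OF assms] test_measurable[OF assms]
  by (subst integrable_completion) (auto simp: measurable_cong_sets[OF sets_M refl])

definition representable :: "('e \<Rightarrow> 'e) \<Rightarrow> bool" where
  "representable g \<longleftrightarrow> (\<exists>\<psi>\<in>F. matches g \<psi>)"

text \<open>Integration by parts turns the field into the density \<open>m\<close>, minus the
  derivative of \<open>\<rho>\<close> in direction \<open>v\<close>. It is supported in
  \<open>K\<close>, inside \<Omega>, and hence defines an element of the free space.\<close>

lemma representable_test:
  fixes \<rho> :: "'e \<Rightarrow> real"
  assumes \<rho>: "\<rho> \<in> test_functions" and K: "compact K" "K \<subseteq> \<Omega>" "\<And>x. x \<notin> K \<Longrightarrow> \<rho> x = 0"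
  shows "(\<lambda>x. \<rho> x *\<^sub>R v) \<in> L1 b \<Omega>" "representable (\<lambda>x. \<rho> x *\<^sub>R v)"
proof -
  show "(\<lambda>x. \<rho> x *\<^sub>R v) \<in> L1 b \<Omega>"
    using test_integrable_lam[OF \<rho>] K by (auto simp: L1_iff)
  define m where "m x = - frechet_derivative \<rho> (at x) v" for x
  have mt: "m \<in> test_functions"
    unfolding m_def using test_cmult[OF test_derivative[OF \<rho>, of v], of "-1"] by simp
  have mK: "m x = 0" if "x \<notin> K" for x
  proof -
    have "closure {x. \<rho> x \<noteq> 0} \<subseteq> K" using K(3) compact_imp_closed[OF K(1)] by (intro closure_minimal) auto
    then have "frechet_derivative \<rho> (at x) = (\<lambda>_. 0)"
      using that by (intro test_derivative_zero[OF \<rho>]) auto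
    then show ?thesis by (simp add: m_def)
  qed
  define \<psi> where "\<psi> f = (if f \<in> Lip0 \<Omega> p then \<integral>x. f x * m x \<partial>M else 0)" for f
  have "\<psi> \<in> F"
    unfolding \<psi>_def by (rule density_in_free[OF test_measurable[OF mt] test_integrable[OF mt] K(1,2) mK])
  moreover have "matches (\<lambda>x. \<rho> x *\<^sub>R v) \<psi>"
    unfolding matches_def
  proof
    fix \<phi> :: "'e \<Rightarrow> real" assume \<phi>: "\<phi> \<in> test_functions"
    then obtain L where L: "L-lipschitz_on UNIV \<phi>" using test_lipschitz by blast
    have "pair (\<lambda>x. \<rho> x *\<^sub>R v) \<phi> = (\<integral>x. \<rho> x * frechet_derivative \<phi> (at x) v \<partial>lam)"
      by (simp add: pair_def linear_scale[OF test_derivative_linear[OF \<phi>]])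
    also have "\<dots> = (\<integral>x. \<rho> x * frechet_derivative \<phi> (at x) v \<partial>M)"
    proof (rule integral_completion)
      have "(\<lambda>x. \<rho> x * frechet_derivative \<phi> (at x) v) \<in> borel_measurable borel"
        by (intro borel_measurable_times test_measurable \<rho> test_derivative \<phi>)
      then show "(\<lambda>x. \<rho> x * frechet_derivative \<phi> (at x) v) \<in> borel_measurable M"
        by (simp add: measurable_cong_sets[OF sets_M refl])
    qed
    also have "\<dots> = - (\<integral>x. (\<phi> x - \<phi> p) * frechet_derivative \<rho> (at x) v \<partial>M)"
      by (rule test_integration_by_parts[OF \<rho> \<phi>])
    also have "\<dots> = (\<integral>x. (\<phi> x - \<phi> p) * m x \<partial>M)" by (simp add: m_def)
    also have "\<dots> = (\<integral>x. res \<phi> x * m x \<partial>M)"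
      by (rule Bochner_Integration.integral_cong) (use mK K(2) in \<open>auto simp: res_def\<close>)
    also have "\<dots> = \<psi> (res \<phi>)" by (simp add: \<psi>_def res_Lip0[OF L])
    finally show "pair (\<lambda>x. \<rho> x *\<^sub>R v) \<phi> = \<psi> (res \<phi>)" .
  qed
  ultimately show "representable (\<lambda>x. \<rho> x *\<^sub>R v)" unfolding representable_def by blast
qed

lemma representable_add:
  "g \<in> L1 b \<Omega> \<Longrightarrow> h \<in> L1 b \<Omega> \<Longrightarrow> representable g \<Longrightarrow> representable h \<Longrightarrow> representable (\<lambda>x. g x + h x)"
  unfolding representable_def using lipschitz_free_add[OF p] matches_add L1_integrable by blast

lemma representable_sum:
  assumes "finite I" "\<And>i. i \<in> I \<Longrightarrow> g i \<in> L1 b \<Omega>" "\<And>i. i \<in> I \<Longrightarrow> representable (g i)"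
  shows "(\<lambda>x. \<Sum>i\<in>I. g i x) \<in> L1 b \<Omega> \<and> representable (\<lambda>x. \<Sum>i\<in>I. g i x)"
  using assms
proof induction
  case empty
  have "matches (\<lambda>_. 0) (\<lambda>_. 0)" unfolding matches_def using pair_scale[of _ 0 "\<lambda>_. 0"] by simp
  moreover have "(\<lambda>_. 0) \<in> F"
    using lipschitz_free_scale[OF p delta_span_free[OF p delta_in_span[OF p]], of 0] by simp
  ultimately show ?case using L1_zero unfolding representable_def by auto
next
  case (insert i I)
  then show ?case using representable_add[of "g i" "\<lambda>x. \<Sum>i\<in>I. g i x"] by (auto intro!: L1_add)
qed

text \<open>The bound for differences of matched functionals makes the functionals of the
  approximating fields a Cauchy sequence. Their limit is built pointwise on each \<open>f\<close>,
  and only afterwards shown to be a limit in the dual norm and a member of the free space.\<close>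

lemma representable_closed:
  assumes g: "g \<in> L1 b \<Omega>"
    and approx: "\<And>e. e > 0 \<Longrightarrow> \<exists>h\<in>L1 b \<Omega>. representable h \<and> (\<integral>x. norm (g x - h x) \<partial>lam) \<le> e"
  shows "representable g"
proof -
  define e where "e n = (1 / 2 :: real) ^ n" for n
  have e0: "e \<longlonglongrightarrow> 0" unfolding e_def by (rule LIMSEQ_power_zero) simp
  have "\<exists>h\<in>L1 b \<Omega>. representable h \<and> (\<integral>x. norm (g x - h x) \<partial>lam) \<le> e n" for n
    by (rule approx) (simp add: e_def)
  then have "\<exists>h \<psi>. h \<in> L1 b \<Omega> \<and> \<psi> \<in> F \<and> matches h \<psi> \<and> (\<integral>x. norm (g x - h x) \<partial>lam) \<le> e n" for n
    unfolding representable_def by blast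
  then obtain h u where h: "\<And>n. h n \<in> L1 b \<Omega>" and u: "\<And>n. u n \<in> F" and m: "\<And>n. matches (h n) (u n)"
    and near: "\<And>n. (\<integral>x. norm (g x - h n x) \<partial>lam) \<le> e n" by metis
  note gi = L1_integrable[OF g] and hi = L1_integrable[OF h]
  have diff: "\<bar>u n f - u k f\<bar> \<le> L * (e n + e k)" if f: "f \<in> Lip0 \<Omega> p" "L-lipschitz_on \<Omega> f" for n k f L
  proof -
    have "\<bar>u n f - u k f\<bar> \<le> L * (\<integral>x. norm (h n x - h k x) \<partial>lam)"
      using matches_bound[OF lipschitz_free_diff[OF p u u] integrable_sub[OF hi hi] matches_diff[OF hi hi m m] f] .
    also have "\<dots> \<le> L * (e n + e k)"
    proof (rule mult_left_mono[OF _ lipschitz_on_nonneg[OF f(2)]])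
      have "norm (h n x - h k x) \<le> norm (g x - h n x) + norm (g x - h k x)" for x
        using norm_triangle_ineq4[of "g x - h k x" "g x - h n x"] by (simp add: add.commute)
      then have "(\<integral>x. norm (h n x - h k x) \<partial>lam) \<le> (\<integral>x. norm (g x - h n x) + norm (g x - h k x) \<partial>lam)"
        by (intro integral_mono integrable_norm_co integrable_sub hi gi Bochner_Integration.integrable_add)
      also have "\<dots> = (\<integral>x. norm (g x - h n x) \<partial>lam) + (\<integral>x. norm (g x - h k x) \<partial>lam)"
        by (intro Bochner_Integration.integral_add integrable_norm_co integrable_sub hi gi)
      finally show "(\<integral>x. norm (h n x - h k x) \<partial>lam) \<le> e n + e k" using near[of n] near[of k] by linarith
    qed
    finally show ?thesis .
  qed
  have conv: "convergent (\<lambda>n. u n f)" for f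
  proof (cases "f \<in> Lip0 \<Omega> p")
    case True
    have "(\<lambda>n. lip_norm \<Omega> f * (2 * e n)) \<longlonglongrightarrow> 0" using tendsto_mult_right_zero[OF tendsto_mult_right_zero[OF e0]] .
    have "Cauchy (\<lambda>n. u n f)"
    proof (rule metric_CauchyI)
      fix r :: real assume "r > 0"
      with order_tendstoD(2)[OF \<open>(\<lambda>n. lip_norm \<Omega> f * (2 * e n)) \<longlonglongrightarrow> 0\<close>] obtain N where N: "\<And>n. n \<ge> N \<Longrightarrow> lip_norm \<Omega> f * (2 * e n) < r"
        unfolding eventually_sequentially by blast
      show "\<exists>N. \<forall>n\<ge>N. \<forall>k\<ge>N. dist (u n f) (u k f) < r"
      proof (intro exI allI impI)
        fix n k assume nk: "n \<ge> N" "k \<ge> N"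
        show "dist (u n f) (u k f) < r"
          using diff[OF True Lip0_lipschitz[OF True], of n k] N[OF nk(1)] N[OF nk(2)]
          by (simp add: dist_real_def distrib_left)
      qed
    qed
    then show ?thesis by (simp add: Cauchy_convergent_iff)
  next
    case False
    then have "(\<lambda>n. u n f) = (\<lambda>_. 0)" using Lip0_dualD(3)[OF lipschitz_free_dual[OF u]] by auto
    then show ?thesis by (simp add: convergent_const)
  qed
  define \<psi> where "\<psi> f = lim (\<lambda>n. u n f)" for f
  have lim: "(\<lambda>n. u n f) \<longlonglongrightarrow> \<psi> f" for f unfolding \<psi>_def using conv convergent_LIMSEQ_iff by blast
  \<comment> \<open>The Cauchy estimate with \<open>k\<close> fixed and \<open>n\<close> tending to
    infinity. For fixed \<open>L\<close> it is uniform in \<open>f\<close>, hence an estimate in the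
    dual norm.\<close>
  have err: "\<bar>\<psi> f - u k f\<bar> \<le> L * e k" if f: "f \<in> Lip0 \<Omega> p" "L-lipschitz_on \<Omega> f" for k f L
  proof (rule LIMSEQ_le)
    show "(\<lambda>n. \<bar>u n f - u k f\<bar>) \<longlonglongrightarrow> \<bar>\<psi> f - u k f\<bar>" by (intro tendsto_intros lim)
    show "(\<lambda>n. L * (e n + e k)) \<longlonglongrightarrow> L * e k"
      using tendsto_mult_left[OF tendsto_add[OF e0 tendsto_const[of "e k"]], of L] by simp
    show "\<exists>N. \<forall>n\<ge>N. \<bar>u n f - u k f\<bar> \<le> L * (e n + e k)" using diff[OF f] by blast
  qed
  have \<psi>d: "\<psi> \<in> Lip0_dual \<Omega> p"
  proof -
    obtain C where C: "C \<ge> 0" "\<And>f. f \<in> Lip0 \<Omega> p \<Longrightarrow> \<bar>u 0 f\<bar> \<le> C * lip_norm \<Omega> f"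
      using Lip0_dual_bounded[OF lipschitz_free_dual[OF u[of 0]]] by blast
    show ?thesis
    proof (rule Lip0_dualI)
      fix f k assume f: "f \<in> Lip0 \<Omega> p" and k: "k \<in> Lip0 \<Omega> p"
      have "u n (\<lambda>x. f x + k x) = u n f + u n k" for n
        by (rule Lip0_dualD(1)[OF lipschitz_free_dual[OF u] f k])
      with tendsto_add[OF lim[of f] lim[of k]] show "\<psi> (\<lambda>x. f x + k x) = \<psi> f + \<psi> k"
        using LIMSEQ_unique[OF lim[of "\<lambda>x. f x + k x"]] by simp
    next
      fix c f assume f: "f \<in> Lip0 \<Omega> p"
      have "u n (\<lambda>x. c * f x) = c * u n f" for n
        by (rule Lip0_dualD(2)[OF lipschitz_free_dual[OF u] f])
      with tendsto_mult_left[OF lim[of f], of c] show "\<psi> (\<lambda>x. c * f x) = c * \<psi> f"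
        using LIMSEQ_unique[OF lim[of "\<lambda>x. c * f x"]] by simp
    next
      fix f assume f: "f \<in> Lip0 \<Omega> p"
      show "\<bar>\<psi> f\<bar> \<le> (C + e 0) * lip_norm \<Omega> f"
        using err[OF f Lip0_lipschitz[OF f], of 0] C(2)[OF f] by (simp add: algebra_simps)
    next
      fix f assume "f \<notin> Lip0 \<Omega> p"
      then have "u n f = 0" for n using Lip0_dualD(3)[OF lipschitz_free_dual[OF u]] by blast
      then show "\<psi> f = 0" by (simp add: \<psi>_def)
    qed
  qed
  have "\<psi> \<in> F"
  proof (rule lipschitz_free_approx[OF p \<psi>d])
    fix r :: real assume "r > 0"
    with order_tendstoD(2)[OF e0] obtain n where n: "e n < r" by (auto simp: eventually_sequentially)
    have "dual_norm \<Omega> p (\<lambda>f. \<psi> f - u n f) \<le> r"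
      by (rule dual_norm_le) (use err[of _ 1 n] n in force)
    then show "\<exists>\<theta>\<in>F. dual_norm \<Omega> p (\<lambda>f. \<psi> f - \<theta> f) \<le> r" using u by blast
  qed
  moreover have "matches g \<psi>"
    unfolding matches_def
  proof
    fix \<phi> :: "'e \<Rightarrow> real" assume \<phi>: "\<phi> \<in> test_functions"
    then obtain L where L: "L-lipschitz_on UNIV \<phi>" using test_lipschitz by blast
    have "(\<lambda>n. pair (h n) \<phi>) \<longlonglongrightarrow> pair g \<phi>"
    proof (rule LIM_zero_cancel, rule Lim_null_comparison)
      have "\<bar>pair (h n) \<phi> - pair g \<phi>\<bar> \<le> L * e n" for n
      proof -
        have "\<bar>pair (\<lambda>x. g x - h n x) \<phi>\<bar> \<le> L * (\<integral>x. norm (g x - h n x) \<partial>lam)"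
          by (rule pair_bound[OF integrable_sub[OF gi hi] \<phi> L])
        also have "\<dots> \<le> L * e n" by (rule mult_left_mono[OF near lipschitz_on_nonneg[OF L]])
        finally show ?thesis by (simp add: pair_diff[OF gi hi \<phi>])
      qed
      then show "\<forall>\<^sub>F n in sequentially. norm (pair (h n) \<phi> - pair g \<phi>) \<le> L * e n" by simp
      show "(\<lambda>n. L * e n) \<longlonglongrightarrow> 0" by (rule tendsto_mult_right_zero[OF e0])
    qed
    moreover have "(\<lambda>n. pair (h n) \<phi>) \<longlonglongrightarrow> \<psi> (res \<phi>)"
      unfolding matchesD[OF m \<phi>] by (rule lim)
    ultimately show "pair g \<phi> = \<psi> (res \<phi>)" by (rule LIMSEQ_unique)
  qed
  ultimately show ?thesis unfolding representable_def by blast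
qed

section \<open>Density of test fields among integrable fields\<close>

lemma compact_inner_approximation:
  assumes A [measurable]: "A \<in> sets borel" and fin: "emeasure M A < \<infinity>" and e: "e > 0"
  obtains K where "compact K" "K \<subseteq> A" "(\<integral>x. \<bar>indicator A x - indicator K x :: real\<bar> \<partial>M) < e"
proof -
  define B where "B = J -` A"
  have [measurable]: "B \<in> sets borel" using measurable_sets[OF J_measurable A] by (simp add: B_def)
  \<comment> \<open>Inner regularity is applied to a finite measure on \<open>real^'n\<close>:
    Lebesgue measure restricted to the preimage of \<open>A\<close>. The compact set found there is
    carried back by \<open>J\<close>.\<close>
  define N where "N = density lborel (indicator B :: real^'n \<Rightarrow> ennreal)"
  have NX: "emeasure N X = emeasure lborel (B \<inter> X)" if [measurable]: "X \<in> sets borel" for X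
    by (simp add: N_def emeasure_density mult.commute flip: indicator_inter_arith)
  have MB: "emeasure lborel (B \<inter> J -` X) = emeasure M (A \<inter> X)" if [measurable]: "X \<in> sets borel" for X
    by (simp add: M_def emeasure_distr B_def vimage_Int)
  have NB: "emeasure N B = emeasure M A" using NX[of B] MB[of UNIV] by simp
  have sup: "emeasure N B = (SUP K\<in>{K. K \<subseteq> B \<and> compact K}. emeasure N K)"
  proof (rule inner_regular)
    show "sets N = sets borel" by (simp add: N_def)
    show "emeasure N (space N) \<noteq> \<infinity>" using NX[of UNIV] MB[of UNIV] fin by (simp add: N_def)
  qed measurable
  have "\<exists>K\<in>{K. K \<subseteq> B \<and> compact K}. emeasure N B < emeasure N K + e"
    by (rule SUP_approx_ennreal[OF e _ sup]) (use fin in \<open>auto simp: NB\<close>)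
  then obtain K where K: "K \<subseteq> B" "compact K" "emeasure N B < emeasure N K + e" by blast
  define K' where "K' = J ` K"
  have cK: "compact K'" unfolding K'_def by (intro compact_continuous_image J_continuous K)
  have sub: "K' \<subseteq> A" using K(1) by (auto simp: K'_def B_def)
  have [measurable]: "K' \<in> sets borel" using cK by (simp add: borel_closed compact_imp_closed)
  have [measurable]: "K \<in> sets borel" using K(2) by (simp add: borel_closed compact_imp_closed)
  have "J -` K' = K" unfolding K'_def using J_bij by (simp add: bij_def inj_vimage_image_eq)
  then have KM: "emeasure N K = emeasure M K'"
    using NX[of K] MB[of K'] sub by (simp add: Int_absorb1)
  have finK: "emeasure M K' < \<infinity>" using M_finite[OF compact_imp_bounded[OF cK]] by simp
  have "measure M A < measure M K' + e"
  proof -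
    have "ennreal (measure M A) < ennreal (measure M K') + ennreal e"
      using K(3) fin finK unfolding NB KM by (simp add: emeasure_eq_ennreal_measure less_top)
    then show ?thesis using e by (simp add: ennreal_plus[symmetric] ennreal_less_iff del: ennreal_plus)
  qed
  moreover have "(\<integral>x. \<bar>indicator A x - indicator K' x :: real\<bar> \<partial>M) = measure M A - measure M K'"
  proof -
    have "\<bar>indicator A x - indicator K' x :: real\<bar> = indicator A x - indicator K' x" for x
      using sub by (auto simp: indicator_def)
    moreover have "integrable M (indicator A :: 'e \<Rightarrow> real)" "integrable M (indicator K' :: 'e \<Rightarrow> real)"
      using fin finK by (auto intro!: integrable_real_indicator)
    ultimately show ?thesis by simp
  qed
  ultimately show ?thesis using cK sub by (intro that[of K']) auto
qed

lemma test_add: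
  fixes \<phi> \<rho> :: "'e \<Rightarrow> real"
  assumes "\<phi> \<in> test_functions" "\<rho> \<in> test_functions"
  shows "(\<lambda>x. \<phi> x + \<rho> x) \<in> test_functions"
proof (rule test_functionsI)
  show "compact (closure {x. \<phi> x \<noteq> 0} \<union> closure {x. \<rho> x \<noteq> 0})"
    by (intro compact_Un test_compact assms)
  show "x \<in> closure {x. \<phi> x \<noteq> 0} \<union> closure {x. \<rho> x \<noteq> 0}" if "\<phi> x + \<rho> x \<noteq> 0" for x
    using that closure_subset[of "{x. \<phi> x \<noteq> 0}"] closure_subset[of "{x. \<rho> x \<noteq> 0}"]
    by (cases "\<phi> x = 0") auto
qed (intro higher_differentiable_add test_smooth assms)

lemma \<Omega>_lam: "\<Omega> \<in> sets lam"
  using open_\<Omega> by (intro sets_completionI_sets) simp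

text \<open>The usual test functions of the open set \<Omega>, in contrast to
  \<open>test_functions\<close>, whose supports may lie anywhere.\<close>

definition inner_test :: "('e \<Rightarrow> real) \<Rightarrow> bool" where
  "inner_test \<rho> \<longleftrightarrow> \<rho> \<in> test_functions \<and> (\<exists>K. compact K \<and> K \<subseteq> \<Omega> \<and> (\<forall>x. x \<notin> K \<longrightarrow> \<rho> x = 0))"

lemma inner_test_add: "inner_test \<phi> \<Longrightarrow> inner_test \<rho> \<Longrightarrow> inner_test (\<lambda>x. \<phi> x + \<rho> x)"
  unfolding inner_test_def
proof (elim conjE exE, intro conjI)
  fix K K' assume K: "compact K" "K \<subseteq> \<Omega>" "\<forall>x. x \<notin> K \<longrightarrow> \<phi> x = 0"
    "compact K'" "K' \<subseteq> \<Omega>" "\<forall>x. x \<notin> K' \<longrightarrow> \<rho> x = 0"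
  then show "\<exists>K. compact K \<and> K \<subseteq> \<Omega> \<and> (\<forall>x. x \<notin> K \<longrightarrow> \<phi> x + \<rho> x = 0)"
    by (intro exI[of _ "K \<union> K'"]) (simp add: compact_Un)
qed (rule test_add)

lemma inner_test_cmult: "inner_test \<rho> \<Longrightarrow> inner_test (\<lambda>x. c * \<rho> x)"
  unfolding inner_test_def using test_cmult by auto

lemma inner_test_integrable: "inner_test \<rho> \<Longrightarrow> integrable lam \<rho>"
  unfolding inner_test_def by (blast intro: test_integrable_lam)

text \<open>A set measurable for the completion is replaced by its Borel main part, which changes
  integrals by nothing; then a compact subset is chosen and its indicator smoothed, each at an error
  of \<open>e / 2\<close>.\<close>

lemma indicator_inner_test:
  assumes A: "A \<in> sets lam" "emeasure lam A < \<infinity>" and e: "e > 0"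
  obtains \<rho> where "inner_test \<rho>" "(\<integral>x. \<bar>indicator \<Omega> x * indicator A x - \<rho> x\<bar> \<partial>lam) < e"
proof -
  have A0: "A \<inter> \<Omega> \<in> sets lam" using A(1) \<Omega>_lam by (rule sets.Int)
  define A' where "A' = main_part M (A \<inter> \<Omega>)"
  have A'm: "A' \<in> sets borel" using main_part_sets[OF A0] by (simp add: A'_def)
  have un: "A' \<union> null_part M (A \<inter> \<Omega>) = A \<inter> \<Omega>" unfolding A'_def by (rule main_part_null_part_Un[OF A0])
  have "emeasure M A' = emeasure lam (A \<inter> \<Omega>)" unfolding A'_def using A0 by (simp add: emeasure_completion)
  also have "\<dots> \<le> emeasure lam A" by (rule emeasure_mono) (use A in auto)
  finally have A'fin: "emeasure M A' < \<infinity>" using A(2) by simp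
  obtain K where K: "compact K" "K \<subseteq> A'" "(\<integral>x. \<bar>indicator A' x - indicator K x :: real\<bar> \<partial>M) < e / 2"
    using compact_inner_approximation[OF A'm A'fin, of "e / 2"] e by auto
  have "K \<subseteq> \<Omega>" using K(2) un by blast
  then obtain \<rho> K' where \<rho>: "\<rho> \<in> test_functions" "compact K'" "K' \<subseteq> \<Omega>" "\<And>x. x \<notin> K' \<Longrightarrow> \<rho> x = 0"
      "(\<integral>x. \<bar>\<rho> x - indicator K x\<bar> \<partial>M) < e / 2"
    using indicator_test_approximation[OF K(1) _ open_\<Omega>, of "e / 2"] e by auto
  note [measurable] = A'm test_measurable[OF \<rho>(1)]
  have [measurable]: "K \<in> sets borel" using K(1) by (simp add: borel_closed compact_imp_closed)
  have iA: "integrable M (indicator A' :: 'e \<Rightarrow> real)" "integrable M (indicator K :: 'e \<Rightarrow> real)"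
    using A'fin M_finite[OF compact_imp_bounded[OF K(1)]] by (auto intro!: integrable_real_indicator)
  note i\<rho> = test_integrable[OF \<rho>(1)]
  have meas: "(\<lambda>x. \<bar>indicator A' x - \<rho> x\<bar>) \<in> borel_measurable M" by measurable
  have "(\<integral>x. \<bar>indicator \<Omega> x * indicator A x - \<rho> x\<bar> \<partial>lam) = (\<integral>x. \<bar>indicator A' x - \<rho> x\<bar> \<partial>lam)"
  proof (rule integral_cong_AE)
    show "(\<lambda>x. \<bar>indicator \<Omega> x * indicator A x - \<rho> x\<bar>) \<in> borel_measurable lam"
      using A(1) \<Omega>_lam measurable_lam[OF test_measurable[OF \<rho>(1)]]
      by (intro borel_measurable_abs borel_measurable_diff borel_measurable_times borel_measurable_indicator)
    show "(\<lambda>x. \<bar>indicator A' x - \<rho> x\<bar>) \<in> borel_measurable lam" by (rule measurable_completion[OF meas])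
    show "AE x in lam. \<bar>indicator \<Omega> x * indicator A x - \<rho> x\<bar> = \<bar>indicator A' x - \<rho> x\<bar>"
      using AE_completion[OF AE_notin_null_part[OF A0]]
    proof eventually_elim
      case (elim x)
      then have "x \<in> A' \<longleftrightarrow> x \<in> A \<and> x \<in> \<Omega>" using un by blast
      then show ?case by (simp add: indicator_def)
    qed
  qed
  also have "\<dots> = (\<integral>x. \<bar>indicator A' x - \<rho> x\<bar> \<partial>M)" by (rule integral_completion[OF meas])
  also have "\<dots> \<le> (\<integral>x. \<bar>indicator A' x - indicator K x\<bar> + \<bar>\<rho> x - indicator K x\<bar> \<partial>M)"
    by (intro integral_mono integrable_abs Bochner_Integration.integrable_diff
        Bochner_Integration.integrable_add iA i\<rho>) auto
  also have "\<dots> = (\<integral>x. \<bar>indicator A' x - indicator K x\<bar> \<partial>M) + (\<integral>x. \<bar>\<rho> x - indicator K x\<bar> \<partial>M)"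
    by (intro Bochner_Integration.integral_add integrable_abs Bochner_Integration.integrable_diff iA i\<rho>)
  also have "\<dots> < e" using K(3) \<rho>(5) by simp
  finally show ?thesis using \<rho> by (intro that[of \<rho>]) (auto simp: inner_test_def)
qed

text \<open>Approximating the product with the indicator of \<Omega> leaves \<open>u\<close>
  unrestricted, so that induction on integrable functions applies although its intermediate
  functions need not vanish off \<Omega>.\<close>

lemma inner_test_dense:
  fixes u :: "'e \<Rightarrow> real"
  assumes "integrable lam u" "e > 0"
  shows "\<exists>\<rho>. inner_test \<rho> \<and> (\<integral>x. \<bar>indicator \<Omega> x * u x - \<rho> x\<bar> \<partial>lam) < e"
  using assms
proof (induction u arbitrary: e rule: integrable_induct)
  case (base A c)
  show ?case
  proof (cases "c = 0")
    case True
    have "inner_test (\<lambda>x. 0)" unfolding inner_test_def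
      by (auto intro!: test_functionsI[where K = "{}"] higher_differentiable_const exI[of _ "{}"])
    then show ?thesis using True base(3) by (intro exI[of _ "\<lambda>x. 0"]) simp
  next
    case False
    then obtain \<rho> where \<rho>: "inner_test \<rho>" "(\<integral>x. \<bar>indicator \<Omega> x * indicator A x - \<rho> x\<bar> \<partial>lam) < e / \<bar>c\<bar>"
      using indicator_inner_test[OF base(1,2), of "e / \<bar>c\<bar>"] base(3) by auto
    have "\<bar>indicator \<Omega> x * (indicator A x *\<^sub>R c) - c * \<rho> x\<bar> = \<bar>c\<bar> * \<bar>indicator \<Omega> x * indicator A x - \<rho> x\<bar>" for x
      unfolding abs_mult[symmetric] by (simp add: algebra_simps)
    then have "(\<integral>x. \<bar>indicator \<Omega> x * (indicator A x *\<^sub>R c) - c * \<rho> x\<bar> \<partial>lam)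
        = \<bar>c\<bar> * (\<integral>x. \<bar>indicator \<Omega> x * indicator A x - \<rho> x\<bar> \<partial>lam)" by simp
    also have "\<dots> < e" using \<rho>(2) False by (simp add: field_simps)
    finally show ?thesis using inner_test_cmult[OF \<rho>(1), of c] by blast
  qed
next
  case (add f g)
  obtain \<rho> \<eta> where \<rho>: "inner_test \<rho>" "(\<integral>x. \<bar>indicator \<Omega> x * f x - \<rho> x\<bar> \<partial>lam) < e / 2"
    and \<eta>: "inner_test \<eta>" "(\<integral>x. \<bar>indicator \<Omega> x * g x - \<eta> x\<bar> \<partial>lam) < e / 2"
    using add.IH[of "e / 2"] add.prems by (meson half_gt_zero)
  have i: "integrable lam (\<lambda>x. indicator \<Omega> x * k x)" if "integrable lam k" for k :: "'e \<Rightarrow> real"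
    using integrable_mult_indicator[OF \<Omega>_lam that] by simp
  note ii = i[OF add.hyps(1)] i[OF add.hyps(2)] inner_test_integrable[OF \<rho>(1)] inner_test_integrable[OF \<eta>(1)]
  have "\<bar>indicator \<Omega> x * (f x + g x) - (\<rho> x + \<eta> x)\<bar>
      \<le> \<bar>indicator \<Omega> x * f x - \<rho> x\<bar> + \<bar>indicator \<Omega> x * g x - \<eta> x\<bar>" for x
    by (simp add: distrib_left)
  then have "(\<integral>x. \<bar>indicator \<Omega> x * (f x + g x) - (\<rho> x + \<eta> x)\<bar> \<partial>lam)
      \<le> (\<integral>x. \<bar>indicator \<Omega> x * f x - \<rho> x\<bar> + \<bar>indicator \<Omega> x * g x - \<eta> x\<bar> \<partial>lam)"
    by (intro integral_mono integrable_abs Bochner_Integration.integrable_diff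
        Bochner_Integration.integrable_add ii i add.hyps) auto
  also have "\<dots> = (\<integral>x. \<bar>indicator \<Omega> x * f x - \<rho> x\<bar> \<partial>lam) + (\<integral>x. \<bar>indicator \<Omega> x * g x - \<eta> x\<bar> \<partial>lam)"
    by (intro Bochner_Integration.integral_add integrable_abs Bochner_Integration.integrable_diff ii)
  also have "\<dots> < e" using \<rho>(2) \<eta>(2) by simp
  finally show ?case using inner_test_add[OF \<rho>(1) \<eta>(1)] by blast
next
  case (lim f s)
  have i: "integrable lam (\<lambda>x. indicator \<Omega> x * k x)" if "integrable lam k" for k :: "'e \<Rightarrow> real"
    using integrable_mult_indicator[OF \<Omega>_lam that] by simp
  have "(\<lambda>n. \<integral>x. \<bar>s n x - f x\<bar> \<partial>lam) \<longlonglongrightarrow> (\<integral>x. 0 \<partial>lam)"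
  \<comment> \<open>The approximants satisfy
    \<open>\<bar>s n x\<bar> \<le> 2 * \<bar>f x\<bar>\<close>, hence the factor 3 for the
    difference.\<close>
  proof (rule integral_dominated_convergence[where w = "\<lambda>x. 3 * \<bar>f x\<bar>"])
    show "integrable lam (\<lambda>x. 3 * \<bar>f x\<bar>)" using lim.hyps by simp
    show "AE x in lam. (\<lambda>n. \<bar>s n x - f x\<bar>) \<longlonglongrightarrow> 0"
    proof (rule AE_I2)
      fix x assume "x \<in> space lam"
      then have "(\<lambda>n. s n x) \<longlonglongrightarrow> f x" by (rule lim.hyps)
      then show "(\<lambda>n. \<bar>s n x - f x\<bar>) \<longlonglongrightarrow> 0" by (intro tendsto_rabs_zero LIM_zero)
    qed
    show "AE x in lam. norm \<bar>s n x - f x\<bar> \<le> 3 * \<bar>f x\<bar>" for n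
    proof (rule AE_I2)
      fix x assume "x \<in> space lam"
      then have "norm (s n x) \<le> 2 * norm (f x)" by (rule lim.hyps)
      then show "norm \<bar>s n x - f x\<bar> \<le> 3 * \<bar>f x\<bar>" by simp
    qed
  qed (use lim.hyps in auto)
  then have "\<forall>\<^sub>F n in sequentially. (\<integral>x. \<bar>s n x - f x\<bar> \<partial>lam) < e / 2"
    using lim.prems by (intro order_tendstoD(2)[where y = 0]) simp_all
  then obtain n where n: "(\<integral>x. \<bar>s n x - f x\<bar> \<partial>lam) < e / 2" by (auto simp: eventually_sequentially)
  obtain \<rho> where \<rho>: "inner_test \<rho>" "(\<integral>x. \<bar>indicator \<Omega> x * s n x - \<rho> x\<bar> \<partial>lam) < e / 2"
    using lim.IH[of "e / 2" n] lim.prems by auto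
  note ii = i[OF lim.hyps(1)[of n]] inner_test_integrable[OF \<rho>(1)] lim.hyps(1)[of n] \<open>integrable lam f\<close>
  have "\<bar>indicator \<Omega> x * f x - \<rho> x\<bar> \<le> \<bar>indicator \<Omega> x * s n x - \<rho> x\<bar> + \<bar>s n x - f x\<bar>" for x
    by (cases "x \<in> \<Omega>") auto
  then have "(\<integral>x. \<bar>indicator \<Omega> x * f x - \<rho> x\<bar> \<partial>lam)
      \<le> (\<integral>x. \<bar>indicator \<Omega> x * s n x - \<rho> x\<bar> + \<bar>s n x - f x\<bar> \<partial>lam)"
    by (intro integral_mono integrable_abs Bochner_Integration.integrable_diff
        Bochner_Integration.integrable_add ii i) auto
  also have "\<dots> = (\<integral>x. \<bar>indicator \<Omega> x * s n x - \<rho> x\<bar> \<partial>lam) + (\<integral>x. \<bar>s n x - f x\<bar> \<partial>lam)"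
    by (intro Bochner_Integration.integral_add integrable_abs Bochner_Integration.integrable_diff ii)
  also have "\<dots> < e" using n \<rho>(2) by simp
  finally show ?case using \<rho>(1) by blast
qed

text \<open>Each coordinate is approximated by test functions supported in \<Omega>, and the
  resulting combinations of fields with fixed direction \<open>b i\<close> are representable;
  closedness does the rest.\<close>

lemma L1_representable:
  assumes g: "g \<in> L1 b \<Omega>"
  shows "representable g"
proof (rule representable_closed[OF g])
  fix e :: real assume e: "e > 0"
  \<comment> \<open>The weights \<open>norm (b i)\<close> convert coordinate errors into an error in
    norm; the added 1 makes the divisor positive.\<close>
  define B where "B = (\<Sum>i\<in>UNIV. norm (b i)) + 1"
  have B: "B > 0" by (simp add: B_def sum_nonneg add_nonneg_pos)
  have ci: "integrable lam (\<lambda>x. co i (g x))" for i using L1_integrable[OF g] integrable_iff_co by blast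
  have ind: "indicator \<Omega> x * co i (g x) = co i (g x)" for i x
    using g by (cases "x \<in> \<Omega>") (auto simp: L1_iff linear_0[OF co_linear])
  have "\<exists>\<rho>. inner_test \<rho> \<and> (\<integral>x. \<bar>co i (g x) - \<rho> x\<bar> \<partial>lam) < e / B" for i
    using inner_test_dense[OF ci, of "e / B" i] e B by (simp add: ind)
  then obtain \<rho> where \<rho>: "\<And>i. inner_test (\<rho> i)" "\<And>i. (\<integral>x. \<bar>co i (g x) - \<rho> i x\<bar> \<partial>lam) < e / B" by metis
  define h where "h x = (\<Sum>i\<in>UNIV. \<rho> i x *\<^sub>R b i)" for x
  have "(\<lambda>x. \<rho> i x *\<^sub>R b i) \<in> L1 b \<Omega> \<and> representable (\<lambda>x. \<rho> i x *\<^sub>R b i)" for i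
    using \<rho>(1)[of i] representable_test unfolding inner_test_def by blast
  then have h: "h \<in> L1 b \<Omega> \<and> representable h"
    unfolding h_def by (intro representable_sum) auto
  have id: "integrable lam (\<lambda>x. \<bar>co i (g x) - \<rho> i x\<bar>)" for i
    by (intro integrable_abs Bochner_Integration.integrable_diff ci inner_test_integrable \<rho>)
  have "norm (g x - h x) \<le> (\<Sum>i\<in>UNIV. \<bar>co i (g x) - \<rho> i x\<bar> * norm (b i))" for x
  proof -
    have "g x - h x = (\<Sum>i\<in>UNIV. (co i (g x) - \<rho> i x) *\<^sub>R b i)"
      by (subst co_sum[of "g x", symmetric]) (simp add: h_def scaleR_diff_left sum_subtractf)
    then show ?thesis by (simp add: order_trans[OF norm_sum])
  qed
  then have "(\<integral>x. norm (g x - h x) \<partial>lam) \<le> (\<integral>x. (\<Sum>i\<in>UNIV. \<bar>co i (g x) - \<rho> i x\<bar> * norm (b i)) \<partial>lam)"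
    using h g by (intro integral_mono integrable_norm_co integrable_sub L1_integrable
        Bochner_Integration.integrable_sum integrable_mult_left id) auto
  also have "\<dots> = (\<Sum>i\<in>UNIV. (\<integral>x. \<bar>co i (g x) - \<rho> i x\<bar> \<partial>lam) * norm (b i))"
    by (subst Bochner_Integration.integral_sum) (auto intro!: integrable_mult_left id)
  also have "\<dots> \<le> (\<Sum>i\<in>UNIV. (e / B) * norm (b i))"
    using \<rho>(2) by (intro sum_mono mult_right_mono) (auto simp: less_imp_le)
  also have "\<dots> = (e / B) * (B - 1)" by (simp add: B_def sum_distrib_left)
  also have "\<dots> \<le> e" using e B by (simp add: field_simps)
  finally show "\<exists>h\<in>L1 b \<Omega>. representable h \<and> (\<integral>x. norm (g x - h x) \<partial>lam) \<le> e" using h by blast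
qed

section \<open>The quotient map and its isometry\<close>

lemma Y_rel_iff:
  "(g, h) \<in> Y_rel b \<Omega> \<longleftrightarrow> g \<in> L1 b \<Omega> \<and> h \<in> L1 b \<Omega> \<and> (\<forall>\<phi>\<in>test_functions. pair g \<phi> = pair h \<phi>)"
proof -
  have "(\<lambda>x. g x - h x) \<in> Y_space b \<Omega> \<longleftrightarrow> (\<forall>\<phi>\<in>test_functions. pair g \<phi> = pair h \<phi>)"
    if g: "g \<in> L1 b \<Omega>" and h: "h \<in> L1 b \<Omega>"
  proof -
    have i: "integrable lam (\<lambda>x. g x - h x)" by (intro integrable_sub L1_integrable g h)
    then have "(\<lambda>x. g x - h x) \<in> L1 b \<Omega>" using g h by (auto simp: L1_iff)
    then show ?thesis
      by (auto simp: Y_space_def eq_distribution_def div_distribution_eq[OF i]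
          pair_diff[OF L1_integrable[OF g] L1_integrable[OF h]])
  qed
  then show ?thesis by (auto simp: Y_rel_def)
qed

lemma Y_class_iff:
  "g \<in> L1 b \<Omega> \<Longrightarrow> h \<in> Y_class b \<Omega> g \<longleftrightarrow> h \<in> L1 b \<Omega> \<and> (\<forall>\<phi>\<in>test_functions. pair g \<phi> = pair h \<phi>)"
  by (simp add: Y_class_def Y_rel_iff)

text \<open>Some member of the class matches \<open>\<psi>\<close> exactly when all of them do, so
  no representative has to be chosen.\<close>

definition \<Phi> :: "('e \<Rightarrow> 'e) set \<Rightarrow> ('e \<Rightarrow> real) \<Rightarrow> real" where
  "\<Phi> c = (THE \<psi>. \<psi> \<in> F \<and> (\<exists>g\<in>c. matches g \<psi>))"

lemma Y_class_matches:
  assumes g: "g \<in> L1 b \<Omega>"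
  shows "(\<exists>h\<in>Y_class b \<Omega> g. matches h \<psi>) \<longleftrightarrow> matches g \<psi>"
  using g by (auto simp: Y_class_iff matches_def)

text \<open>Existence is the representability of every field, uniqueness comes from the
  approximation by test functions. From here on all claims about \<open>\<Phi>\<close> are claims
  about \<open>matches\<close>.\<close>

lemma \<Phi>_iff:
  assumes g: "g \<in> L1 b \<Omega>"
  shows "\<Phi> (Y_class b \<Omega> g) = \<psi> \<longleftrightarrow> \<psi> \<in> F \<and> matches g \<psi>"
proof -
  obtain u where u: "u \<in> F" "matches g u" using L1_representable[OF g] unfolding representable_def by blast
  have "\<Phi> (Y_class b \<Omega> g) = u"
    unfolding \<Phi>_def Y_class_matches[OF g]
    by (rule the_equality) (use u matches_unique[OF _ u(1) L1_integrable[OF g] _ u(2)] in blast)+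
  then show ?thesis using u matches_unique[OF _ u(1) L1_integrable[OF g] _ u(2)] by blast
qed

lemma quotient_eq: "L1 b \<Omega> // Y_rel b \<Omega> = Y_class b \<Omega> ` L1 b \<Omega>"
  by (auto simp: quotient_def Y_class_def)

text \<open>Every representative has norm at least that of the functional, and the lifting gives
  representatives with norm as close to it as desired; the lifting also yields surjectivity.\<close>

lemma \<Phi>_isometry: "surjective_linear_isometry b \<Omega> p \<Phi>"
  unfolding surjective_linear_isometry_def quotient_eq
proof (intro conjI ballI allI)
  note char = \<Phi>_iff[THEN iffD1, OF _ refl]
  show "\<Phi> ` Y_class b \<Omega> ` L1 b \<Omega> = F"
  proof (intro equalityI subsetI)
    fix \<psi> assume "\<psi> \<in> F"
    then obtain g where "g \<in> L1 b \<Omega>" "matches g \<psi>" using free_lift[of \<psi> 1] by auto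
    then show "\<psi> \<in> \<Phi> ` Y_class b \<Omega> ` L1 b \<Omega>" using \<open>\<psi> \<in> F\<close> \<Phi>_iff[of g \<psi>] by blast
  qed (use char in auto)
  fix g h assume g: "g \<in> L1 b \<Omega>" and h: "h \<in> L1 b \<Omega>"
  show "\<Phi> (Y_class b \<Omega> (\<lambda>x. g x + h x)) = (\<lambda>f. \<Phi> (Y_class b \<Omega> g) f + \<Phi> (Y_class b \<Omega> h) f)"
    unfolding \<Phi>_iff[OF L1_add[OF g h]]
    using char[OF g] char[OF h] g h by (simp add: lipschitz_free_add[OF p] matches_add L1_integrable)
next
  note char = \<Phi>_iff[THEN iffD1, OF _ refl]
  fix r g assume g: "g \<in> L1 b \<Omega>"
  show "\<Phi> (Y_class b \<Omega> (\<lambda>x. r *\<^sub>R g x)) = (\<lambda>f. r * \<Phi> (Y_class b \<Omega> g) f)"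
    unfolding \<Phi>_iff[OF L1_scale[OF g]] using char[OF g] by (simp add: lipschitz_free_scale[OF p] matches_scale)
next
  fix c assume "c \<in> Y_class b \<Omega> ` L1 b \<Omega>"
  then obtain g where g: "g \<in> L1 b \<Omega>" and c: "c = Y_class b \<Omega> g" by blast
  define \<psi> where "\<psi> = \<Phi> c"
  have \<psi>: "\<psi> \<in> F" "matches g \<psi>" using \<Phi>_iff[OF g, of \<psi>] by (auto simp: \<psi>_def c)
  \<comment> \<open>The class is the whole fibre over \<open>\<psi>\<close>, so a field obtained by
    lifting \<open>\<psi>\<close> automatically lies in it.\<close>
  have mem: "h \<in> c \<longleftrightarrow> h \<in> L1 b \<Omega> \<and> matches h \<psi>" for h
    using \<psi>(2) by (auto simp: c Y_class_iff[OF g] matches_def)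
  show "dual_norm \<Omega> p (\<Phi> c) = quotient_norm b \<Omega> c"
    unfolding \<psi>_def[symmetric] quotient_norm_def
  proof (rule antisym)
    show "dual_norm \<Omega> p \<psi> \<le> Inf (L1_norm b \<Omega> ` c)"
    proof (rule cINF_greatest)
      show "c \<noteq> {}" using mem g \<psi>(2) by blast
      fix h assume "h \<in> c"
      then show "dual_norm \<Omega> p \<psi> \<le> L1_norm b \<Omega> h"
        using matches_norm[OF \<psi>(1)] by (simp add: mem L1_norm_eq L1_integrable)
    qed
    show "Inf (L1_norm b \<Omega> ` c) \<le> dual_norm \<Omega> p \<psi>"
    proof (rule field_le_epsilon)
      fix e :: real assume "e > 0"
      then obtain h where h: "h \<in> L1 b \<Omega>" "matches h \<psi>" "(\<integral>x. norm (h x) \<partial>lam) \<le> dual_norm \<Omega> p \<psi> + e"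
        using free_lift[OF \<psi>(1)] by blast
      have "Inf (L1_norm b \<Omega> ` c) \<le> L1_norm b \<Omega> h"
      proof (rule cINF_lower)
        show "bdd_below (L1_norm b \<Omega> ` c)"
          by (rule bdd_belowI2[of _ 0]) (simp add: mem L1_norm_eq)
      qed (simp add: mem h)
      then show "Inf (L1_norm b \<Omega> ` c) \<le> dual_norm \<Omega> p \<psi> + e" using h by (simp add: L1_norm_eq)
    qed
  qed
qed

text \<open>On test functions the evaluation at \<open>a\<close> becomes
  \<open>\<phi> a - \<phi> p\<close> because of the normalisation at \<open>p\<close>. The
  divergence is minus the pairing, which reverses the order of the two Dirac measures.\<close>

lemma \<Phi>_delta_iff:
  assumes a: "a \<in> \<Omega>" and g: "g \<in> L1 b \<Omega>"
  shows "\<Phi> (Y_class b \<Omega> g) = delta \<Omega> p a \<longleftrightarrow>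
    eq_distribution (div_distribution b g) (\<lambda>\<phi>. dirac_distribution p \<phi> - dirac_distribution a \<phi>)"
proof -
  have "dirac_distribution x \<phi> = \<phi> x" if "\<phi> \<in> test_functions" for x and \<phi> :: "'e \<Rightarrow> real"
    unfolding dirac_distribution_def using test_measurable[OF that] by (intro integral_return) auto
  moreover have "delta \<Omega> p a \<in> F" by (rule delta_span_free[OF p delta_in_span[OF a]])
  ultimately show ?thesis
    unfolding \<Phi>_iff[OF g] matches_def eq_distribution_def
    by (auto simp: div_distribution_eq[OF L1_integrable[OF g]] delta_res[OF a] algebra_simps)
qed

end

theorem theorem1p1:
  fixes b :: "'n::finite \<Rightarrow> 'e::{real_normed_vector, second_countable_topology}"
    and \<Omega> :: "'e set" and p :: 'e
  assumes "is_basis b"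
    and "\<Omega> \<noteq> {}" and "open \<Omega>" and "convex \<Omega>" and "p \<in> \<Omega>"
  shows "\<exists>\<Phi>. surjective_linear_isometry b \<Omega> p \<Phi> \<and>
    (\<forall>a\<in>\<Omega>. \<forall>g\<in>L1 b \<Omega>.
       \<Phi> (Y_class b \<Omega> g) = delta \<Omega> p a \<longleftrightarrow>
       eq_distribution (div_distribution b g)
         (\<lambda>\<phi>. dirac_distribution p \<phi> - dirac_distribution a \<phi>))"
proof -
  interpret convex_domain b \<Omega> p
    using assms by unfold_locales
  show ?thesis using \<Phi>_isometry \<Phi>_delta_iff by blast
qed

end
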